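(* Consider the Greedy-GQ iterates $(\theta_t,\omega_t)$ run for horizon $T$ with constant stepsizes $\alpha_t=\alpha=\frac{1}{T^a}$ and $\beta_t=\beta=\frac{1}{T^b}$ for $0\le t\le T$, where $\frac12<a\le 1$ and $0<b\le a$. Let $M$ be a random index, independent of the sample trajectory, with $\mathbb{P}(M=k)=\frac{\alpha_k}{\sum_{t=0}^T\alpha_t}$ for $k\in\{0,1,\dots,T\}$. Then, for $T>0$, $$\mathbb{E}\big[\|\nabla J(\theta_M)\|^2\big]=\mathcal{O}\left(\frac{1}{T^{1-a}}+\frac{\log T}{T^{\min\{b,a-b\}}}\right),$$ where the constant hidden in $\mathcal O(\cdot)$ does not depend on $T$.
   Context: Setting. An MDP has state space $\mathcal S\subset\mathbb R^d$, finite action set $\mathcal A$, transition kernel $\mathsf P(\cdot|s,a)$, discount factor $\gamma\in(0,1)$, and reward $r:\mathcal S\times\mathcal A\times\mathcal S\to[0,r_{\max}]$. Features $\phi_{s,a}\in\mathbb R^N$ are given and $Q_\theta(s,a)=\phi_{s,a}^\top\theta$, $\theta\in\mathbb R^N$. A fixed behavior policy $\pi_b$ generates a single trajectory: $s_0$ is given, $a_t\sim\pi_b(\cdot|s_t)$, $s_{t+1}\sim\mathsf P(\cdot|s_t,a_t)$, $r_t=r(s_t,a_t,s_{t+1})$. The Markov chain $(s_t,a_t)$ is uniformly ergodic with invariant measure $\mu$ on $\mathcal S\times\mathcal A$. A parameterized target policy $\pi_\theta(\cdot|s)$, differentiable in $\theta$, is given. Notation. $\|\cdot\|$ is the Euclidean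 norm. $\bar V_{s'}(\theta)=\sum_{a'\in\mathcal A}\pi_\theta(a'|s')\theta^\top\phi_{s',a'}$; $\delta_{s,a,s'}(\theta)=r(s,a,s')+\gamma\bar V_{s'}(\theta)-\theta^\top\phi_{s,a}$; $\hat\phi_{s'}(\theta)=\nabla_\theta\bar V_{s'}(\theta)=\sum_{a'\in\mathcal A}\big(\theta^\top\phi_{s',a'}\nabla\pi_\theta(a'|s')+\pi_\theta(a'|s')\phi_{s',a'}\big)$; $C=\mathbb E_\mu[\phi_{S,A}\phi_{S,A}^\top]$. The objective (mean squared projected Bellman error) is $$J(\theta)=\mathbb E_\mu[\delta_{S,A,S'}(\theta)\phi_{S,A}]^\top C^{-1}\,\mathbb E_\mu[\delta_{S,A,S'}(\theta)\phi_{S,A}],$$ where $\mathbb E_\mu$ means $(S,A)\sim\mu$, $S'\sim\mathsf P(\cdot|S,A)$. Greedy-GQ algorithm. From given $\theta_0,\omega_0\in\mathbb R^N$, with $\phi_t=\phi_{s_t,a_t}$, $\delta_{t+1}(\theta)=\delta_{s_t,a_t,s_{t+1}}(\theta)$, $\hat\phi_{t+1}(\theta)=\hat\phi_{s_{t+1}}(\theta)$, $$\theta_{t+1}=\theta_t+\alpha_t\big(\delta_{t+1}(\theta_t)\phi_t-\gamma(\omega_t^\top\phi_t)\hat\phi_{t+1}(\theta_t)\big),\qquad \omega_{t+1}=\omega_t+\beta_t\big(\delta_{t+1}(\theta_t)-\phi_t^\top\omega_t\big)\phi_t.$$ Standing assumptions. (1) $C$ is non-singular. (2) $\|\phi_{s,a}\|\le1$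 for all $(s,a)$. (3) There are $m>0$, $\rho\in(0,1)$ with $\sup_{s\in\mathcal S}d_{TV}(\mathbb P(s_t\in\cdot\,|s_0=s),\mu)\le m\rho^t$ for all $t>0$, where $d_{TV}$ is total variation distance and $\mu$ here denotes its marginal on $\mathcal S$. (4) For constants $k_1,k_2$ and all $(s,a)$: $\|\nabla\pi_\theta(a|s)\|\le k_1$ for all $\theta$, and $\|\nabla\pi_{\theta_1}(a|s)-\nabla\pi_{\theta_2}(a|s)\|\le k_2\|\theta_1-\theta_2\|$ for all $\theta_1,\theta_2$. (5) There is a constant $R$ (independent of $T$) such that $\|\theta_t\|\le R$ and $\|\omega_t\|\le R$ almost surely for all $t$. *)

theory Defs
  imports "HOL-Probability.Probability"
begin

section \<open>Gradients, total variation, and Markov kernels\<close>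

definition grad :: "('v::real_inner \<Rightarrow> real) \<Rightarrow> 'v \<Rightarrow> 'v" where
  "grad f x = (THE D. GDERIV f x :> D)"

definition tv_dist :: "'x measure \<Rightarrow> 'x measure \<Rightarrow> real" where
  "tv_dist p q = (SUP B\<in>sets p. \<bar>measure p B - measure q B\<bar>)"

primrec kernel_pow :: "'x measure \<Rightarrow> ('x \<Rightarrow> 'x measure) \<Rightarrow> nat \<Rightarrow> 'x \<Rightarrow> 'x measure" where
  "kernel_pow X K 0 x = return X x"
| "kernel_pow X K (Suc t) x = kernel_pow X K t x \<bind> K"

definition invariant_measure :: "'x measure \<Rightarrow> ('x \<Rightarrow> 'x measure) \<Rightarrow> 'x measure \<Rightarrow> bool" where
  "invariant_measure X K \<mu> \<longleftrightarrow> \<mu> \<in> space (prob_algebra X) \<and> \<mu> \<bind> K = \<mu>"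

definition uniformly_ergodic :: "'x measure \<Rightarrow> ('x \<Rightarrow> 'x measure) \<Rightarrow> 'x measure \<Rightarrow> bool" where
  "uniformly_ergodic X K \<mu> \<longleftrightarrow> invariant_measure X K \<mu> \<and>
     (\<lambda>t. SUP x\<in>space X. tv_dist (kernel_pow X K t x) \<mu>) \<longlonglongrightarrow> 0"

section \<open>The decision process under the behavior policy\<close>

text \<open>Actions range over a finite type. The transition kernel is a function on state-action pairs;
  a policy assigns to each state a distribution on actions.\<close>

definition state_space :: "(real^'d) set \<Rightarrow> (real^'d) measure" where
  "state_space S = restrict_space borel S"

definition sa_space :: "(real^'d) set \<Rightarrow> ((real^'d) \<times> 'a::finite) measure" where
  "sa_space S = state_space S \<Otimes>\<^sub>M count_space UNIV"

definition measurable_policy :: "(real^'d) set \<Rightarrow> (real^'d \<Rightarrow> 'a::finite pmf) \<Rightarrow> bool" where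
  "measurable_policy S p \<longleftrightarrow> (\<forall>a. (\<lambda>s. pmf (p s) a) \<in> borel_measurable (state_space S))"

definition state_kernel ::
    "((real^'d) \<times> 'a \<Rightarrow> (real^'d) measure) \<Rightarrow> (real^'d \<Rightarrow> 'a::finite pmf) \<Rightarrow> real^'d \<Rightarrow> (real^'d) measure" where
  "state_kernel P pib s = measure_pmf (pib s) \<bind> (\<lambda>a. P (s, a))"

definition sa_kernel ::
    "(real^'d) set \<Rightarrow> ((real^'d) \<times> 'a \<Rightarrow> (real^'d) measure) \<Rightarrow> (real^'d \<Rightarrow> 'a::finite pmf) \<Rightarrow>
     (real^'d) \<times> 'a \<Rightarrow> ((real^'d) \<times> 'a) measure" where
  "sa_kernel S P pib x =
     P x \<bind> (\<lambda>s'. distr (measure_pmf (pib s')) (sa_space S) (\<lambda>a'. (s', a')))"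

text \<open>Sub-sigma-algebras generated by the history: with \<open>n\<close> actions revealed, the states up to
  time \<open>t\<close> and the actions at times \<open>i < n\<close>.\<close>

definition history ::
    "'w measure \<Rightarrow> (real^'d) set \<Rightarrow> (nat \<Rightarrow> 'w \<Rightarrow> real^'d) \<Rightarrow> (nat \<Rightarrow> 'w \<Rightarrow> 'a::finite) \<Rightarrow>
     nat \<Rightarrow> nat \<Rightarrow> 'w measure" where
  "history \<Omega> S st act t n = sigma (space \<Omega>)
     ({st i -` B \<inter> space \<Omega> | i B. i \<le> t \<and> B \<in> sets (state_space S)} \<union>
      {act i -` B \<inter> space \<Omega> | i B. i < n})"

text \<open>The last two clauses say \<open>a\<^sub>t \<sim> \<pi>\<^sub>b(\<cdot>|s\<^sub>t)\<close> given \<open>s\<^sub>0, a\<^sub>0, \<dots>, s\<^sub>t\<close>, and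
  \<open>s\<^sub>t\<^sub>+\<^sub>1 \<sim> P(\<cdot>|s\<^sub>t, a\<^sub>t)\<close> given \<open>s\<^sub>0, a\<^sub>0, \<dots>, s\<^sub>t, a\<^sub>t\<close>.\<close>

definition behavior_trajectory ::
    "'w measure \<Rightarrow> (real^'d) set \<Rightarrow> ((real^'d) \<times> 'a \<Rightarrow> (real^'d) measure) \<Rightarrow>
     (real^'d \<Rightarrow> 'a::finite pmf) \<Rightarrow> real^'d \<Rightarrow> (nat \<Rightarrow> 'w \<Rightarrow> real^'d) \<Rightarrow> (nat \<Rightarrow> 'w \<Rightarrow> 'a) \<Rightarrow> bool" where
  "behavior_trajectory \<Omega> S P pib s0 st act \<longleftrightarrow>
     (\<forall>t. st t \<in> \<Omega> \<rightarrow>\<^sub>M state_space S) \<and>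
     (\<forall>t. act t \<in> \<Omega> \<rightarrow>\<^sub>M count_space UNIV) \<and>
     (AE x in \<Omega>. st 0 x = s0) \<and>
     (\<forall>t a. AE x in \<Omega>.
        real_cond_exp \<Omega> (history \<Omega> S st act t t)
          (indicator (act t -` {a} \<inter> space \<Omega>)) x = pmf (pib (st t x)) a) \<and>
     (\<forall>t. \<forall>B\<in>sets (state_space S). AE x in \<Omega>.
        real_cond_exp \<Omega> (history \<Omega> S st act t (Suc t))
          (indicator (st (Suc t) -` B \<inter> space \<Omega>)) x = measure (P (st t x, act t x)) B)"

section \<open>Linear function approximation and the objective\<close>

type_synonym ('d, 'a, 'n) features = "real^'d \<Rightarrow> 'a \<Rightarrow> real^'n"
type_synonym ('d, 'a, 'n) policy_family = "real^'n \<Rightarrow> real^'d \<Rightarrow> 'a pmf"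
type_synonym ('d, 'a) reward = "real^'d \<Rightarrow> 'a \<Rightarrow> real^'d \<Rightarrow> real"

definition Vbar ::
    "('d, 'a::finite, 'n::finite) features \<Rightarrow> ('d, 'a, 'n) policy_family \<Rightarrow> real^'n \<Rightarrow> real^'d \<Rightarrow> real" where
  "Vbar \<phi> \<pi> \<theta> s' = (\<Sum>a'\<in>UNIV. pmf (\<pi> \<theta> s') a' * (\<theta> \<bullet> \<phi> s' a'))"

definition td_error ::
    "('d, 'a::finite) reward \<Rightarrow> real \<Rightarrow> ('d, 'a, 'n::finite) features \<Rightarrow> ('d, 'a, 'n) policy_family \<Rightarrow>
     real^'n \<Rightarrow> real^'d \<Rightarrow> 'a \<Rightarrow> real^'d \<Rightarrow> real" where
  "td_error r \<gamma> \<phi> \<pi> \<theta> s a s' = r s a s' + \<gamma> * Vbar \<phi> \<pi> \<theta> s' - \<theta> \<bullet> \<phi> s a"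

text \<open>The gradient of \<open>Vbar \<phi> \<pi> \<theta> s'\<close> in \<open>\<theta>\<close>, expanded by the product rule.\<close>

definition phi_hat ::
    "('d, 'a::finite, 'n::finite) features \<Rightarrow> ('d, 'a, 'n) policy_family \<Rightarrow> real^'n \<Rightarrow> real^'d \<Rightarrow> real^'n" where
  "phi_hat \<phi> \<pi> \<theta> s' =
     (\<Sum>a'\<in>UNIV. (\<theta> \<bullet> \<phi> s' a') *\<^sub>R grad (\<lambda>\<eta>. pmf (\<pi> \<eta> s') a') \<theta>
        + pmf (\<pi> \<theta> s') a' *\<^sub>R \<phi> s' a')"

definition feature_cov ::
    "((real^'d) \<times> 'a) measure \<Rightarrow> ('d, 'a::finite, 'n::finite) features \<Rightarrow> real^'n^'n" where
  "feature_cov \<mu> \<phi> = (\<chi> i j. \<integral>(s, a). \<phi> s a $ i * \<phi> s a $ j \<partial>\<mu>)"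

text \<open>The law of \<open>((S, A), S')\<close> with \<open>(S, A) \<sim> \<mu>\<close> and \<open>S' \<sim> P(\<cdot>|S, A)\<close>.\<close>

definition transition_law ::
    "(real^'d) set \<Rightarrow> ((real^'d) \<times> 'a::finite \<Rightarrow> (real^'d) measure) \<Rightarrow> ((real^'d) \<times> 'a) measure \<Rightarrow>
     (((real^'d) \<times> 'a) \<times> (real^'d)) measure" where
  "transition_law S P \<mu> =
     \<mu> \<bind> (\<lambda>x. distr (P x) (sa_space S \<Otimes>\<^sub>M state_space S) (\<lambda>s'. (x, s')))"

definition mean_td_update ::
    "(real^'d) set \<Rightarrow> ((real^'d) \<times> 'a::finite \<Rightarrow> (real^'d) measure) \<Rightarrow> ((real^'d) \<times> 'a) measure \<Rightarrow>
     ('d, 'a) reward \<Rightarrow> real \<Rightarrow> ('d, 'a, 'n::finite) features \<Rightarrow> ('d, 'a, 'n) policy_family \<Rightarrow>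
     real^'n \<Rightarrow> real^'n" where
  "mean_td_update S P \<mu> r \<gamma> \<phi> \<pi> \<theta> =
     (\<integral>((s, a), s'). td_error r \<gamma> \<phi> \<pi> \<theta> s a s' *\<^sub>R \<phi> s a \<partial>transition_law S P \<mu>)"

definition MSPBE ::
    "(real^'d) set \<Rightarrow> ((real^'d) \<times> 'a::finite \<Rightarrow> (real^'d) measure) \<Rightarrow> ((real^'d) \<times> 'a) measure \<Rightarrow>
     ('d, 'a) reward \<Rightarrow> real \<Rightarrow> ('d, 'a, 'n::finite) features \<Rightarrow> ('d, 'a, 'n) policy_family \<Rightarrow>
     real^'n \<Rightarrow> real" where
  "MSPBE S P \<mu> r \<gamma> \<phi> \<pi> \<theta> =
     mean_td_update S P \<mu> r \<gamma> \<phi> \<pi> \<theta> \<bullet>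
       (matrix_inv (feature_cov \<mu> \<phi>) *v mean_td_update S P \<mu> r \<gamma> \<phi> \<pi> \<theta>)"

section \<open>Greedy-GQ\<close>

text \<open>The pair \<open>(\<theta>\<^sub>t, \<omega>\<^sub>t)\<close> computed along a given sequence of states and actions.\<close>

primrec greedy_gq ::
    "('d, 'a::finite) reward \<Rightarrow> real \<Rightarrow> ('d, 'a, 'n::finite) features \<Rightarrow> ('d, 'a, 'n) policy_family \<Rightarrow>
     (nat \<Rightarrow> real) \<Rightarrow> (nat \<Rightarrow> real) \<Rightarrow> real^'n \<Rightarrow> real^'n \<Rightarrow> (nat \<Rightarrow> real^'d) \<Rightarrow> (nat \<Rightarrow> 'a) \<Rightarrow>
     nat \<Rightarrow> (real^'n) \<times> (real^'n)" where
  "greedy_gq r \<gamma> \<phi> \<pi> \<alpha> \<beta> \<theta>0 \<omega>0 s a 0 = (\<theta>0, \<omega>0)"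
| "greedy_gq r \<gamma> \<phi> \<pi> \<alpha> \<beta> \<theta>0 \<omega>0 s a (Suc t) =
     (let (\<theta>, \<omega>) = greedy_gq r \<gamma> \<phi> \<pi> \<alpha> \<beta> \<theta>0 \<omega>0 s a t;
          f = \<phi> (s t) (a t);
          \<delta> = td_error r \<gamma> \<phi> \<pi> \<theta> (s t) (a t) (s (Suc t))
      in (\<theta> + \<alpha> t *\<^sub>R (\<delta> *\<^sub>R f - (\<gamma> * (\<omega> \<bullet> f)) *\<^sub>R phi_hat \<phi> \<pi> \<theta> (s (Suc t))),
          \<omega> + \<beta> t *\<^sub>R ((\<delta> - f \<bullet> \<omega>) *\<^sub>R f)))"

definition stepsize :: "nat \<Rightarrow> real \<Rightarrow> nat \<Rightarrow> real" where
  "stepsize T c t = 1 / real T powr c"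

text \<open>The horizon-\<open>T\<close> run with \<open>\<alpha>\<^sub>t = T\<^sup>-\<^sup>a\<close> and \<open>\<beta>\<^sub>t = T\<^sup>-\<^sup>b\<close>,
  evaluated at a sample point of the trajectory.\<close>

definition gq_run ::
    "('d, 'a::finite) reward \<Rightarrow> real \<Rightarrow> ('d, 'a, 'n::finite) features \<Rightarrow> ('d, 'a, 'n) policy_family \<Rightarrow>
     real \<Rightarrow> real \<Rightarrow> real^'n \<Rightarrow> real^'n \<Rightarrow> (nat \<Rightarrow> 'w \<Rightarrow> real^'d) \<Rightarrow> (nat \<Rightarrow> 'w \<Rightarrow> 'a) \<Rightarrow>
     nat \<Rightarrow> nat \<Rightarrow> 'w \<Rightarrow> (real^'n) \<times> (real^'n)" where
  "gq_run r \<gamma> \<phi> \<pi> a b \<theta>0 \<omega>0 st act T t x =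
     greedy_gq r \<gamma> \<phi> \<pi> (stepsize T a) (stepsize T b) \<theta>0 \<omega>0 (\<lambda>i. st i x) (\<lambda>i. act i x) t"

definition random_index ::
    "'w measure \<Rightarrow> (real^'d) set \<Rightarrow> (nat \<Rightarrow> 'w \<Rightarrow> real^'d) \<Rightarrow> (nat \<Rightarrow> 'w \<Rightarrow> 'a::finite) \<Rightarrow>
     (nat \<Rightarrow> real) \<Rightarrow> nat \<Rightarrow> ('w \<Rightarrow> nat) \<Rightarrow> bool" where
  "random_index \<Omega> S st act \<alpha> T M \<longleftrightarrow>
     M \<in> \<Omega> \<rightarrow>\<^sub>M count_space UNIV \<and>
     prob_space.indep_set \<Omega> {M -` N \<inter> space \<Omega> | N. True}
       {(\<lambda>x t. (st t x, act t x)) -` B \<inter> space \<Omega> | B. B \<in> sets (\<Pi>\<^sub>M t\<in>UNIV. sa_space S)} \<and>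
     (\<forall>k\<le>T. measure \<Omega> {x \<in> space \<Omega>. M x = k} = \<alpha> k / (\<Sum>t\<le>T. \<alpha> t))"

end

theory Submission
  imports Defs
begin

text \<open>Write \<open>W \<theta> = C\<^sup>-\<^sup>1 E[\<delta>(\<theta>) \<phi>]\<close>, so that the fast iterate \<open>\<omega>\<close> tracks \<open>W \<theta>\<close> and the mean slow
  update at \<open>\<omega> = W \<theta>\<close> is \<open>- \<nabla>J(\<theta>) / 2\<close>. On the ball containing the iterates everything is bounded
  and Lipschitz. The descent inequality for \<open>J\<close> bounds \<open>\<alpha> \<parallel>\<nabla>J\<parallel>\<^sup>2\<close> by a telescoping term plus
  \<open>\<alpha> \<parallel>\<omega> - W \<theta>\<parallel>\<^sup>2\<close>, and since \<open>C\<close> is positive definite the tracking error contracts at rate \<open>\<beta>\<close>,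
  up to the drift \<open>O(\<alpha>)\<close> of \<open>W \<theta>\<close> and \<open>O(\<beta>\<^sup>2)\<close>; summing gives the average error
  \<open>1/(T \<alpha>) + 1/(T \<beta>) + \<alpha>/\<beta> + \<beta>\<close>. Markov noise is handled by conditioning \<open>\<tau> = O(log T)\<close> steps
  back, at a cost \<open>O(\<beta> \<tau> + \<rho>\<^sup>\<tau>)\<close>.\<close>

section \<open>Gradients and functions bounded and Lipschitz on a set\<close>

text \<open>Two obstacles shape the proof. Mixing is assumed for the states alone, whereas the noise
  is a function of a whole transition \<open>((s, a), s')\<close> and of an iterate depending on the
  past. Averaging out the action and the next state leaves a function of the state, to which mixing
  applies; the stationary averages agree because invariance determines the conditional law of the
  action under \<open>\<mu>\<close>. The iterate is carried along as a parameter measurable with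
  respect to the history.

  The second obstacle is smoothness of the objective, which has to be derived. Nothing is
  differentiated under an integral: the Lipschitz gradient of the policy gives \<open>Vbar\<close> a
  quadratic remainder, uniform in the state; integrated, it becomes one for the objective, and this
  remainder is at once the proof of differentiability and the descent inequality. Constants are
  local to a ball because \<open>Vbar\<close> multiplies the policy by a term linear in
  \<open>\<theta>\<close>.

  The lag \<tau> stays free until the rates are computed; demanding
  \<open>\<rho> ^ \<tau> \<le> 1 / T\<close> makes it logarithmic, and this is where log T
  originates.\<close>

lemma GDERIV_unique:
  assumes "GDERIV f x :> D" "GDERIV f x :> E"
  shows "D = E"
proof -
  have "(\<lambda>h. h \<bullet> D) = (\<lambda>h. h \<bullet> E)"
    using assms unfolding gderiv_def by (rule has_derivative_unique)
  then have "(D - E) \<bullet> D = (D - E) \<bullet> E" by metis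
  then have "(D - E) \<bullet> (D - E) = 0" by (simp add: inner_diff_right)
  then show ?thesis by simp
qed

lemma grad_eq: "GDERIV f x :> D \<Longrightarrow> grad f x = D"
  unfolding grad_def using GDERIV_unique by blast

text \<open>The Riesz vector of the derivative, written out in the standard basis. It connects the
  plain differentiability of the policy with \<open>grad\<close>, which is a definite
  description.\<close>

lemma differentiable_imp_GDERIV:
  fixes f :: "'v::euclidean_space \<Rightarrow> real"
  assumes "f differentiable (at x)"
  shows "GDERIV f x :> grad f x"
proof -
  obtain f' where f': "(f has_derivative f') (at x)" using assms by (auto simp: differentiable_def)
  interpret bounded_linear f' using f' by (rule has_derivative_bounded_linear)
  have "f' h = h \<bullet> (\<Sum>b\<in>Basis. f' b *\<^sub>R b)" for h
  proof -
    have "f' h = f' (\<Sum>b\<in>Basis. (h \<bullet> b) *\<^sub>R b)" by (simp add: euclidean_representation)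
    also have "\<dots> = (\<Sum>b\<in>Basis. (h \<bullet> b) * f' b)" by (simp add: sum scaleR)
    also have "\<dots> = h \<bullet> (\<Sum>b\<in>Basis. f' b *\<^sub>R b)" by (simp add: inner_sum_right mult.commute)
    finally show ?thesis .
  qed
  then have "GDERIV f x :> (\<Sum>b\<in>Basis. f' b *\<^sub>R b)"
    unfolding gderiv_def by (intro has_derivative_eq_rhs[OF f'] ext)
  then show ?thesis using grad_eq by metis
qed

text \<open>Lets the gradient of the objective be read off from a Taylor estimate. The estimate is
  required only within distance one because the constant available for the objective depends on a
  ball.\<close>

lemma GDERIV_of_quadratic_remainder:
  fixes f :: "'v::real_inner \<Rightarrow> real"
  assumes "\<And>y. norm (y - x) \<le> 1 \<Longrightarrow> \<bar>f y - f x - D \<bullet> (y - x)\<bar> \<le> L * (norm (y - x))\<^sup>2"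
  shows "GDERIV f x :> D"
  unfolding gderiv_def
proof (rule has_derivativeI_sandwich[of 1])
  show "bounded_linear (\<lambda>h. h \<bullet> D)" by (rule bounded_linear_inner_left)
  show "((\<lambda>y. \<bar>L\<bar> * norm (y - x)) \<longlongrightarrow> 0) (at x)"
    by (auto intro!: tendsto_eq_intros)
  fix y assume y: "y \<noteq> x" "dist y x < 1"
  then have n: "0 < norm (y - x)" "norm (y - x) \<le> 1" by (auto simp: dist_norm)
  have "norm (f y - f x - (y - x) \<bullet> D) \<le> L * (norm (y - x))\<^sup>2"
    using assms[OF n(2)] by (simp add: inner_commute)
  also have "\<dots> \<le> (\<bar>L\<bar> * norm (y - x)) * norm (y - x)"
    using mult_right_mono[OF abs_ge_self[of L], of "norm (y - x) * norm (y - x)"]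
    by (simp add: power2_eq_square)
  finally show "norm (f y - f x - (y - x) \<bullet> D) / norm (y - x) \<le> \<bar>L\<bar> * norm (y - x)"
    using n by (simp add: field_simps)
qed simp

lemma GDERIV_segment:
  assumes "\<And>z. GDERIV f z :> g z"
  shows "((\<lambda>t. f (x + t *\<^sub>R (y - x))) has_real_derivative (y - x) \<bullet> g (x + t *\<^sub>R (y - x))) (at t)"
proof -
  have "(f has_derivative (\<lambda>h. h \<bullet> g (x + t *\<^sub>R (y - x)))) (at (x + t *\<^sub>R (y - x)))"
    using assms by (simp add: gderiv_def)
  moreover have "((\<lambda>t. x + t *\<^sub>R (y - x)) has_derivative (\<lambda>s. s *\<^sub>R (y - x))) (at t)"
    by (auto intro!: derivative_eq_intros)
  ultimately have "((\<lambda>t. f (x + t *\<^sub>R (y - x))) has_derivative (\<lambda>s. (s *\<^sub>R (y - x)) \<bullet> g (x + t *\<^sub>R (y - x)))) (at t)"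
    by (rule has_derivative_compose[rotated])
  then show ?thesis by (simp add: has_field_derivative_def mult.commute[of _ "_ \<bullet> _"])
qed

lemma GDERIV_segment_mvt:
  assumes "\<And>z. GDERIV f z :> g z"
  obtains t where "0 < t" "t < 1" "f y - f x = (y - x) \<bullet> g (x + t *\<^sub>R (y - x))"
proof -
  let ?h = "\<lambda>t::real. f (x + t *\<^sub>R (y - x))"
  have "\<exists>z::real. 0 < z \<and> z < 1 \<and> ?h 1 - ?h 0 = (1 - 0) * ((y - x) \<bullet> g (x + z *\<^sub>R (y - x)))"
    by (rule MVT2) (use GDERIV_segment[OF assms, where x=x and y=y] in auto)
  then show thesis using that by auto
qed

text \<open>The mean value theorem evaluates the gradient at one point of the segment, at distance
  at most \<open>norm (y - x)\<close> from \<open>x\<close>. Integrating along the segment would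
  halve the constant, which is immaterial here.\<close>

lemma quadratic_remainder_of_lipschitz_gradient:
  assumes g: "\<And>z. GDERIV f z :> g z"
    and lip: "\<And>z w. norm (g z - g w) \<le> k * norm (z - w)"
  shows "\<bar>f y - f x - g x \<bullet> (y - x)\<bar> \<le> k * (norm (y - x))\<^sup>2"
proof -
  obtain t where t: "0 < t" "t < 1" "f y - f x = (y - x) \<bullet> g (x + t *\<^sub>R (y - x))"
    using GDERIV_segment_mvt[OF g] by blast
  have "f y - f x - g x \<bullet> (y - x) = (y - x) \<bullet> (g (x + t *\<^sub>R (y - x)) - g x)"
    using t(3) by (simp add: inner_diff_right inner_commute)
  then have "\<bar>f y - f x - g x \<bullet> (y - x)\<bar> \<le> norm (y - x) * norm (g (x + t *\<^sub>R (y - x)) - g x)"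
    using Cauchy_Schwarz_ineq2 by metis
  also have "\<dots> \<le> norm (y - x) * (k * norm (t *\<^sub>R (y - x)))"
    using lip[of "x + t *\<^sub>R (y - x)" x] by (intro mult_left_mono) auto
  also have "\<dots> \<le> norm (y - x) * (k * norm (y - x))"
  proof (cases "y = x")
    case False
    \<comment> \<open>The sign of \<open>k\<close> is not given; the Lipschitz bound itself shows
      this product to be nonnegative.\<close>
    have "0 \<le> k * norm (y - x)" using lip[of y x] norm_ge_zero[of "g y - g x"] by linarith
    then have "\<bar>t\<bar> * (k * norm (y - x)) \<le> 1 * (k * norm (y - x))"
      using t by (intro mult_right_mono) auto
    then have "norm (y - x) * (\<bar>t\<bar> * (k * norm (y - x))) \<le> norm (y - x) * (1 * (k * norm (y - x)))"
      by (rule mult_left_mono) simp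
    then show ?thesis by (simp add: mult_ac)
  qed simp
  finally show ?thesis by (simp add: power2_eq_square mult_ac)
qed

section \<open>Calculus of families that are bounded and Lipschitz in a parameter\<close>

definition bounded_lipschitz_const ::
    "real \<Rightarrow> 'e::real_normed_vector set \<Rightarrow> 'x set \<Rightarrow> ('e \<Rightarrow> 'x \<Rightarrow> 'b::real_normed_vector) \<Rightarrow> bool" where
  "bounded_lipschitz_const c B X f \<longleftrightarrow> 0 < c \<and>
     (\<forall>x\<in>X. \<forall>e\<in>B. norm (f e x) \<le> c \<and> (\<forall>e'\<in>B. norm (f e x - f e' x) \<le> c * norm (e - e')))"

lemma bounded_lipschitz_constD:
  assumes "bounded_lipschitz_const c B X f"
  shows "0 < c" "x \<in> X \<Longrightarrow> e \<in> B \<Longrightarrow> norm (f e x) \<le> c"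
    "x \<in> X \<Longrightarrow> e \<in> B \<Longrightarrow> e' \<in> B \<Longrightarrow> norm (f e x - f e' x) \<le> c * norm (e - e')" "0 \<le> c"
  using assms by (auto simp: bounded_lipschitz_const_def)

text \<open>Hiding the constant makes closure under sums, products and integrals a matter of
  introduction rules; constants are extracted only where an estimate needs numbers. One constant
  serves as bound and as Lipschitz modulus, uniformly in the sample \<open>x\<close>.\<close>

definition bounded_lipschitz_on ::
    "'e::real_normed_vector set \<Rightarrow> 'x set \<Rightarrow> ('e \<Rightarrow> 'x \<Rightarrow> 'b::real_normed_vector) \<Rightarrow> bool" where
  "bounded_lipschitz_on B X f \<longleftrightarrow> (\<exists>c. bounded_lipschitz_const c B X f)"

lemma bounded_lipschitz_onI:
  assumes "\<And>x e. x \<in> X \<Longrightarrow> e \<in> B \<Longrightarrow> norm (f e x) \<le> c"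
    and "\<And>x e e'. x \<in> X \<Longrightarrow> e \<in> B \<Longrightarrow> e' \<in> B \<Longrightarrow> norm (f e x - f e' x) \<le> d * norm (e - e')"
  shows "bounded_lipschitz_on B X f"
  unfolding bounded_lipschitz_on_def bounded_lipschitz_const_def
proof (intro exI[of _ "\<bar>c\<bar> + \<bar>d\<bar> + 1"] conjI ballI)
  fix x e e' assume x: "x \<in> X" "e \<in> B"
  show "norm (f e x) \<le> \<bar>c\<bar> + \<bar>d\<bar> + 1" using assms(1)[OF x] by linarith
  assume e': "e' \<in> B"
  have "d * norm (e - e') \<le> (\<bar>c\<bar> + \<bar>d\<bar> + 1) * norm (e - e')" by (intro mult_right_mono) auto
  then show "norm (f e x - f e' x) \<le> (\<bar>c\<bar> + \<bar>d\<bar> + 1) * norm (e - e')" using assms(2)[OF x e'] by linarith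
qed simp

lemma bounded_lipschitz_onE:
  assumes "bounded_lipschitz_on B X f"
  obtains c where "bounded_lipschitz_const c B X f"
  using assms unfolding bounded_lipschitz_on_def by blast

named_theorems bl_intros

lemma bl_const:
  assumes "\<And>x. x \<in> X \<Longrightarrow> norm (h x) \<le> c"
  shows "bounded_lipschitz_on B X (\<lambda>e. h)"
  by (rule bounded_lipschitz_onI[where c=c and d=0]) (use assms in auto)

text \<open>The difference of products is split as (p - p') q + p' (q - q'); boundedness of each
  factor makes the product Lipschitz. Real products, scaling and inner products are all
  instances.\<close>

lemma bl_bilinear:
  assumes b: "bounded_bilinear pr" and f: "bounded_lipschitz_on B X f" and g: "bounded_lipschitz_on B X g"
  shows "bounded_lipschitz_on B X (\<lambda>e x. pr (f e x) (g e x))"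
proof -
  interpret bounded_bilinear pr by fact
  obtain K where K: "0 \<le> K" "\<And>a b. norm (pr a b) \<le> norm a * norm b * K" using nonneg_bounded by blast
  obtain c where "bounded_lipschitz_const c B X f"
    using f by (rule bounded_lipschitz_onE)
  note c = bounded_lipschitz_constD[OF this]
  obtain d where "bounded_lipschitz_const d B X g"
    using g by (rule bounded_lipschitz_onE)
  note d = bounded_lipschitz_constD[OF this]
  have pr_le: "norm (pr a b) \<le> p * q * K" if "norm a \<le> p" "norm b \<le> q" for a b p q
  proof -
    have "0 \<le> p" using that(1) norm_ge_zero order_trans by blast
    then have "norm a * norm b * K \<le> p * q * K"
      using that K(1) by (intro mult_right_mono mult_mono) auto
    then show ?thesis using K(2)[of a b] by linarith
  qed
  show ?thesis
  proof (rule bounded_lipschitz_onI[where c="c * d * K" and d="2 * (c * d * K)"])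
    fix x e assume x: "x \<in> X" "e \<in> B"
    show "norm (pr (f e x) (g e x)) \<le> c * d * K" using c(2)[OF x] d(2)[OF x] by (rule pr_le)
    fix e' assume e': "e' \<in> B"
    have "pr (f e x) (g e x) - pr (f e' x) (g e' x) = pr (f e x - f e' x) (g e x) + pr (f e' x) (g e x - g e' x)"
      by (simp add: diff_left diff_right)
    then have "norm (pr (f e x) (g e x) - pr (f e' x) (g e' x))
      \<le> norm (pr (f e x - f e' x) (g e x)) + norm (pr (f e' x) (g e x - g e' x))"
      using norm_triangle_ineq by metis
    also have "\<dots> \<le> (c * norm (e - e')) * d * K + c * (d * norm (e - e')) * K"
      using c(3)[OF x e'] d(2)[OF x] c(2)[OF x(1) e'] d(3)[OF x e'] by (intro add_mono pr_le)
    also have "\<dots> = 2 * (c * d * K) * norm (e - e')" by (simp add: algebra_simps)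
    finally show "norm (pr (f e x) (g e x) - pr (f e' x) (g e' x)) \<le> 2 * (c * d * K) * norm (e - e')" .
  qed
qed

lemmas bl_mult[bl_intros] = bl_bilinear[OF bounded_bilinear_mult]
  and bl_scaleR[bl_intros] = bl_bilinear[OF bounded_bilinear_scaleR]
  and bl_inner[bl_intros] = bl_bilinear[OF bounded_bilinear_inner]

lemma bl_linear:
  assumes b: "bounded_linear h" and f: "bounded_lipschitz_on B X f"
  shows "bounded_lipschitz_on B X (\<lambda>e x. h (f e x))"
proof -
  interpret bounded_linear h by fact
  obtain K where K: "0 \<le> K" "\<And>a. norm (h a) \<le> norm a * K" using nonneg_bounded by blast
  obtain c where "bounded_lipschitz_const c B X f"
    using f by (rule bounded_lipschitz_onE)
  note c = bounded_lipschitz_constD[OF this]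
  show ?thesis
  proof (rule bounded_lipschitz_onI[where c="c * K" and d="c * K"])
    fix x e assume x: "x \<in> X" "e \<in> B"
    show "norm (h (f e x)) \<le> c * K"
      using K(2)[of "f e x"] mult_right_mono[OF c(2)[OF x] K(1)] by linarith
    fix e' assume e': "e' \<in> B"
    have "norm (h (f e x) - h (f e' x)) \<le> norm (f e x - f e' x) * K"
      using K(2) by (metis diff)
    also have "\<dots> \<le> (c * norm (e - e')) * K" by (intro mult_right_mono c(3) x e' K)
    finally show "norm (h (f e x) - h (f e' x)) \<le> c * K * norm (e - e')" by (simp add: mult_ac)
  qed
qed

lemma bl_add[bl_intros]:
  assumes "bounded_lipschitz_on B X f" "bounded_lipschitz_on B X g"
  shows "bounded_lipschitz_on B X (\<lambda>e x. f e x + g e x)"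
proof -
  obtain c where "bounded_lipschitz_const c B X f"
    using assms(1) by (rule bounded_lipschitz_onE)
  note c = bounded_lipschitz_constD[OF this]
  obtain d where "bounded_lipschitz_const d B X g"
    using assms(2) by (rule bounded_lipschitz_onE)
  note d = bounded_lipschitz_constD[OF this]
  show ?thesis
  proof (rule bounded_lipschitz_onI[where c="c + d" and d="c + d"])
    fix x e assume x: "x \<in> X" "e \<in> B"
    show "norm (f e x + g e x) \<le> c + d" using c(2)[OF x] d(2)[OF x] by (rule norm_triangle_mono)
    fix e' assume e': "e' \<in> B"
    have "norm (f e x + g e x - (f e' x + g e' x)) = norm ((f e x - f e' x) + (g e x - g e' x))"
      by (simp add: algebra_simps)
    also have "\<dots> \<le> c * norm (e - e') + d * norm (e - e')"
      using c(3)[OF x e'] d(3)[OF x e'] by (rule norm_triangle_mono)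
    finally show "norm (f e x + g e x - (f e' x + g e' x)) \<le> (c + d) * norm (e - e')" by (simp add: algebra_simps)
  qed
qed

lemma bl_minus[bl_intros]: "bounded_lipschitz_on B X f \<Longrightarrow> bounded_lipschitz_on B X (\<lambda>e x. - f e x)"
  using bl_linear[OF bounded_linear_minus[OF bounded_linear_ident]] .

lemma bl_diff[bl_intros]:
  "bounded_lipschitz_on B X f \<Longrightarrow> bounded_lipschitz_on B X g \<Longrightarrow> bounded_lipschitz_on B X (\<lambda>e x. f e x - g e x)"
  using bl_add[OF _ bl_minus, of B X f g] by simp

lemma bl_sum[bl_intros]:
  "(\<And>i. i \<in> I \<Longrightarrow> bounded_lipschitz_on B X (f i)) \<Longrightarrow> bounded_lipschitz_on B X (\<lambda>e x. \<Sum>i\<in>I. f i e x)"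
proof (induction I rule: infinite_finite_induct)
  case (insert i I)
  have "bounded_lipschitz_on B X (\<lambda>e x. f i e x + (\<Sum>i\<in>I. f i e x))"
    using insert by (intro bl_add) auto
  then show ?case using insert by simp
qed (auto intro: bl_const[where c=0])

lemma bl_real[bl_intros]: "bounded_lipschitz_on B X (\<lambda>e x. c :: real)"
  by (rule bl_const[where c="\<bar>c\<bar>"]) simp

text \<open>Transfers facts about functions of \<open>\<theta>\<close> or \<open>\<omega>\<close>
  alone to functions of the pair, with \<open>u\<close> a projection.\<close>

lemma bl_reparam:
  assumes f: "bounded_lipschitz_on B' X f" and u: "\<And>e. e \<in> B \<Longrightarrow> u e \<in> B'" and b: "bounded_linear u"
  shows "bounded_lipschitz_on B X (\<lambda>e x. f (u e) x)"
proof -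
  interpret bounded_linear u by fact
  obtain K where K: "0 \<le> K" "\<And>a. norm (u a) \<le> norm a * K" using nonneg_bounded by blast
  obtain c where "bounded_lipschitz_const c B' X f"
    using f by (rule bounded_lipschitz_onE)
  note c = bounded_lipschitz_constD[OF this]
  show ?thesis
  proof (rule bounded_lipschitz_onI[where c=c and d="c * K"])
    fix x e assume x: "x \<in> X" "e \<in> B"
    show "norm (f (u e) x) \<le> c" using c(2) x u by blast
    fix e' assume e': "e' \<in> B"
    have "norm (f (u e) x - f (u e') x) \<le> c * norm (u (e - e'))"
      using c(3)[OF x(1) u[OF x(2)] u[OF e']] by (simp add: diff)
    also have "\<dots> \<le> c * (norm (e - e') * K)" using K(2) c(4) by (intro mult_left_mono)
    finally show "norm (f (u e) x - f (u e') x) \<le> c * K * norm (e - e')" by (simp add: mult_ac)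
  qed
qed

lemma bl_param:
  assumes u: "\<And>e. e \<in> B \<Longrightarrow> norm (u e) \<le> R" and b: "bounded_linear u"
  shows "bounded_lipschitz_on B X (\<lambda>e x. u e)"
proof -
  have "bounded_lipschitz_on (cball 0 R) X (\<lambda>e x. e)"
    by (rule bounded_lipschitz_onI[where c=R and d=1]) auto
  from bl_reparam[OF this _ b] show ?thesis using u by auto
qed

lemma bl_id[bl_intros]: "bounded_lipschitz_on (cball 0 B) X (\<lambda>\<theta> x. \<theta>)"
  by (rule bl_param[where R=B]) auto

text \<open>The integral does not depend on \<open>y\<close>; the dummy argument keeps averaged
  quantities such as \<open>g\<close> and \<open>D\<close> within the same predicate as the sampled
  ones.\<close>

lemma bl_integral:
  fixes f :: "'e::real_normed_vector \<Rightarrow> 'x \<Rightarrow> 'b::{banach, second_countable_topology}"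
  assumes M: "prob_space M" and f: "bounded_lipschitz_on B (space M) f"
    and meas: "\<And>e. e \<in> B \<Longrightarrow> f e \<in> borel_measurable M"
  shows "bounded_lipschitz_on B Y (\<lambda>e y. \<integral>x. f e x \<partial>M)"
proof -
  interpret prob_space M by fact
  obtain c where "bounded_lipschitz_const c B (space M) f"
    using f by (rule bounded_lipschitz_onE)
  note c = bounded_lipschitz_constD[OF this]
  have int: "integrable M (f e)" if "e \<in> B" for e
    using that c(2) meas by (intro integrable_const_bound[where B=c]) auto
  have bd: "norm (\<integral>x. g x \<partial>M) \<le> d" if "integrable M g" "\<And>x. x \<in> space M \<Longrightarrow> norm (g x) \<le> d" for g :: "'x \<Rightarrow> 'b" and d
  proof -
    have "norm (\<integral>x. g x \<partial>M) \<le> (\<integral>x. norm (g x) \<partial>M)" by (rule integral_norm_bound)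
    also have "\<dots> \<le> (\<integral>x. d \<partial>M)" using that by (intro integral_mono) auto
    finally show ?thesis by (simp add: prob_space)
  qed
  show ?thesis
  proof (rule bounded_lipschitz_onI[where c=c and d=c])
    fix e assume e: "e \<in> B"
    show "norm (\<integral>x. f e x \<partial>M) \<le> c" using int[OF e] c(2)[OF _ e] by (rule bd)
    fix e' assume e': "e' \<in> B"
    have "norm (\<integral>x. f e x - f e' x \<partial>M) \<le> c * norm (e - e')"
      using int[OF e] int[OF e'] c(3)[OF _ e e'] by (intro bd) auto
    then show "norm ((\<integral>x. f e x \<partial>M) - (\<integral>x. f e' x \<partial>M)) \<le> c * norm (e - e')"
      using int[OF e] int[OF e'] by simp
  qed
qed

section \<open>Kernels, total variation and conditional laws\<close>

text \<open>The policy is assumed measurable in the state and smooth in the parameter, but iterates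
  and states are both random. Continuity in \<open>z\<close> allows \<open>g\<close> to be replaced
  by simple functions, for which the composition is glued from finitely many measurable
  pieces.\<close>

lemma measurable_Caratheodory:
  fixes f :: "'z::{second_countable_topology, metric_space} \<Rightarrow> 'x \<Rightarrow> 'b::metric_space"
  assumes f: "\<And>z. f z \<in> borel_measurable N"
    and cont: "\<And>x. x \<in> space N \<Longrightarrow> continuous_on UNIV (\<lambda>z. f z x)"
    and g: "g \<in> borel_measurable M" and h: "h \<in> M \<rightarrow>\<^sub>M N"
  shows "(\<lambda>w. f (g w) (h w)) \<in> borel_measurable M"
proof -
  obtain F where F: "\<And>i. simple_function M (F i)" "\<And>x. x \<in> space M \<Longrightarrow> (\<lambda>i. F i x) \<longlonglongrightarrow> g x"
    using borel_measurable_implies_sequence_metric[OF g] by blast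
  show ?thesis
  proof (rule borel_measurable_LIMSEQ_metric)
    fix i
    have "(\<lambda>w. f z (h w)) \<in> borel_measurable M" for z
      using f[of z] h by measurable
    then show "(\<lambda>w. f (F i w) (h w)) \<in> borel_measurable M"
      by (rule measurable_compose_countable'[where I="F i ` space M"])
        (use F(1)[of i] in \<open>auto intro: countable_finite simp: simple_function_def measurable_count_space_eq2\<close>)
  next
    fix x assume x: "x \<in> space M"
    then have "isCont (\<lambda>z. f z (h x)) (g x)"
      using cont[OF measurable_space[OF h x]] by (simp add: continuous_on_eq_continuous_at)
    then show "(\<lambda>i. f (F i x) (h x)) \<longlonglongrightarrow> f (g x) (h x)"
      using F(2)[OF x] isCont_tendsto_compose by blast
  qed
qed

lemma prob_kernelD:
  assumes "K \<in> M \<rightarrow>\<^sub>M prob_algebra N" "x \<in> space M"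
  shows "prob_space (K x)" "sets (K x) = sets N" "space (K x) = space N"
proof -
  have "K x \<in> space (prob_algebra N)" using assms by (rule measurable_space)
  then show "prob_space (K x)" "sets (K x) = sets N" by (auto simp: space_prob_algebra)
  then show "space (K x) = space N" using sets_eq_imp_space_eq by blast
qed

lemma integral_bind_bounded:
  fixes f :: "_ \<Rightarrow> real"
  assumes f[measurable]: "f \<in> borel_measurable N"
    and bd: "\<And>x. x \<in> space N \<Longrightarrow> \<bar>f x\<bar> \<le> c"
    and K[measurable]: "K \<in> M \<rightarrow>\<^sub>M prob_algebra N" and M: "prob_space M"
  shows "integral\<^sup>L (M \<bind> K) f = (\<integral>x. integral\<^sup>L (K x) f \<partial>M)"
proof -
  interpret prob_space M by fact
  have KS: "K \<in> M \<rightarrow>\<^sub>M subprob_algebra N" using K by (rule measurable_prob_algebraD)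
  have "integral\<^sup>L (M \<bind> K) f = integral\<^sup>L (join (distr M (subprob_algebra N) K)) f"
    using bind_nonempty''[OF KS not_empty] by simp
  also have "\<dots> = (\<integral>M'. integral\<^sup>L M' f \<partial>distr M (subprob_algebra N) K)"
  proof (rule integral_join[OF f bd])
    show "finite_measure (distr M (subprob_algebra N) K)"
      by (rule finite_measure_distr[OF KS])
    have "AE x in M. emeasure (K x) (space (K x)) \<le> ennreal 1"
      using prob_kernelD(1)[OF K] by (intro AE_I2) (simp add: prob_space.emeasure_space_1)
    then show "AE M' in distr M (subprob_algebra N) K. emeasure M' (space M') \<le> ennreal 1"
      by (subst AE_distr_iff[OF KS]) auto
  qed auto
  also have "\<dots> = (\<integral>x. integral\<^sup>L (K x) f \<partial>M)"
    by (rule integral_distr[OF KS]) measurable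
  finally show ?thesis .
qed

text \<open>Pushing \<open>K x\<close> forward along \<open>Pair x\<close> turns the integrand,
  which depends on \<open>x\<close>, into a fixed function on the product space, and integration of
  a fixed function is measurable in the measure.\<close>

lemma measurable_kernel_integral:
  fixes h :: "_ \<Rightarrow> _ \<Rightarrow> real"
  assumes h: "case_prod h \<in> borel_measurable (M \<Otimes>\<^sub>M N)"
    and K: "K \<in> M \<rightarrow>\<^sub>M prob_algebra N"
  shows "(\<lambda>x. \<integral>y. h x y \<partial>K x) \<in> borel_measurable M"
proof -
  have KS: "K \<in> M \<rightarrow>\<^sub>M subprob_algebra N" using K by (rule measurable_prob_algebraD)
  have d: "(\<lambda>x. distr (K x) (M \<Otimes>\<^sub>M N) (Pair x)) \<in> M \<rightarrow>\<^sub>M subprob_algebra (M \<Otimes>\<^sub>M N)"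
    by (rule measurable_distr2[OF _ KS]) simp
  have "(\<lambda>x. integral\<^sup>L (distr (K x) (M \<Otimes>\<^sub>M N) (Pair x)) (case_prod h)) \<in> borel_measurable M"
    using measurable_compose[OF d integral_measurable_subprob_algebra[OF h]] .
  also have "?this \<longleftrightarrow> ?thesis"
  proof (rule measurable_cong)
    fix x assume x: "x \<in> space M"
    have "Pair x \<in> N \<rightarrow>\<^sub>M M \<Otimes>\<^sub>M N" using x by simp
    then have "Pair x \<in> K x \<rightarrow>\<^sub>M M \<Otimes>\<^sub>M N"
      using prob_kernelD(2)[OF K x] by (simp cong: measurable_cong_sets)
    then show "integral\<^sup>L (distr (K x) (M \<Otimes>\<^sub>M N) (Pair x)) (case_prod h) = (\<integral>y. h x y \<partial>K x)"
      by (subst integral_distr) (use h in auto)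
  qed
  finally show ?thesis .
qed

lemma measurable_kernel_integral_fst:
  fixes h :: "_ \<Rightarrow> _ \<Rightarrow> real"
  assumes K: "K \<in> M \<rightarrow>\<^sub>M prob_algebra L" and h: "case_prod h \<in> borel_measurable (N \<Otimes>\<^sub>M L)"
  shows "(\<lambda>(w, s). \<integral>y. h w y \<partial>K s) \<in> borel_measurable (N \<Otimes>\<^sub>M M)"
proof -
  have "(\<lambda>z. \<integral>y. (\<lambda>z y. h (fst z) y) z y \<partial>K (snd z)) \<in> borel_measurable (N \<Otimes>\<^sub>M M)"
  proof (rule measurable_kernel_integral)
    show "(\<lambda>z. K (snd z)) \<in> N \<Otimes>\<^sub>M M \<rightarrow>\<^sub>M prob_algebra L" by (rule measurable_compose[OF measurable_snd K])
    have "(\<lambda>z. (fst (fst z), snd z)) \<in> (N \<Otimes>\<^sub>M M) \<Otimes>\<^sub>M L \<rightarrow>\<^sub>M N \<Otimes>\<^sub>M L" by measurable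
    from measurable_compose[OF this h]
    show "(\<lambda>(z, y). h (fst z) y) \<in> borel_measurable ((N \<Otimes>\<^sub>M M) \<Otimes>\<^sub>M L)" by (simp add: split_beta')
  qed
  then show ?thesis by (simp add: split_beta')
qed

text \<open>A non-integrable function has Bochner integral 0, and \<open>0 \<le> c\<close> covers
  that case, so users owe no integrability proof.\<close>

lemma (in prob_space) integral_abs_le:
  fixes f :: "_ \<Rightarrow> real"
  assumes "AE x in M. \<bar>f x\<bar> \<le> c" "0 \<le> c"
  shows "\<bar>integral\<^sup>L M f\<bar> \<le> c"
proof (cases "integrable M f")
  case True
  have "\<bar>integral\<^sup>L M f\<bar> \<le> (\<integral>x. \<bar>f x\<bar> \<partial>M)" by (rule integral_abs_bound)
  also have "\<dots> \<le> (\<integral>x. c \<partial>M)"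
    using True assms by (intro integral_mono_AE) auto
  finally show ?thesis by (simp add: prob_space)
qed (use assms in \<open>simp add: not_integrable_integral_eq\<close>)

lemma kernel_integral_bound:
  fixes h :: "_ \<Rightarrow> _ \<Rightarrow> real"
  assumes "K \<in> M \<rightarrow>\<^sub>M prob_algebra N" "x \<in> space M" "\<And>y. y \<in> space N \<Longrightarrow> \<bar>h x y\<bar> \<le> c" "0 \<le> c"
  shows "\<bar>\<integral>y. h x y \<partial>K x\<bar> \<le> c"
  using prob_kernelD(3)[OF assms(1,2)] assms(3,4)
  by (intro prob_space.integral_abs_le[OF prob_kernelD(1)[OF assms(1,2)]] AE_I2) auto

section \<open>Total variation and differences of integrals\<close>

lemma measure_diff_le_1:
  assumes "prob_space p" "prob_space q"
  shows "\<bar>measure p B - measure q B\<bar> \<le> 1"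
  using prob_space.prob_le_1[OF assms(1), of B] prob_space.prob_le_1[OF assms(2), of B]
    measure_nonneg[of p B] measure_nonneg[of q B] by linarith

lemma tv_dist_ge:
  assumes "prob_space p" "prob_space q" "B \<in> sets p"
  shows "\<bar>measure p B - measure q B\<bar> \<le> tv_dist p q"
  unfolding tv_dist_def by (rule cSUP_upper[OF assms(3) bdd_aboveI2[OF measure_diff_le_1[OF assms(1,2)]]])

lemma tv_dist_le_1:
  assumes "prob_space p" "prob_space q"
  shows "tv_dist p q \<le> 1"
  unfolding tv_dist_def using measure_diff_le_1[OF assms] sets.top[of p] by (intro cSUP_least) auto

text \<open>A discrete layer-cake formula: the sum counts the levels \<open>i / n\<close> not
  exceeding \<open>y\<close>, hence equals the integer part of \<open>n * y\<close> divided by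
  \<open>n\<close>.\<close>

lemma step_approximation:
  fixes y :: real
  assumes "0 \<le> y" "y \<le> 1" "0 < n"
  shows "\<bar>y - (\<Sum>i=1..n. (1 / real n) * of_bool (y \<ge> real i / real n))\<bar> \<le> 1 / real n"
proof -
  define k where "k = nat \<lfloor>real n * y\<rfloor>"
  have k: "real k \<le> real n * y" "real n * y < real k + 1"
    using assms unfolding k_def by (auto simp: of_nat_floor)
  have "real k \<le> real n" using k(1) assms by (smt (verit) mult_left_le of_nat_0_le_iff)
  then have kn: "k \<le> n" by simp
  have iff: "(y \<ge> real i / real n) \<longleftrightarrow> i \<le> k" for i
  proof -
    have "(y \<ge> real i / real n) \<longleftrightarrow> real i \<le> real n * y"
      using assms by (simp add: field_simps)
    also have "\<dots> \<longleftrightarrow> i \<le> k"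
    proof
      assume "real i \<le> real n * y"
      then have "real i < real (k + 1)" using k by simp
      then show "i \<le> k" by linarith
    next
      assume "i \<le> k"
      then have "real i \<le> real k" by simp
      then show "real i \<le> real n * y" using k by linarith
    qed
    finally show ?thesis .
  qed
  have "(\<Sum>i=1..n. (1 / real n) * of_bool (y \<ge> real i / real n)) = (\<Sum>i\<in>{1..n}. if i \<le> k then 1 / real n else 0)"
    by (intro sum.cong) (auto simp: iff)
  also have "\<dots> = (\<Sum>i\<in>{1..k}. 1 / real n)"
    using kn by (intro sum.mono_neutral_cong_right) auto
  also have "\<dots> = real k / real n" by simp
  finally have *: "(\<Sum>i=1..n. (1 / real n) * of_bool (y \<ge> real i / real n)) = real k / real n" .
  have "real n * \<bar>y - real k / real n\<bar> \<le> 1"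
  proof -
    have "real n * (y - real k / real n) = real n * y - real k" using assms(3) by (simp add: field_simps)
    then have "real n * \<bar>y - real k / real n\<bar> = \<bar>real n * y - real k\<bar>"
      by (metis abs_mult abs_of_nat)
    then show ?thesis using k by simp
  qed
  then show ?thesis unfolding * using assms(3) by (simp add: field_simps)
qed

text \<open>\<open>tv_dist\<close> is a supremum over events, so the function is traded for its
  superlevel sets. The \<open>n\<close> sets carry weight \<open>1 / n\<close> each, so together
  they contribute at most one total variation distance, and discretisation costs
  \<open>1 / n\<close> under either measure.\<close>

lemma integral_diff_le_tv_dist_unit:
  fixes h :: "_ \<Rightarrow> real"
  assumes p: "prob_space p" and q: "prob_space q" and s: "sets p = sets q"
    and h[measurable]: "h \<in> borel_measurable p" and bd: "\<And>x. x \<in> space p \<Longrightarrow> 0 \<le> h x \<and> h x \<le> 1"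
  shows "\<bar>integral\<^sup>L p h - integral\<^sup>L q h\<bar> \<le> tv_dist p q"
proof (rule field_le_epsilon)
  fix e :: real assume e: "0 < e"
  obtain n where n': "2 / e < real n" using reals_Archimedean2 by blast
  moreover have "0 < 2 / e" using e by simp
  ultimately have "0 < real n" by linarith
  then have n: "0 < n" "2 / real n < e"
    using n' e by (simp_all add: field_simps)
  have sp: "space p = space q" using s by (rule sets_eq_imp_space_eq)
  define g where "g x = (\<Sum>i=1..n. (1 / real n) * of_bool (h x \<ge> real i / real n))" for x
  define A where "A i = {x \<in> space p. h x \<ge> real i / real n}" for i
  have A[measurable]: "A i \<in> sets p" for i unfolding A_def by measurable
  have g_int: "integral\<^sup>L M g = (\<Sum>i=1..n. (1 / real n) * measure M (A i)) \<and> \<bar>integral\<^sup>L M h - integral\<^sup>L M g\<bar> \<le> 1 / real n"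
    if M: "prob_space M" "sets M = sets p" for M
  proof -
    interpret M: prob_space M by fact
    have spM: "space M = space p" using M(2) by (rule sets_eq_imp_space_eq)
    have [measurable]: "h \<in> borel_measurable M" using h M(2) by (simp cong: measurable_cong_sets)
    have AM: "A i \<in> sets M" for i using A M(2) by simp
    have geq: "g x = (\<Sum>i=1..n. (1 / real n) * indicator (A i) x)" if "x \<in> space M" for x
      unfolding g_def using that spM by (intro sum.cong) (auto simp: A_def indicator_def)
    have "integral\<^sup>L M g = (\<integral>x. (\<Sum>i=1..n. (1 / real n) * indicator (A i) x) \<partial>M)"
      by (rule Bochner_Integration.integral_cong) (auto simp: geq)
    also have "\<dots> = (\<Sum>i=1..n. \<integral>x. (1 / real n) * indicator (A i) x \<partial>M)"
      using AM by (intro Bochner_Integration.integral_sum integrable_mult_right integrable_real_indicator) 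
        (auto simp: M.emeasure_eq_measure)
    also have "\<dots> = (\<Sum>i=1..n. (1 / real n) * measure M (A i))"
      using AM by (intro sum.cong) (auto simp: spM[symmetric] dest: sets.sets_into_space intro!: arg_cong[where f="measure M"])
    finally have 1: "integral\<^sup>L M g = (\<Sum>i=1..n. (1 / real n) * measure M (A i))" .
    have ih: "integrable M h" using bd spM by (intro M.integrable_const_bound[where B=1]) auto
    have ig: "integrable M g"
    proof -
      have "integrable M (\<lambda>x. (\<Sum>i=1..n. (1 / real n) * indicator (A i) x))"
        using AM by (intro Bochner_Integration.integrable_sum integrable_mult_right integrable_real_indicator) 
        (auto simp: M.emeasure_eq_measure)
      then show ?thesis
        by (subst Bochner_Integration.integrable_cong[OF refl geq]) auto
    qed
    have "\<bar>integral\<^sup>L M h - integral\<^sup>L M g\<bar> = \<bar>\<integral>x. h x - g x \<partial>M\<bar>"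
      using ih ig by simp
    also have "\<dots> \<le> 1 / real n"
    proof (intro M.integral_abs_le AE_I2)
      fix x assume "x \<in> space M"
      then show "\<bar>h x - g x\<bar> \<le> 1 / real n"
        unfolding g_def using bd[of x] spM n by (intro step_approximation) auto
    qed simp
    finally show ?thesis using 1 by simp
  qed
  have "\<bar>integral\<^sup>L p g - integral\<^sup>L q g\<bar> = \<bar>\<Sum>i=1..n. (1 / real n) * (measure p (A i) - measure q (A i))\<bar>"
    using g_int[OF p] g_int[OF q s[symmetric]] by (simp add: sum_subtractf right_diff_distrib)
  also have "\<dots> \<le> (\<Sum>i=1..n. (1 / real n) * tv_dist p q)"
    using tv_dist_ge[OF p q A] by (intro order_trans[OF sum_abs] sum_mono) (simp add: abs_mult mult_left_mono divide_right_mono)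
  also have "\<dots> = tv_dist p q" using n by simp
  finally have "\<bar>integral\<^sup>L p g - integral\<^sup>L q g\<bar> \<le> tv_dist p q" .
  moreover have "2 / real n = 1 / real n + 1 / real n" by simp
  ultimately show "\<bar>integral\<^sup>L p h - integral\<^sup>L q h\<bar> \<le> tv_dist p q + e"
    using g_int[OF p refl] g_int[OF q s[symmetric]] n by linarith
qed

text \<open>The interval from \<open>- c\<close> to \<open>c\<close> is mapped affinely onto the
  unit interval; the factor \<open>2 * c\<close> is its length.\<close>

lemma integral_diff_le_tv_dist:
  fixes h :: "_ \<Rightarrow> real"
  assumes p: "prob_space p" and q: "prob_space q" and s: "sets p = sets q"
    and h[measurable]: "h \<in> borel_measurable p" and bd: "\<And>x. x \<in> space p \<Longrightarrow> \<bar>h x\<bar> \<le> c" and c: "0 < c"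
  shows "\<bar>integral\<^sup>L p h - integral\<^sup>L q h\<bar> \<le> 2 * c * tv_dist p q"
proof -
  define g where "g x = (h x + c) / (2 * c)" for x
  have g: "g \<in> borel_measurable p" unfolding g_def by measurable
  have bg: "0 \<le> g x \<and> g x \<le> 1" if "x \<in> space p" for x
    using bd[OF that] c unfolding g_def by (auto simp: field_simps abs_le_iff)
  have gi: "integral\<^sup>L M g = (integral\<^sup>L M h + c) / (2 * c)" if M: "prob_space M" "sets M = sets p" for M
  proof -
    interpret M: prob_space M by fact
    have spM: "space M = space p" using M(2) by (rule sets_eq_imp_space_eq)
    have [measurable]: "h \<in> borel_measurable M" using h M(2) by (simp cong: measurable_cong_sets)
    have "integrable M h" using bd spM by (intro M.integrable_const_bound[where B=c]) auto
    then show ?thesis unfolding g_def by (simp add: M.prob_space)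
  qed
  have "integral\<^sup>L p g - integral\<^sup>L q g = (integral\<^sup>L p h - integral\<^sup>L q h) / (2 * c)"
    by (simp add: gi[OF p] gi[OF q s[symmetric]] diff_divide_distrib[symmetric])
  then have "\<bar>integral\<^sup>L p h - integral\<^sup>L q h\<bar> = 2 * c * \<bar>integral\<^sup>L p g - integral\<^sup>L q g\<bar>"
    using c by (simp add: abs_mult)
  also have "\<dots> \<le> 2 * c * tv_dist p q"
    using integral_diff_le_tv_dist_unit[OF p q s g bg] c by (intro mult_left_mono) auto
  finally show ?thesis .
qed

section \<open>From conditional probabilities of events to integrals against a kernel\<close>

text \<open>The trajectory is specified by conditional probabilities of single events. Here they
  become an identity for functions of the past and the next draw: the joint law of
  \<open>(W, Y)\<close> and the law composed from \<open>W\<close> and \<open>K\<close> agree on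
  rectangles, which generate the product sigma-algebra.\<close>

lemma (in prob_space) conditional_law_integral:
  fixes h :: "_ \<Rightarrow> _ \<Rightarrow> real"
  assumes sub: "subalgebra M F" and W: "W \<in> F \<rightarrow>\<^sub>M N" and Y[measurable]: "Y \<in> M \<rightarrow>\<^sub>M L"
    and K: "K \<in> N \<rightarrow>\<^sub>M prob_algebra L"
    and ce: "\<And>B. B \<in> sets L \<Longrightarrow>
      AE x in M. real_cond_exp M F (indicator (Y -` B \<inter> space M)) x = measure (K (W x)) B"
    and h: "case_prod h \<in> borel_measurable (N \<Otimes>\<^sub>M L)"
    and bd: "\<And>w y. w \<in> space N \<Longrightarrow> y \<in> space L \<Longrightarrow> \<bar>h w y\<bar> \<le> c"
  shows "(\<integral>x. h (W x) (Y x) \<partial>M) = (\<integral>x. (\<integral>y. h (W x) y \<partial>K (W x)) \<partial>M)"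
proof -
  interpret F: finite_measure_subalgebra M F
    by unfold_locales (rule sub)
  have W'[measurable]: "W \<in> M \<rightarrow>\<^sub>M N" by (rule measurable_from_subalg[OF sub W])
  have spF: "space F = space M" using sub by (simp add: subalgebra_def)
  have KW[measurable]: "(\<lambda>x. K (W x)) \<in> M \<rightarrow>\<^sub>M prob_algebra L" using measurable_compose[OF W' K] .
  define G where "G x = distr (K (W x)) (N \<Otimes>\<^sub>M L) (Pair (W x))" for x
  have G: "G \<in> M \<rightarrow>\<^sub>M prob_algebra (N \<Otimes>\<^sub>M L)"
    unfolding G_def by (rule measurable_distr_prob_space2[OF KW]) measurable
  have GS: "G \<in> M \<rightarrow>\<^sub>M subprob_algebra (N \<Otimes>\<^sub>M L)" using G by (rule measurable_prob_algebraD)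
  have PW: "Pair (W x) \<in> K (W x) \<rightarrow>\<^sub>M N \<Otimes>\<^sub>M L" if x: "x \<in> space M" for x
  proof -
    have "Pair (W x) \<in> L \<rightarrow>\<^sub>M N \<Otimes>\<^sub>M L" using measurable_space[OF W' x] by simp
    then show ?thesis using prob_kernelD(2)[OF KW x] by (simp cong: measurable_cong_sets)
  qed
  have eq: "distr M (N \<Otimes>\<^sub>M L) (\<lambda>x. (W x, Y x)) = M \<bind> G"
  proof (rule measure_eqI_generator_eq[where A="\<lambda>_. space N \<times> space L" and
        E="{a \<times> b | a b. a \<in> sets N \<and> b \<in> sets L}" and \<Omega>="space N \<times> space L"])
    show "Int_stable {a \<times> b | a b. a \<in> sets N \<and> b \<in> sets L}" by (rule Int_stable_pair_measure_generator)
    show "{a \<times> b | a b. a \<in> sets N \<and> b \<in> sets L} \<subseteq> Pow (space N \<times> space L)"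
      by (rule pair_measure_closed)
    show "sets (distr M (N \<Otimes>\<^sub>M L) (\<lambda>x. (W x, Y x))) = sigma_sets (space N \<times> space L) {a \<times> b |a b. a \<in> sets N \<and> b \<in> sets L}"
      by (simp add: sets_pair_measure)
    have "sets (M \<bind> G) = sets (N \<Otimes>\<^sub>M L)" using sets_bind[OF _ not_empty] sets_kernel[OF GS] by blast
    then show "sets (M \<bind> G) = sigma_sets (space N \<times> space L) {a \<times> b |a b. a \<in> sets N \<and> b \<in> sets L}"
      by (simp add: sets_pair_measure)
    show "range (\<lambda>_. space N \<times> space L) \<subseteq> {a \<times> b |a b. a \<in> sets N \<and> b \<in> sets L}" by auto
    show "emeasure (distr M (N \<Otimes>\<^sub>M L) (\<lambda>x. (W x, Y x))) (space N \<times> space L) \<noteq> \<infinity>" for i :: nat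
      by (simp add: emeasure_distr emeasure_eq_measure)
    fix X assume "X \<in> {a \<times> b |a b. a \<in> sets N \<and> b \<in> sets L}"
    then obtain A B where X: "X = A \<times> B" and A[measurable]: "A \<in> sets N" and B[measurable]: "B \<in> sets L" by blast
    define A' where "A' = W -` A \<inter> space M"
    have A': "A' \<in> sets F" unfolding A'_def using measurable_sets[OF W A] spF by simp
    have A'M[measurable]: "A' \<in> sets M" unfolding A'_def by measurable
    have YB[measurable]: "Y -` B \<inter> space M \<in> sets M" by measurable
    have "emeasure (distr M (N \<Otimes>\<^sub>M L) (\<lambda>x. (W x, Y x))) X = emeasure M (A' \<inter> (Y -` B \<inter> space M))"
      unfolding X by (subst emeasure_distr) (auto simp: A'_def intro!: arg_cong[where f="emeasure M"])
    also have "\<dots> = ennreal (\<integral>x. indicator A' x * indicator (Y -` B \<inter> space M) x \<partial>M)"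
      by (simp add: emeasure_eq_measure indicator_inter_arith[symmetric] Int_assoc)
    \<comment> \<open>The defining property of conditional expectation applies because
      \<open>A'\<close> is an event of \<open>F\<close>; this is the use of the measurability of
      \<open>W\<close> with respect to the past.\<close>
    also have "(\<integral>x. indicator A' x * indicator (Y -` B \<inter> space M) x \<partial>M)
      = (\<integral>x. indicator A' x * real_cond_exp M F (indicator (Y -` B \<inter> space M)) x \<partial>M)"
      using F.real_cond_exp_intA[of "indicator (Y -` B \<inter> space M)", OF _ A']
      by (simp add: set_lebesgue_integral_def emeasure_eq_measure)
    also have "\<dots> = (\<integral>x. indicator A' x * measure (K (W x)) B \<partial>M)"
    proof (rule integral_cong_AE)
      show "AE x in M. indicat_real A' x * real_cond_exp M F (indicat_real (Y -` B \<inter> space M)) x = indicat_real A' x * measure (K (W x)) B"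
        using ce[OF B] by auto
    qed (use KW measurable_prob_algebraD[OF KW] in measurable)
    also have "ennreal \<dots> = (\<integral>\<^sup>+x. ennreal (indicator A' x * measure (K (W x)) B) \<partial>M)"
    proof (rule nn_integral_eq_integral[symmetric])
      show "integrable M (\<lambda>x. indicat_real A' x * measure (K (W x)) B)"
      proof (rule integrable_const_bound[where B=1])
        show "AE x in M. norm (indicat_real A' x * measure (K (W x)) B) \<le> 1"
          using prob_space.prob_le_1[OF prob_kernelD(1)[OF KW]]
          by (intro AE_I2) (auto simp: indicator_def abs_mult)
      qed (use KW measurable_prob_algebraD[OF KW] in measurable)
    qed auto
    also have "\<dots> = (\<integral>\<^sup>+x. emeasure (G x) X \<partial>M)"
    proof (rule nn_integral_cong)
      fix x assume x: "x \<in> space M"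
      interpret Kx: prob_space "K (W x)" using prob_kernelD(1)[OF KW x] .
      have "emeasure (G x) X = emeasure (K (W x)) (Pair (W x) -` (A \<times> B) \<inter> space (K (W x)))"
        unfolding G_def X by (rule emeasure_distr[OF PW[OF x]]) simp
      also have "Pair (W x) -` (A \<times> B) \<inter> space (K (W x)) = (if W x \<in> A then B else {})"
        using sets.sets_into_space[OF B] prob_kernelD(3)[OF KW x] by auto
      finally show "ennreal (indicator A' x * measure (K (W x)) B) = emeasure (G x) X"
        using x by (auto simp: A'_def Kx.emeasure_eq_measure)
    qed
    also have "\<dots> = emeasure (M \<bind> G) X"
      unfolding X by (rule emeasure_bind[OF not_empty GS, symmetric]) simp
    finally show "emeasure (distr M (N \<Otimes>\<^sub>M L) (\<lambda>x. (W x, Y x))) X = emeasure (M \<bind> G) X" .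
  qed auto
  have "(\<integral>x. h (W x) (Y x) \<partial>M) = integral\<^sup>L (distr M (N \<Otimes>\<^sub>M L) (\<lambda>x. (W x, Y x))) (case_prod h)"
    by (subst integral_distr) (use h in auto)
  also have "\<dots> = (\<integral>x. integral\<^sup>L (G x) (case_prod h) \<partial>M)"
    unfolding eq by (rule integral_bind_bounded[OF h _ G prob_space_axioms, of c]) (auto simp: space_pair_measure bd)
  also have "\<dots> = (\<integral>x. (\<integral>y. h (W x) y \<partial>K (W x)) \<partial>M)"
  proof (rule Bochner_Integration.integral_cong[OF refl])
    fix x assume x: "x \<in> space M"
    show "integral\<^sup>L (G x) (case_prod h) = (\<integral>y. h (W x) y \<partial>K (W x))"
      unfolding G_def using integral_distr[OF PW[OF x] h] by simp
  qed
  finally show ?thesis .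
qed

section \<open>The mean squared projected Bellman error\<close>

lemma inner_integral:
  fixes f :: "'x \<Rightarrow> 'b::{banach, real_inner, second_countable_topology}"
  shows "integrable M f \<Longrightarrow> integral\<^sup>L M f \<bullet> c = (\<integral>x. f x \<bullet> c \<partial>M)"
  by (rule integral_inner_left[symmetric])

lemma matrix_inv_both:
  fixes A :: "real^'n^'n"
  assumes "invertible A"
  shows "A ** matrix_inv A = mat 1" "matrix_inv A ** A = mat 1"
  using someI_ex[OF assms[unfolded invertible_def]] unfolding matrix_inv_def by auto

text \<open>Isolates the optimisation from the decision process: \<open>\<nu>\<close> will be the
  stationary law of a transition, \<open>V\<close> the averaged value \<open>Vbar\<close> and
  \<open>U\<close> its gradient \<open>phi_hat\<close>. That \<open>U\<close> is a gradient enters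
  only as a quadratic remainder uniform in the sample, a form that passes through integrals. All
  bounds are per radius.\<close>

locale td_model = prob_space \<nu> for \<nu> :: "'x measure" +
  fixes f :: "'x \<Rightarrow> real^'n" and rew :: "'x \<Rightarrow> real" and V :: "real^'n \<Rightarrow> 'x \<Rightarrow> real"
    and U :: "real^'n \<Rightarrow> 'x \<Rightarrow> real^'n" and \<gamma> :: real and C :: "real^'n^'n"
  assumes f_meas[measurable]: "f \<in> borel_measurable \<nu>"
    and rew_meas[measurable]: "rew \<in> borel_measurable \<nu>"
    and V_meas: "case_prod V \<in> borel_measurable (borel \<Otimes>\<^sub>M \<nu>)"
    and U_meas: "case_prod U \<in> borel_measurable (borel \<Otimes>\<^sub>M \<nu>)"
    and f_bound: "\<And>x. x \<in> space \<nu> \<Longrightarrow> norm (f x) \<le> 1"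
    and rew_bound: "\<exists>c. \<forall>x\<in>space \<nu>. \<bar>rew x\<bar> \<le> c"
    and V_bl: "\<And>B. bounded_lipschitz_on (cball 0 B) (space \<nu>) V"
    and U_bl: "\<And>B. bounded_lipschitz_on (cball 0 B) (space \<nu>) U"
    and V_remainder: "\<And>B. \<exists>L. \<forall>x\<in>space \<nu>. \<forall>\<theta>\<in>cball 0 B. \<forall>\<theta>'\<in>cball 0 B.
          \<bar>V \<theta>' x - V \<theta> x - U \<theta> x \<bullet> (\<theta>' - \<theta>)\<bar> \<le> L * (norm (\<theta>' - \<theta>))\<^sup>2"
    and C_eq: "\<And>v. C *v v = (\<integral>x. (f x \<bullet> v) *\<^sub>R f x \<partial>\<nu>)"
    and C_inv: "invertible C"
begin

lemma V_meas'[measurable (raw)]: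
  assumes [measurable]: "g \<in> borel_measurable M" "h \<in> M \<rightarrow>\<^sub>M \<nu>"
  shows "(\<lambda>x. V (g x) (h x)) \<in> borel_measurable M"
  using measurable_compose[OF _ V_meas, of "\<lambda>x. (g x, h x)" M] by simp

lemma U_meas'[measurable (raw)]:
  assumes [measurable]: "g \<in> borel_measurable M" "h \<in> M \<rightarrow>\<^sub>M \<nu>"
  shows "(\<lambda>x. U (g x) (h x)) \<in> borel_measurable M"
  using measurable_compose[OF _ U_meas, of "\<lambda>x. (g x, h x)" M] by simp

definition td :: "real^'n \<Rightarrow> 'x \<Rightarrow> real" where
  "td \<theta> x = rew x + \<gamma> * V \<theta> x - \<theta> \<bullet> f x"
definition g :: "real^'n \<Rightarrow> real^'n" where "g \<theta> = (\<integral>x. td \<theta> x *\<^sub>R f x \<partial>\<nu>)"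
definition W :: "real^'n \<Rightarrow> real^'n" where "W \<theta> = matrix_inv C *v g \<theta>"
text \<open>For symmetric \<open>C\<close> the gradient of the quadratic form of \<open>g\<close> is
  twice the transposed Jacobian of \<open>g\<close> applied to \<open>W \<theta>\<close>. As
  \<open>td\<close> has slope \<open>\<gamma> *\<^sub>R U \<theta> x - f x\<close>, this is the
  formula below. That it is the gradient is shown in \<open>GDERIV_J\<close>.\<close>

definition D :: "real^'n \<Rightarrow> real^'n" where
  "D \<theta> = - 2 *\<^sub>R (\<integral>x. (W \<theta> \<bullet> f x) *\<^sub>R (f x - \<gamma> *\<^sub>R U \<theta> x) \<partial>\<nu>)"
definition J :: "real^'n \<Rightarrow> real" where "J \<theta> = g \<theta> \<bullet> W \<theta>"

lemma td_meas[measurable (raw)]: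
  assumes [measurable]: "p \<in> borel_measurable M" "h \<in> M \<rightarrow>\<^sub>M \<nu>"
  shows "(\<lambda>x. td (p x) (h x)) \<in> borel_measurable M"
  unfolding td_def by measurable

lemma g_meas[measurable]: "g \<in> borel_measurable borel"
  unfolding g_def[abs_def] by measurable

lemma W_meas[measurable]: "W \<in> borel_measurable borel"
proof -
  have "(\<lambda>v. matrix_inv C *v v) \<in> borel_measurable borel"
    by (intro borel_measurable_continuous_onI linear_continuous_on matrix_vector_mul_bounded_linear)
  then show ?thesis unfolding W_def[abs_def] by measurable
qed

lemma D_meas[measurable]: "D \<in> borel_measurable borel"
  unfolding D_def[abs_def] by measurable

lemma J_meas[measurable]: "J \<in> borel_measurable borel"
  unfolding J_def[abs_def] by measurable

lemma bl_rew[bl_intros]: "bounded_lipschitz_on B (space \<nu>) (\<lambda>e. rew)"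
proof -
  obtain c where "\<And>x. x \<in> space \<nu> \<Longrightarrow> norm (rew x) \<le> c" using rew_bound by auto
  then show ?thesis by (rule bl_const)
qed

lemma bl_f[bl_intros]: "bounded_lipschitz_on B (space \<nu>) (\<lambda>e. f)"
  by (rule bl_const[OF f_bound])

lemma bl_td[bl_intros]: "bounded_lipschitz_on (cball 0 B) (space \<nu>) td"
  unfolding td_def[abs_def] by (intro bl_intros V_bl)

lemma bl_g[bl_intros]: "bounded_lipschitz_on (cball 0 B) X (\<lambda>\<theta> x. g \<theta>)"
  unfolding g_def by (intro bl_integral bl_intros prob_space_axioms) simp

lemma bl_W[bl_intros]: "bounded_lipschitz_on (cball 0 B) X (\<lambda>\<theta> x. W \<theta>)"
  unfolding W_def by (intro bl_linear[OF matrix_vector_mul_bounded_linear] bl_intros)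

lemma bl_D[bl_intros]: "bounded_lipschitz_on (cball 0 B) X (\<lambda>\<theta> x. D \<theta>)"
  unfolding D_def by (intro bl_linear[OF bounded_linear_scaleR_right] bl_integral bl_intros prob_space_axioms U_bl) simp

lemma bl_J[bl_intros]: "bounded_lipschitz_on (cball 0 B) X (\<lambda>\<theta> x. J \<theta>)"
  unfolding J_def by (intro bl_intros)

lemma integrable_bl:
  fixes h :: "'e::real_normed_vector \<Rightarrow> 'x \<Rightarrow> 'b::{banach, second_countable_topology}"
  assumes "bounded_lipschitz_on B (space \<nu>) h" "h e \<in> borel_measurable \<nu>" "e \<in> B"
  shows "integrable \<nu> (h e)"
proof -
  obtain c where c: "bounded_lipschitz_const c B (space \<nu>) h"
    using assms(1) by (rule bounded_lipschitz_onE)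
  have "norm (h e x) \<le> c" if "x \<in> space \<nu>" for x
    by (rule bounded_lipschitz_constD(2)[OF c that assms(3)])
  then show ?thesis using assms(2) by (intro integrable_const_bound[where B=c]) auto
qed

lemma C_mult: "C *v W \<theta> = g \<theta>"
  unfolding W_def matrix_vector_mul_assoc using matrix_inv_both(1)[OF C_inv] by simp

lemma int_ff: "integrable \<nu> (\<lambda>x. (f x \<bullet> v) *\<^sub>R f x)"
  by (rule integrable_bl[where h="\<lambda>v x. (f x \<bullet> v) *\<^sub>R f x" and B="cball 0 (norm v)"]) (auto intro!: bl_intros)

lemma C_inner: "(C *v u) \<bullet> v = (\<integral>x. (f x \<bullet> u) * (f x \<bullet> v) \<partial>\<nu>)"
  unfolding C_eq inner_integral[OF int_ff] by simp

lemma C_sym: "u \<bullet> (C *v v) = (C *v u) \<bullet> v"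
  by (subst inner_commute) (simp add: C_inner mult.commute)

lemma g_W_sym: "g \<theta> \<bullet> W \<eta> = W \<theta> \<bullet> g \<eta>"
  using C_sym[of "W \<theta>" "W \<eta>"] by (simp add: C_mult)

text \<open>Jensen's inequality gives \<open>v \<bullet> C v = E (f \<bullet> v)\<^sup>2 \<ge> (E \<bar>f \<bullet> v\<bar>)\<^sup>2 \<ge> \<parallel>C v\<parallel>\<^sup>2\<close>, so
  invertibility alone yields positive definiteness.\<close>

lemma C_pos: "\<exists>l>0. \<forall>v. l * (norm v)\<^sup>2 \<le> v \<bullet> (C *v v)"
proof -
  obtain k where k: "0 < k" "\<And>v. norm (matrix_inv C *v v) \<le> norm v * k"
    using bounded_linear.pos_bounded[OF matrix_vector_mul_bounded_linear[of "matrix_inv C"]] by blast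
  have "(1 / k\<^sup>2) * (norm v)\<^sup>2 \<le> v \<bullet> (C *v v)" for v
  proof -
    define a where "a = (\<integral>x. \<bar>f x \<bullet> v\<bar> \<partial>\<nu>)"
    have i1: "integrable \<nu> (\<lambda>x. \<bar>f x \<bullet> v\<bar>)"
      by (intro integrable_abs integrable_bl[where h="\<lambda>v x. f x \<bullet> v" and B="cball 0 (norm v)"]) (auto intro!: bl_intros)
    have i2: "integrable \<nu> (\<lambda>x. (f x \<bullet> v)\<^sup>2)"
      unfolding power2_eq_square
      by (rule integrable_bl[where h="\<lambda>v x. (f x \<bullet> v) * (f x \<bullet> v)" and B="cball 0 (norm v)"]) (auto intro!: bl_intros)
    \<comment> \<open>Jensen's inequality in the guise of a nonnegative variance.\<close>
    have "0 \<le> (\<integral>x. (\<bar>f x \<bullet> v\<bar> - a)\<^sup>2 \<partial>\<nu>)" by simp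
    also have "\<dots> = (\<integral>x. (f x \<bullet> v)\<^sup>2 - 2 * a * \<bar>f x \<bullet> v\<bar> + a\<^sup>2 \<partial>\<nu>)"
      by (simp add: power2_diff algebra_simps)
    also have "\<dots> = (\<integral>x. (f x \<bullet> v)\<^sup>2 \<partial>\<nu>) - 2 * a * a + a\<^sup>2"
      using i1 i2 by (simp add: a_def[symmetric] prob_space)
    finally have a2: "a\<^sup>2 \<le> (\<integral>x. (f x \<bullet> v)\<^sup>2 \<partial>\<nu>)" by (simp add: power2_eq_square)
    have "norm (C *v v) \<le> (\<integral>x. norm ((f x \<bullet> v) *\<^sub>R f x) \<partial>\<nu>)"
      unfolding C_eq by (rule integral_norm_bound)
    also have "\<dots> \<le> a" unfolding a_def
      using f_bound by (intro integral_mono integrable_norm int_ff i1) (auto simp: mult_left_le)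
    finally have "(norm (C *v v))\<^sup>2 \<le> a\<^sup>2" by (simp add: power_mono)
    also note a2
    also have "(\<integral>x. (f x \<bullet> v)\<^sup>2 \<partial>\<nu>) = v \<bullet> (C *v v)"
      unfolding C_sym C_inner by (simp add: power2_eq_square)
    finally have *: "(norm (C *v v))\<^sup>2 \<le> v \<bullet> (C *v v)" .
    \<comment> \<open>The bound \<open>k\<close> on the inverse converts a lower bound in terms of
      \<open>C *v v\<close> into one in terms of \<open>v\<close>, whence the constant
      \<open>1 / k\<^sup>2\<close>.\<close>
    have "norm v = norm (matrix_inv C *v (C *v v))"
      unfolding matrix_vector_mul_assoc using matrix_inv_both(2)[OF C_inv] by simp
    also have "\<dots> \<le> norm (C *v v) * k" by (rule k)
    finally have "(norm v)\<^sup>2 \<le> (norm (C *v v) * k)\<^sup>2" by (simp add: power_mono)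
    then have "(norm v)\<^sup>2 / k\<^sup>2 \<le> (norm (C *v v))\<^sup>2"
      using k(1) by (simp add: field_simps)
    then show ?thesis using * by simp
  qed
  then show ?thesis using k(1) by (intro exI[of _ "1 / k\<^sup>2"]) auto
qed

text \<open>Symmetry of \<open>C\<close> splits the increment of \<open>J\<close> into 2 (g
  \<theta>' - g \<theta>) \<bullet> W \<theta> and (g \<theta>' - g \<theta>) \<bullet> (W \<theta>'
  - W \<theta>). The second part is of second order since \<open>g\<close> and \<open>W\<close> are
  Lipschitz; the first, minus its linear part, is an average of remainders of
  \<open>V\<close>.\<close>

lemma J_remainder:
  "\<exists>L\<ge>0. \<forall>\<theta>\<in>cball 0 B. \<forall>\<theta>'\<in>cball 0 B.
     \<bar>J \<theta>' - J \<theta> - D \<theta> \<bullet> (\<theta>' - \<theta>)\<bar> \<le> L * (norm (\<theta>' - \<theta>))\<^sup>2"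
proof -
  obtain L where L: "\<And>x \<theta> \<theta>'. x \<in> space \<nu> \<Longrightarrow> \<theta> \<in> cball 0 B \<Longrightarrow> \<theta>' \<in> cball 0 B \<Longrightarrow>
      \<bar>V \<theta>' x - V \<theta> x - U \<theta> x \<bullet> (\<theta>' - \<theta>)\<bar> \<le> L * (norm (\<theta>' - \<theta>))\<^sup>2"
    using V_remainder[of B] by blast
  obtain cg where "bounded_lipschitz_const cg (cball 0 B) {()} (\<lambda>\<theta> x. g \<theta>)"
    using bl_g[of B "{()}"] by (rule bounded_lipschitz_onE)
  note cg = bounded_lipschitz_constD[OF this]
  obtain cW where "bounded_lipschitz_const cW (cball 0 B) {()} (\<lambda>\<theta> x. W \<theta>)"
    using bl_W[of B "{()}"] by (rule bounded_lipschitz_onE)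
  note cW = bounded_lipschitz_constD[OF this]
  have main: "\<bar>J \<theta>' - J \<theta> - D \<theta> \<bullet> (\<theta>' - \<theta>)\<bar> \<le> (2 * (cW * (\<bar>\<gamma>\<bar> * \<bar>L\<bar>)) + cg * cW) * (norm (\<theta>' - \<theta>))\<^sup>2"
    if th: "\<theta> \<in> cball 0 B" "\<theta>' \<in> cball 0 B" for \<theta> \<theta>'
  proof -
    let ?h = "\<theta>' - \<theta>"
    have it: "integrable \<nu> (\<lambda>x. td \<eta> x *\<^sub>R f x)" if "\<eta> \<in> cball 0 B" for \<eta>
      by (rule integrable_bl[OF _ _ that, where h="\<lambda>\<eta> x. td \<eta> x *\<^sub>R f x"]) (auto intro!: bl_intros)
    have iD: "integrable \<nu> (\<lambda>x. (W \<theta> \<bullet> f x) *\<^sub>R (f x - \<gamma> *\<^sub>R U \<theta> x))"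
      by (rule integrable_bl[OF _ _ th(1), where h="\<lambda>\<theta> x. (W \<theta> \<bullet> f x) *\<^sub>R (f x - \<gamma> *\<^sub>R U \<theta> x)"])
        (auto intro!: bl_intros U_bl)
    have "(g \<theta>' - g \<theta>) \<bullet> W \<theta> = (\<integral>x. (td \<theta>' x *\<^sub>R f x - td \<theta> x *\<^sub>R f x) \<bullet> W \<theta> \<partial>\<nu>)"
      unfolding g_def using it[OF th(1)] it[OF th(2)]
      by (subst Bochner_Integration.integral_diff[symmetric]) (auto intro!: inner_integral)
    moreover have "D \<theta> \<bullet> ?h = - 2 * (\<integral>x. ((W \<theta> \<bullet> f x) *\<^sub>R (f x - \<gamma> *\<^sub>R U \<theta> x)) \<bullet> ?h \<partial>\<nu>)"
      unfolding D_def inner_scaleR_left inner_integral[OF iD] ..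
    ultimately have "2 * ((g \<theta>' - g \<theta>) \<bullet> W \<theta>) - D \<theta> \<bullet> ?h
        = 2 * ((\<integral>x. (td \<theta>' x *\<^sub>R f x - td \<theta> x *\<^sub>R f x) \<bullet> W \<theta> \<partial>\<nu>)
          + (\<integral>x. ((W \<theta> \<bullet> f x) *\<^sub>R (f x - \<gamma> *\<^sub>R U \<theta> x)) \<bullet> ?h \<partial>\<nu>))" by simp
    also have "\<dots> = 2 * (\<integral>x. (td \<theta>' x *\<^sub>R f x - td \<theta> x *\<^sub>R f x) \<bullet> W \<theta>
          + ((W \<theta> \<bullet> f x) *\<^sub>R (f x - \<gamma> *\<^sub>R U \<theta> x)) \<bullet> ?h \<partial>\<nu>)"
      using it[OF th(1)] it[OF th(2)] iD
      by (subst Bochner_Integration.integral_add)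
        (auto intro!: integrable_inner_left Bochner_Integration.integrable_diff simp del: inner_scaleR_left)
    \<comment> \<open>Rewards and the terms linear in the feature cancel exactly, so that only the
      nonlinearity of \<open>V\<close> is left.\<close>
    also have "\<dots> = 2 * (\<integral>x. (W \<theta> \<bullet> f x) * (\<gamma> * (V \<theta>' x - V \<theta> x - U \<theta> x \<bullet> ?h)) \<partial>\<nu>)"
      by (intro arg_cong[where f="(*) 2"] Bochner_Integration.integral_cong refl)
        (simp add: td_def inner_diff_left inner_diff_right inner_commute algebra_simps)
    finally have e1: "2 * ((g \<theta>' - g \<theta>) \<bullet> W \<theta>) - D \<theta> \<bullet> ?h
        = 2 * (\<integral>x. (W \<theta> \<bullet> f x) * (\<gamma> * (V \<theta>' x - V \<theta> x - U \<theta> x \<bullet> ?h)) \<partial>\<nu>)" .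
    have b1: "\<bar>\<integral>x. (W \<theta> \<bullet> f x) * (\<gamma> * (V \<theta>' x - V \<theta> x - U \<theta> x \<bullet> ?h)) \<partial>\<nu>\<bar> \<le> cW * (\<bar>\<gamma>\<bar> * (\<bar>L\<bar> * (norm ?h)\<^sup>2))"
    proof (intro integral_abs_le AE_I2)
      fix x assume x: "x \<in> space \<nu>"
      have "\<bar>W \<theta> \<bullet> f x\<bar> \<le> norm (W \<theta>) * norm (f x)" by (rule Cauchy_Schwarz_ineq2)
      also have "\<dots> \<le> cW * 1" using cW(2)[of "()" \<theta>] cW(4) th f_bound[OF x] by (intro mult_mono) auto
      finally have 1: "\<bar>W \<theta> \<bullet> f x\<bar> \<le> cW" by simp
      have "\<bar>V \<theta>' x - V \<theta> x - U \<theta> x \<bullet> ?h\<bar> \<le> L * (norm ?h)\<^sup>2" using L[OF x th] .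
      also have "\<dots> \<le> \<bar>L\<bar> * (norm ?h)\<^sup>2" by (intro mult_right_mono) auto
      finally show "\<bar>(W \<theta> \<bullet> f x) * (\<gamma> * (V \<theta>' x - V \<theta> x - U \<theta> x \<bullet> ?h))\<bar> \<le> cW * (\<bar>\<gamma>\<bar> * (\<bar>L\<bar> * (norm ?h)\<^sup>2))"
        unfolding abs_mult using 1 cW(4) by (intro mult_mono mult_nonneg_nonneg) auto
    qed (use cW(4) in auto)
    have "J \<theta>' - J \<theta> = 2 * ((g \<theta>' - g \<theta>) \<bullet> W \<theta>) + (g \<theta>' - g \<theta>) \<bullet> (W \<theta>' - W \<theta>)"
      using g_W_sym[of \<theta> \<theta>'] unfolding J_def by (simp add: inner_diff_left inner_diff_right inner_commute)
    then have "J \<theta>' - J \<theta> - D \<theta> \<bullet> ?h = 2 * (\<integral>x. (W \<theta> \<bullet> f x) * (\<gamma> * (V \<theta>' x - V \<theta> x - U \<theta> x \<bullet> ?h)) \<partial>\<nu>)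
        + (g \<theta>' - g \<theta>) \<bullet> (W \<theta>' - W \<theta>)"
      using e1 by linarith
    moreover have "\<bar>(g \<theta>' - g \<theta>) \<bullet> (W \<theta>' - W \<theta>)\<bar> \<le> (cg * norm ?h) * (cW * norm ?h)"
      using cg(3)[OF _ th(2,1)] cW(3)[OF _ th(2,1)]
      by (intro order_trans[OF Cauchy_Schwarz_ineq2] mult_mono) (auto intro!: mult_nonneg_nonneg cg(4))
    ultimately have "\<bar>J \<theta>' - J \<theta> - D \<theta> \<bullet> ?h\<bar> \<le> 2 * (cW * (\<bar>\<gamma>\<bar> * (\<bar>L\<bar> * (norm ?h)\<^sup>2))) + (cg * norm ?h) * (cW * norm ?h)"
      using b1 by linarith
    also have "\<dots> = (2 * (cW * (\<bar>\<gamma>\<bar> * \<bar>L\<bar>)) + cg * cW) * (norm ?h)\<^sup>2"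
      by (simp add: power2_eq_square algebra_simps)
    finally show ?thesis .
  qed
  have "0 \<le> 2 * (cW * (\<bar>\<gamma>\<bar> * \<bar>L\<bar>)) + cg * cW" using cg(4) cW(4) by auto
  then show ?thesis using main by blast
qed

lemma GDERIV_J: "GDERIV J \<theta> :> D \<theta>"
proof -
  \<comment> \<open>A radius one larger than needed for \<open>\<theta>\<close> contains every point
    at distance at most one.\<close>
  obtain L where L: "\<And>\<theta>1 \<theta>2. \<theta>1 \<in> cball 0 (norm \<theta> + 1) \<Longrightarrow> \<theta>2 \<in> cball 0 (norm \<theta> + 1) \<Longrightarrow>
     \<bar>J \<theta>2 - J \<theta>1 - D \<theta>1 \<bullet> (\<theta>2 - \<theta>1)\<bar> \<le> L * (norm (\<theta>2 - \<theta>1))\<^sup>2"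
    using J_remainder[of "norm \<theta> + 1"] by blast
  show ?thesis
  proof (rule GDERIV_of_quadratic_remainder)
    fix y assume "norm (y - \<theta>) \<le> 1"
    then have "norm y \<le> norm \<theta> + 1" using norm_triangle_sub[of y \<theta>] by linarith
    then show "\<bar>J y - J \<theta> - D \<theta> \<bullet> (y - \<theta>)\<bar> \<le> L * (norm (y - \<theta>))\<^sup>2" by (intro L) auto
  qed
qed

lemma grad_J: "grad J = D"
  using grad_eq[OF GDERIV_J] by auto

end

section \<open>Two-timescale descent\<close>

text \<open>In \<open>error_budget\<close>, \<open>r\<close> is the number of steps by which the iterates are frozen when the Markov
  noise is estimated, and \<open>e\<close> is the mixing error left after \<open>r\<close> steps.\<close>

lemma telescoped_sum_bound:
  fixes u v :: "nat \<Rightarrow> real"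
  assumes "\<And>t. t \<le> T \<Longrightarrow> v t \<le> u t - u (Suc t) + w t"
  shows "(\<Sum>t\<le>T. v t) \<le> u 0 - u (Suc T) + (\<Sum>t\<le>T. w t)"
  using assms
proof (induction T)
  case (Suc T)
  have "(\<Sum>t\<le>T. v t) \<le> u 0 - u (Suc T) + (\<Sum>t\<le>T. w t)" using Suc by simp
  with Suc.prems[of "Suc T"] show ?case by simp
qed simp

definition error_budget :: "real \<Rightarrow> real \<Rightarrow> nat \<Rightarrow> real \<Rightarrow> real \<Rightarrow> real" where
  "error_budget \<alpha> \<beta> T r e = 1 / \<alpha> + 1 / \<beta> + (real T + 1) * (\<alpha> / \<beta>) + (real T + 1) * (\<alpha> + \<beta>)
     + (r + (real T + 1) * (\<beta> * r + e))"

text \<open>Deterministic core: \<open>j\<close>, \<open>d\<close>, \<open>z\<close> stand for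
  expected objective, squared gradient and squared tracking error, \<open>n1\<close> and
  \<open>n2\<close> for the Markov noise. Each recursion is summed and divided by its own stepsize,
  which turns the boundary terms into \<open>1 / \<beta>\<close> and \<open>1 / \<alpha>\<close> and
  the drift of the target into \<open>\<alpha> / \<beta>\<close>; the bound on the sum of
  \<open>z\<close> is fed into the descent sum.\<close>

lemma two_timescale_sum_bound:
  fixes j d z n1 n2 :: "nat \<Rightarrow> real"
  assumes pos: "0 < \<alpha>" "0 < \<beta>" "0 < l" "0 \<le> q" "0 \<le> p" "0 \<le> s" "0 \<le> s'" "0 \<le> r"
    and cnn: "0 \<le> cj" "0 \<le> cz" "0 \<le> k1" "0 \<le> k2"
    and j: "\<And>t. t \<le> Suc T \<Longrightarrow> \<bar>j t\<bar> \<le> cj" and z: "\<And>t. t \<le> Suc T \<Longrightarrow> 0 \<le> z t \<and> z t \<le> cz"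
    and descent: "\<And>t. t \<le> T \<Longrightarrow> \<alpha> / 4 * d t \<le> j t - j (Suc t) + \<alpha> * n1 t + \<alpha> * q * z t + s' * \<alpha>\<^sup>2"
    and tracking: "\<And>t. t \<le> T \<Longrightarrow> 2 * \<beta> * l * z t \<le> z t - z (Suc t) + 2 * \<beta> * n2 t + p * \<alpha> + s * \<beta>\<^sup>2"
    and n1: "(\<Sum>t\<le>T. n1 t) \<le> k1 * (r + (real T + 1) * (\<beta> * r + e))"
    and n2: "(\<Sum>t\<le>T. n2 t) \<le> k2 * (r + (real T + 1) * (\<beta> * r + e))" and e: "0 \<le> e"
  shows "(\<Sum>t\<le>T. d t) \<le> 4 * (2 * cj + k1 + q * ((cz + 2 * k2 + p + s) / (2 * l)) + s') * error_budget \<alpha> \<beta> T r e"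
proof -
  define Q0 where "Q0 = r + (real T + 1) * (\<beta> * r + e)"
  \<comment> \<open>\<open>Q\<close> is the error budget written out. All its summands are
    nonnegative, so each of them may be replaced by \<open>Q\<close> at the price of a
    constant.\<close>
  define Q where "Q = 1 / \<alpha> + 1 / \<beta> + (real T + 1) * (\<alpha> / \<beta>) + (real T + 1) * (\<alpha> + \<beta>) + Q0"
  have nn: "0 \<le> 1 / \<alpha>" "0 \<le> 1 / \<beta>" "0 \<le> (real T + 1) * (\<alpha> / \<beta>)" "0 \<le> (real T + 1) * \<alpha>"
      "0 \<le> (real T + 1) * \<beta>" "0 \<le> Q0"
    unfolding Q0_def using pos e by auto
  have Q: "1 / \<alpha> \<le> Q" "1 / \<beta> \<le> Q" "(real T + 1) * (\<alpha> / \<beta>) \<le> Q" "(real T + 1) * \<alpha> \<le> Q"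
      "(real T + 1) * \<beta> \<le> Q" "Q0 \<le> Q" "0 \<le> Q"
    using nn by (simp_all add: Q_def distrib_left)
  have "(\<Sum>t\<le>T. 2 * \<beta> * l * z t) \<le> z 0 - z (Suc T) + (\<Sum>t\<le>T. 2 * \<beta> * n2 t + p * \<alpha> + s * \<beta>\<^sup>2)"
    by (rule telescoped_sum_bound) (use tracking in \<open>simp add: algebra_simps\<close>)
  also have "\<dots> \<le> cz + 2 * \<beta> * (\<Sum>t\<le>T. n2 t) + (real T + 1) * (p * \<alpha> + s * \<beta>\<^sup>2)"
    using z[of 0] z[of "Suc T"] by (simp add: sum.distrib sum_distrib_left algebra_simps)
  finally have "2 * \<beta> * l * (\<Sum>t\<le>T. z t) \<le> cz + 2 * \<beta> * (\<Sum>t\<le>T. n2 t) + (real T + 1) * (p * \<alpha> + s * \<beta>\<^sup>2)"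
    by (simp add: sum_distrib_left)
  then have "(2 * \<beta> * l * (\<Sum>t\<le>T. z t)) / \<beta> \<le> (cz + 2 * \<beta> * (\<Sum>t\<le>T. n2 t) + (real T + 1) * (p * \<alpha> + s * \<beta>\<^sup>2)) / \<beta>"
    using pos by (intro divide_right_mono) auto
  also have "(2 * \<beta> * l * (\<Sum>t\<le>T. z t)) / \<beta> = 2 * l * (\<Sum>t\<le>T. z t)" using pos by simp
  also have "(cz + 2 * \<beta> * (\<Sum>t\<le>T. n2 t) + (real T + 1) * (p * \<alpha> + s * \<beta>\<^sup>2)) / \<beta>
      = cz * (1 / \<beta>) + 2 * (\<Sum>t\<le>T. n2 t) + p * ((real T + 1) * (\<alpha> / \<beta>)) + s * ((real T + 1) * \<beta>)"
    using pos by (simp add: field_simps power2_eq_square)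
  also have "\<dots> \<le> cz * Q + 2 * (k2 * Q) + p * Q + s * Q"
  proof (intro add_mono mult_left_mono Q pos cnn)
    have "(\<Sum>t\<le>T. n2 t) \<le> k2 * Q0" using n2 unfolding Q0_def .
    also have "\<dots> \<le> k2 * Q" using Q cnn by (intro mult_left_mono)
    finally show "(\<Sum>t\<le>T. n2 t) \<le> k2 * Q" .
  qed auto
  finally have "2 * l * (\<Sum>t\<le>T. z t) \<le> (cz + 2 * k2 + p + s) * Q" by (simp add: algebra_simps)
  then have Z: "(\<Sum>t\<le>T. z t) \<le> (cz + 2 * k2 + p + s) / (2 * l) * Q"
    using pos by (simp add: field_simps)
  have "(\<Sum>t\<le>T. \<alpha> / 4 * d t) \<le> j 0 - j (Suc T) + (\<Sum>t\<le>T. \<alpha> * n1 t + \<alpha> * q * z t + s' * \<alpha>\<^sup>2)"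
    by (rule telescoped_sum_bound) (use descent in \<open>simp add: algebra_simps\<close>)
  also have "\<dots> \<le> 2 * cj + \<alpha> * (\<Sum>t\<le>T. n1 t) + \<alpha> * q * (\<Sum>t\<le>T. z t) + (real T + 1) * (s' * \<alpha>\<^sup>2)"
    using j[of 0] j[of "Suc T"] by (simp add: sum.distrib sum_distrib_left algebra_simps)
  finally have "\<alpha> * (\<Sum>t\<le>T. d t) \<le> 4 * (2 * cj + \<alpha> * (\<Sum>t\<le>T. n1 t) + \<alpha> * q * (\<Sum>t\<le>T. z t) + (real T + 1) * (s' * \<alpha>\<^sup>2))"
    unfolding sum_distrib_left[of "\<alpha> / 4", symmetric] by simp
  then have "(\<alpha> * (\<Sum>t\<le>T. d t)) / \<alpha> \<le> (4 * (2 * cj + \<alpha> * (\<Sum>t\<le>T. n1 t) + \<alpha> * q * (\<Sum>t\<le>T. z t) + (real T + 1) * (s' * \<alpha>\<^sup>2))) / \<alpha>"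
    using pos by (intro divide_right_mono) auto
  also have "(\<alpha> * (\<Sum>t\<le>T. d t)) / \<alpha> = (\<Sum>t\<le>T. d t)" using pos by simp
  also have "(4 * (2 * cj + \<alpha> * (\<Sum>t\<le>T. n1 t) + \<alpha> * q * (\<Sum>t\<le>T. z t) + (real T + 1) * (s' * \<alpha>\<^sup>2))) / \<alpha>
     = 4 * (2 * cj * (1 / \<alpha>) + (\<Sum>t\<le>T. n1 t) + q * (\<Sum>t\<le>T. z t) + s' * ((real T + 1) * \<alpha>))"
    using pos by (simp add: field_simps power2_eq_square)
  also have "\<dots> \<le> 4 * (2 * cj * Q + k1 * Q + q * ((cz + 2 * k2 + p + s) / (2 * l) * Q) + s' * Q)"
  proof (intro mult_left_mono[of _ _ 4] add_mono mult_left_mono[of _ _ q] mult_left_mono[of _ _ s'] mult_left_mono[of _ _ "2 * cj"] Q pos cnn Z)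
    have "(\<Sum>t\<le>T. n1 t) \<le> k1 * Q0" using n1 unfolding Q0_def .
    also have "\<dots> \<le> k1 * Q" using Q cnn by (intro mult_left_mono)
    finally show "(\<Sum>t\<le>T. n1 t) \<le> k1 * Q" .
  qed (use cnn in auto)
  also have "\<dots> = 4 * (2 * cj + k1 + q * ((cz + 2 * k2 + p + s) / (2 * l)) + s') * Q" by (simp add: algebra_simps)
  finally show ?thesis unfolding Q_def Q0_def error_budget_def .
qed

section \<open>Sampled update directions and their stationary means\<close>

context td_model
begin

definition G :: "real^'n \<Rightarrow> real^'n \<Rightarrow> 'x \<Rightarrow> real^'n" where
  "G \<theta> \<omega> x = td \<theta> x *\<^sub>R f x - (\<gamma> * (\<omega> \<bullet> f x)) *\<^sub>R U \<theta> x"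
definition H :: "real^'n \<Rightarrow> real^'n \<Rightarrow> 'x \<Rightarrow> real^'n" where
  "H \<theta> \<omega> x = (td \<theta> x - f x \<bullet> \<omega>) *\<^sub>R f x"

text \<open>First-order terms of the two recursions: change of \<open>J\<close> along the slow
  direction, and half the change of the squared tracking error along the fast one. In
  \<open>F1\<close> the iterate \<omega> is replaced by its target \<open>W (fst e)\<close>, so that
  the mean is exactly a multiple of the squared gradient; the discrepancy is charged to the tracking
  error. Both are functions of the pair so that a single noise estimate serves them.\<close>

definition F1 :: "(real^'n) \<times> (real^'n) \<Rightarrow> 'x \<Rightarrow> real" where
  "F1 e x = D (fst e) \<bullet> G (fst e) (W (fst e)) x"
definition F2 :: "(real^'n) \<times> (real^'n) \<Rightarrow> 'x \<Rightarrow> real" where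
  "F2 e x = (snd e - W (fst e)) \<bullet> H (fst e) (snd e) x"

lemma G_meas[measurable (raw)]:
  assumes [measurable]: "p \<in> borel_measurable M" "q \<in> borel_measurable M" "h \<in> M \<rightarrow>\<^sub>M \<nu>"
  shows "(\<lambda>x. G (p x) (q x) (h x)) \<in> borel_measurable M"
  unfolding G_def by measurable

lemma H_meas[measurable (raw)]:
  assumes [measurable]: "p \<in> borel_measurable M" "q \<in> borel_measurable M" "h \<in> M \<rightarrow>\<^sub>M \<nu>"
  shows "(\<lambda>x. H (p x) (q x) (h x)) \<in> borel_measurable M"
  unfolding H_def by measurable

lemma F1_meas: "case_prod F1 \<in> borel_measurable (borel \<Otimes>\<^sub>M \<nu>)"
  unfolding F1_def[abs_def] split_beta' by (simp add: borel_prod[symmetric])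

lemma F2_meas: "case_prod F2 \<in> borel_measurable (borel \<Otimes>\<^sub>M \<nu>)"
  unfolding F2_def[abs_def] split_beta' by (simp add: borel_prod[symmetric])

abbreviation box2 :: "real \<Rightarrow> ((real^'n) \<times> (real^'n)) set" where
  "box2 R \<equiv> cball 0 R \<times> cball 0 R"

lemma bl_fst:
  assumes "bounded_lipschitz_on (cball 0 R) X h"
  shows "bounded_lipschitz_on (box2 R) X (\<lambda>e x. h (fst e) x)"
  by (rule bl_reparam[OF assms _ bounded_linear_fst]) auto

lemma bl_snd:
  assumes "bounded_lipschitz_on (cball 0 R) X h"
  shows "bounded_lipschitz_on (box2 R) X (\<lambda>e x. h (snd e) x)"
  by (rule bl_reparam[OF assms _ bounded_linear_snd]) auto

lemma bl_F1: "bounded_lipschitz_on (box2 R) (space \<nu>) F1"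
  unfolding F1_def[abs_def] G_def by (intro bl_fst bl_intros U_bl)

lemma bl_H: "bounded_lipschitz_on (box2 R) (space \<nu>) (\<lambda>e. H (fst e) (snd e))"
  unfolding H_def[abs_def]
  by (intro bl_scaleR bl_diff bl_inner bl_f bl_fst[OF bl_td] bl_snd[OF bl_id])

lemma bl_G: "bounded_lipschitz_on (box2 R) (space \<nu>) (\<lambda>e. G (fst e) (snd e))"
  unfolding G_def[abs_def]
  by (intro bl_scaleR bl_diff bl_inner bl_mult bl_real bl_f bl_fst[OF bl_td] bl_fst[OF U_bl] bl_snd[OF bl_id])

lemma bl_F2: "bounded_lipschitz_on (box2 R) (space \<nu>) F2"
  unfolding F2_def[abs_def]
  by (intro bl_inner bl_diff bl_H bl_fst[OF bl_W] bl_snd[OF bl_id])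

lemma int_td_f: "integrable \<nu> (\<lambda>x. td \<theta> x *\<^sub>R f x)"
  by (rule integrable_bl[where h="\<lambda>\<eta> x. td \<eta> x *\<^sub>R f x" and B="cball 0 (norm \<theta>)"]) (auto intro!: bl_intros)

lemma int_U: "integrable \<nu> (\<lambda>x. (\<gamma> * (W \<theta> \<bullet> f x)) *\<^sub>R U \<theta> x)"
  by (rule integrable_bl[where h="\<lambda>\<theta> x. (\<gamma> * (W \<theta> \<bullet> f x)) *\<^sub>R U \<theta> x" and B="cball 0 (norm \<theta>)"])
    (auto intro!: bl_intros U_bl)

text \<open>At \<open>\<omega> = W \<theta>\<close> the two correction terms \<open>E[\<delta> f]\<close> and \<open>E[(W \<theta> \<bullet> f) f]\<close> agree, so the
  mean of the first update is minus one half of the gradient.\<close>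

lemma F1_mean: "(\<integral>x. F1 e x \<partial>\<nu>) = - (norm (D (fst e)))\<^sup>2 / 2"
proof -
  let ?\<theta> = "fst e"
  have "(\<integral>x. G ?\<theta> (W ?\<theta>) x \<partial>\<nu>) = g ?\<theta> - (\<integral>x. (\<gamma> * (W ?\<theta> \<bullet> f x)) *\<^sub>R U ?\<theta> x \<partial>\<nu>)"
    unfolding G_def g_def using int_td_f int_U by simp
  also have "g ?\<theta> = (\<integral>x. (f x \<bullet> W ?\<theta>) *\<^sub>R f x \<partial>\<nu>)"
    using C_mult[of ?\<theta>] C_eq by metis
  also have "\<dots> - (\<integral>x. (\<gamma> * (W ?\<theta> \<bullet> f x)) *\<^sub>R U ?\<theta> x \<partial>\<nu>)
      = (\<integral>x. (f x \<bullet> W ?\<theta>) *\<^sub>R f x - (\<gamma> * (W ?\<theta> \<bullet> f x)) *\<^sub>R U ?\<theta> x \<partial>\<nu>)"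
    using int_ff int_U by simp
  also have "\<dots> = (\<integral>x. (W ?\<theta> \<bullet> f x) *\<^sub>R (f x - \<gamma> *\<^sub>R U ?\<theta> x) \<partial>\<nu>)"
    by (simp add: scaleR_diff_right inner_commute mult.commute)
  also have "\<dots> = - (1/2) *\<^sub>R D ?\<theta>" unfolding D_def by simp
  finally have m: "(\<integral>x. G ?\<theta> (W ?\<theta>) x \<partial>\<nu>) = - (1/2) *\<^sub>R D ?\<theta>" .
  have "(\<integral>x. F1 e x \<partial>\<nu>) = (\<integral>x. G ?\<theta> (W ?\<theta>) x \<bullet> D ?\<theta> \<partial>\<nu>)"
    unfolding F1_def by (simp add: inner_commute)
  also have "\<dots> = (\<integral>x. G ?\<theta> (W ?\<theta>) x \<partial>\<nu>) \<bullet> D ?\<theta>"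
    by (rule inner_integral[symmetric]) (use int_td_f int_U in \<open>simp add: G_def\<close>)
  also have "\<dots> = - (norm (D ?\<theta>))\<^sup>2 / 2" unfolding m by (simp add: power2_norm_eq_inner)
  finally show ?thesis .
qed

text \<open>The mean fast direction is g \<theta> - C \<omega>, and g \<theta> = C (W \<theta>), so
  it is linear in the tracking error. With \<open>C_pos\<close> this is the contraction.\<close>

lemma F2_mean:
  "(\<integral>x. F2 e x \<partial>\<nu>) = - ((snd e - W (fst e)) \<bullet> (C *v (snd e - W (fst e))))"
proof -
  let ?\<theta> = "fst e" and ?\<omega> = "snd e"
  have eqH: "H ?\<theta> ?\<omega> x = td ?\<theta> x *\<^sub>R f x - (f x \<bullet> ?\<omega>) *\<^sub>R f x" for x
    by (simp add: H_def scaleR_diff_left)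
  have iH: "integrable \<nu> (H ?\<theta> ?\<omega>)" unfolding eqH using int_td_f int_ff by simp
  have "(\<integral>x. H ?\<theta> ?\<omega> x \<partial>\<nu>) = g ?\<theta> - C *v ?\<omega>"
    unfolding eqH g_def C_eq using int_td_f int_ff by simp
  also have "\<dots> = - (C *v (?\<omega> - W ?\<theta>))"
    by (simp add: matrix_vector_mult_diff_distrib C_mult)
  finally have m: "(\<integral>x. H ?\<theta> ?\<omega> x \<partial>\<nu>) = - (C *v (?\<omega> - W ?\<theta>))" .
  have "(\<integral>x. F2 e x \<partial>\<nu>) = (\<integral>x. H ?\<theta> ?\<omega> x \<bullet> (?\<omega> - W ?\<theta>) \<partial>\<nu>)"
    unfolding F2_def by (simp add: inner_commute)
  also have "\<dots> = (\<integral>x. H ?\<theta> ?\<omega> x \<partial>\<nu>) \<bullet> (?\<omega> - W ?\<theta>)"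
    by (rule inner_integral[OF iH, symmetric])
  finally show ?thesis unfolding m by (simp add: inner_commute)
qed

end

section \<open>Markov noise and the expected sum of squared gradients\<close>

context td_model
begin

text \<open>The only interface to the Markov chain: an iterate known at time \<open>k\<close> and
  the transition at time \<open>t\<close> behave like an independent pair with
  \<open>\<nu>\<close>-distributed second entry, up to a geometric error. It speaks of all bounded
  \<open>h\<close>, since \<open>F1\<close> and \<open>F2\<close> are both tested.\<close>

definition mixing_bound :: "'w measure \<Rightarrow> (nat \<Rightarrow> 'w \<Rightarrow> 'x) \<Rightarrow> (nat \<Rightarrow> 'w \<Rightarrow> (real^'n) \<times> (real^'n)) \<Rightarrow> real \<Rightarrow> real \<Rightarrow> bool" where
  "mixing_bound \<Omega> X E m \<rho> \<longleftrightarrow> (\<forall>k t h c. k \<le> t \<longrightarrow> 0 < c \<longrightarrow>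
     case_prod h \<in> borel_measurable (borel \<Otimes>\<^sub>M \<nu>) \<longrightarrow> (\<forall>e. \<forall>x\<in>space \<nu>. \<bar>h e x\<bar> \<le> c) \<longrightarrow>
     \<bar>(\<integral>w. h (E k w) (X t w) \<partial>\<Omega>) - (\<integral>w. (\<integral>x. h (E k w) x \<partial>\<nu>) \<partial>\<Omega>)\<bar> \<le> c * m * \<rho> ^ (t - k))"

text \<open>Boundedness reaches \<open>Suc T\<close> because the one-step inequality at
  \<open>t = T\<close> involves the next iterate.\<close>

definition gq_process ::
    "'w measure \<Rightarrow> (nat \<Rightarrow> 'w \<Rightarrow> 'x) \<Rightarrow> real \<Rightarrow> nat \<Rightarrow> real \<Rightarrow> real \<Rightarrow> real \<Rightarrow> real \<Rightarrow>
     (nat \<Rightarrow> 'w \<Rightarrow> real^'n) \<Rightarrow> (nat \<Rightarrow> 'w \<Rightarrow> real^'n) \<Rightarrow> bool" where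
  "gq_process \<Omega> X R T m \<rho> \<alpha> \<beta> \<theta> \<omega> \<longleftrightarrow>
     (\<forall>t. \<theta> t \<in> borel_measurable \<Omega>) \<and> (\<forall>t. \<omega> t \<in> borel_measurable \<Omega>) \<and>
     (\<forall>t\<le>Suc T. AE w in \<Omega>. norm (\<theta> t w) \<le> R \<and> norm (\<omega> t w) \<le> R) \<and>
     (\<forall>t. \<forall>w\<in>space \<Omega>. \<theta> (Suc t) w = \<theta> t w + \<alpha> *\<^sub>R G (\<theta> t w) (\<omega> t w) (X t w)) \<and>
     (\<forall>t. \<forall>w\<in>space \<Omega>. \<omega> (Suc t) w = \<omega> t w + \<beta> *\<^sub>R H (\<theta> t w) (\<omega> t w) (X t w)) \<and>
     mixing_bound \<Omega> X (\<lambda>t w. (\<theta> t w, \<omega> t w)) m \<rho>"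

lemma drift_AE:
  fixes E :: "nat \<Rightarrow> 'w \<Rightarrow> 'e::real_normed_vector"
  assumes "\<And>t. t < N \<Longrightarrow> AE w in \<Omega>. norm (E (Suc t) w - E t w) \<le> d"
  shows "k + j \<le> N \<Longrightarrow> AE w in \<Omega>. norm (E (k + j) w - E k w) \<le> real j * d"
proof (induction j)
  case (Suc j)
  have 1: "AE w in \<Omega>. norm (E (k + j) w - E k w) \<le> real j * d" using Suc by simp
  have 2: "AE w in \<Omega>. norm (E (Suc (k + j)) w - E (k + j) w) \<le> d" using Suc.prems by (intro assms) simp
  show ?case using 1 2
  proof eventually_elim
    case (elim w)
    have "norm (E (k + Suc j) w - E k w) = norm ((E (Suc (k + j)) w - E (k + j) w) + (E (k + j) w - E k w))" by simp
    also have "\<dots> \<le> d + real j * d" using elim(2,1) by (rule norm_triangle_mono)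
    finally show ?case by (simp add: algebra_simps)
  qed
qed simp

text \<open>Freeze the iterate \<open>\<tau>\<close> steps in the past: it is then determined by the history, so the mixing
  hypothesis applies, and the error of freezing is at most \<open>\<tau>\<close> one-step drifts.\<close>

lemma markov_noise_bound:
  fixes \<Omega> :: "'w measure" and X :: "nat \<Rightarrow> 'w \<Rightarrow> 'x" and E :: "nat \<Rightarrow> 'w \<Rightarrow> (real^'n) \<times> (real^'n)"
  assumes \<Omega>: "prob_space \<Omega>" and X[measurable]: "\<And>t. X t \<in> \<Omega> \<rightarrow>\<^sub>M \<nu>" and E[measurable]: "\<And>t. E t \<in> borel_measurable \<Omega>"
    and F[measurable]: "case_prod F \<in> borel_measurable (borel \<Otimes>\<^sub>M \<nu>)" and c: "0 < c"
    and Fb: "\<And>x e. x \<in> space \<nu> \<Longrightarrow> e \<in> box2 R \<Longrightarrow> \<bar>F e x\<bar> \<le> c"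
    and Fl: "\<And>x e e'. x \<in> space \<nu> \<Longrightarrow> e \<in> box2 R \<Longrightarrow> e' \<in> box2 R \<Longrightarrow> \<bar>F e x - F e' x\<bar> \<le> c * norm (e - e')"
    and ball: "\<And>t. t \<le> N \<Longrightarrow> AE w in \<Omega>. E t w \<in> box2 R"
    and drift: "\<And>t. t < N \<Longrightarrow> AE w in \<Omega>. norm (E (Suc t) w - E t w) \<le> d"
    and mix: "mixing_bound \<Omega> X E m \<rho>" and d: "0 \<le> d"
  shows "t \<le> N \<Longrightarrow> integrable \<Omega> (\<lambda>w. F (E t w) (X t w))"
    and "t \<le> N \<Longrightarrow> integrable \<Omega> (\<lambda>w. \<integral>x. F (E t w) x \<partial>\<nu>)"
    and "t \<le> N \<Longrightarrow> (\<integral>w. F (E t w) (X t w) \<partial>\<Omega>) - (\<integral>w. (\<integral>x. F (E t w) x \<partial>\<nu>) \<partial>\<Omega>) \<le> 2 * c"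
    and "t \<le> N \<Longrightarrow> \<tau> \<le> t \<Longrightarrow>
      (\<integral>w. F (E t w) (X t w) \<partial>\<Omega>) - (\<integral>w. (\<integral>x. F (E t w) x \<partial>\<nu>) \<partial>\<Omega>) \<le> 2 * c * (real \<tau> * d) + c * m * \<rho> ^ \<tau>"
proof -
  interpret O: prob_space \<Omega> by fact
  have FE[measurable]: "(\<lambda>w. F (E t w) (X s w)) \<in> borel_measurable \<Omega>" for s t
    using measurable_compose[OF _ F, of "\<lambda>w. (E t w, X s w)" \<Omega>] by simp
  have XS: "X t w \<in> space \<nu>" if "w \<in> space \<Omega>" for t w using measurable_space[OF X that] .
  have Fbar_meas: "(\<lambda>e. \<integral>x. F e x \<partial>\<nu>) \<in> borel_measurable borel"
    by (rule borel_measurable_lebesgue_integral) (rule F)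
  have FbE[measurable]: "(\<lambda>w. \<integral>x. F (E t w) x \<partial>\<nu>) \<in> borel_measurable \<Omega>" for t
    using measurable_compose[OF E Fbar_meas] .
  have Fx_meas: "F e \<in> borel_measurable \<nu>" for e
    using measurable_compose[OF _ F, of "\<lambda>x. (e, x)" \<nu>] by simp
  have Fx_int: "integrable \<nu> (F e)" if "e \<in> box2 R" for e
    using that Fb Fx_meas by (intro integrable_const_bound[where B=c]) auto
  have iF: "integrable \<Omega> (\<lambda>w. F (E t w) (X s w))" if "t \<le> N" for s t
  proof (rule O.integrable_const_bound[where B=c])
    show "AE w in \<Omega>. norm (F (E t w) (X s w)) \<le> c"
      using ball[OF that] AE_space by eventually_elim (simp add: Fb XS)
  qed simp
  have Fbar_le: "\<bar>\<integral>x. F e x \<partial>\<nu>\<bar> \<le> c" if "e \<in> box2 R" for e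
    using Fb that c by (intro integral_abs_le AE_I2) auto
  have iFb: "integrable \<Omega> (\<lambda>w. \<integral>x. F (E t w) x \<partial>\<nu>)" if "t \<le> N" for t
  proof (rule O.integrable_const_bound[where B=c])
    show "AE w in \<Omega>. norm (\<integral>x. F (E t w) x \<partial>\<nu>) \<le> c"
      using ball[OF that] by eventually_elim (simp add: Fbar_le)
  qed simp
  show "t \<le> N \<Longrightarrow> integrable \<Omega> (\<lambda>w. F (E t w) (X t w))" using iF .
  show "t \<le> N \<Longrightarrow> integrable \<Omega> (\<lambda>w. \<integral>x. F (E t w) x \<partial>\<nu>)" using iFb .
  {
    assume t: "t \<le> N"
    have "\<bar>\<integral>w. F (E t w) (X t w) \<partial>\<Omega>\<bar> \<le> c"
    proof (rule O.integral_abs_le)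
      show "AE w in \<Omega>. \<bar>F (E t w) (X t w)\<bar> \<le> c"
        using ball[OF t] AE_space by eventually_elim (simp add: Fb XS)
    qed (use c in simp)
    moreover have "\<bar>\<integral>w. (\<integral>x. F (E t w) x \<partial>\<nu>) \<partial>\<Omega>\<bar> \<le> c"
    proof (rule O.integral_abs_le)
      show "AE w in \<Omega>. \<bar>\<integral>x. F (E t w) x \<partial>\<nu>\<bar> \<le> c"
        using ball[OF t] by eventually_elim (simp add: Fbar_le)
    qed (use c in simp)
    ultimately show "(\<integral>w. F (E t w) (X t w) \<partial>\<Omega>) - (\<integral>w. (\<integral>x. F (E t w) x \<partial>\<nu>) \<partial>\<Omega>) \<le> 2 * c" by linarith
  }
  {
    assume t: "t \<le> N" "\<tau> \<le> t"
    define k where "k = t - \<tau>"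
    have k: "k \<le> N" "k \<le> t" "t - k = \<tau>" "k + \<tau> = t" using t by (auto simp: k_def)
    have dr: "AE w in \<Omega>. norm (E t w - E k w) \<le> real \<tau> * d"
      using drift_AE[where N=N and \<Omega>=\<Omega> and E=E and d=d and k=k and j=\<tau>, OF drift] k t by auto
    have rd: "0 \<le> real \<tau> * d" using d by simp
    have "\<bar>(\<integral>w. F (E t w) (X t w) - F (E k w) (X t w) \<partial>\<Omega>)\<bar> \<le> c * (real \<tau> * d)"
    proof (rule O.integral_abs_le)
      show "AE w in \<Omega>. \<bar>F (E t w) (X t w) - F (E k w) (X t w)\<bar> \<le> c * (real \<tau> * d)"
        using ball[OF t(1)] ball[OF k(1)] dr AE_space
      proof eventually_elim
        case (elim w)
        have "\<bar>F (E t w) (X t w) - F (E k w) (X t w)\<bar> \<le> c * norm (E t w - E k w)" using elim by (intro Fl XS)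
        also have "\<dots> \<le> c * (real \<tau> * d)" using elim c by (intro mult_left_mono) auto
        finally show ?case .
      qed
    qed (use c rd in auto)
    then have s1: "\<bar>(\<integral>w. F (E t w) (X t w) \<partial>\<Omega>) - (\<integral>w. F (E k w) (X t w) \<partial>\<Omega>)\<bar> \<le> c * (real \<tau> * d)"
      using iF t k by simp
    \<comment> \<open>Freezing is paid for a second time, now in the stationary average; together
      with the estimate above this gives the factor 2 in front of the drift.\<close>
    have "\<bar>(\<integral>w. (\<integral>x. F (E t w) x \<partial>\<nu>) - (\<integral>x. F (E k w) x \<partial>\<nu>) \<partial>\<Omega>)\<bar> \<le> c * (real \<tau> * d)"
    proof (rule O.integral_abs_le)
      show "AE w in \<Omega>. \<bar>(\<integral>x. F (E t w) x \<partial>\<nu>) - (\<integral>x. F (E k w) x \<partial>\<nu>)\<bar> \<le> c * (real \<tau> * d)"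
        using ball[OF t(1)] ball[OF k(1)] dr
      proof eventually_elim
        case (elim w)
        have "(\<integral>x. F (E t w) x \<partial>\<nu>) - (\<integral>x. F (E k w) x \<partial>\<nu>) = (\<integral>x. F (E t w) x - F (E k w) x \<partial>\<nu>)"
          using Fx_int elim by simp
        moreover have "\<bar>\<integral>x. F (E t w) x - F (E k w) x \<partial>\<nu>\<bar> \<le> c * (real \<tau> * d)"
        proof (intro integral_abs_le AE_I2)
          fix x assume "x \<in> space \<nu>"
          then have "\<bar>F (E t w) x - F (E k w) x\<bar> \<le> c * norm (E t w - E k w)" using elim by (intro Fl)
          also have "\<dots> \<le> c * (real \<tau> * d)" using elim c by (intro mult_left_mono) auto
          finally show "\<bar>F (E t w) x - F (E k w) x\<bar> \<le> c * (real \<tau> * d)" .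
        qed (use c rd in auto)
        ultimately show ?case by simp
      qed
    qed (use c rd in auto)
    then have s2: "\<bar>(\<integral>w. (\<integral>x. F (E t w) x \<partial>\<nu>) \<partial>\<Omega>) - (\<integral>w. (\<integral>x. F (E k w) x \<partial>\<nu>) \<partial>\<Omega>)\<bar> \<le> c * (real \<tau> * d)"
      using iFb t k by simp
    \<comment> \<open>\<open>F\<close> is controlled only on the box, whereas
      \<open>mixing_bound\<close> wants a bound for every parameter. Cutting off outside the box
      changes nothing almost surely, as the iterates stay inside.\<close>
    define F' where "F' e x = (if e \<in> box2 R then F e x else 0)" for e x
    have box: "box2 R \<in> sets borel" by (intro borel_closed closed_Times closed_cball)
    have F'm: "case_prod F' \<in> borel_measurable (borel \<Otimes>\<^sub>M \<nu>)"
    proof -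
      have "(\<lambda>z. if fst z \<in> box2 R then case_prod F z else 0) \<in> borel_measurable (borel \<Otimes>\<^sub>M \<nu>)"
        using F box by (intro measurable_If) auto
      also have "(\<lambda>z. if fst z \<in> box2 R then case_prod F z else 0) = case_prod F'"
        by (auto simp: F'_def)
      finally show ?thesis .
    qed
    have "\<bar>(\<integral>w. F' (E k w) (X t w) \<partial>\<Omega>) - (\<integral>w. (\<integral>x. F' (E k w) x \<partial>\<nu>) \<partial>\<Omega>)\<bar> \<le> c * m * \<rho> ^ (t - k)"
      using c Fb by (intro mix[unfolded mixing_bound_def, rule_format] k(2) F'm) (auto simp: F'_def)
    moreover have "(\<integral>w. F' (E k w) (X t w) \<partial>\<Omega>) = (\<integral>w. F (E k w) (X t w) \<partial>\<Omega>)"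
    proof (rule integral_cong_AE)
      show "(\<lambda>w. F' (E k w) (X t w)) \<in> borel_measurable \<Omega>"
        using measurable_compose[OF _ F'm, of "\<lambda>w. (E k w, X t w)" \<Omega>] by simp
      show "AE w in \<Omega>. F' (E k w) (X t w) = F (E k w) (X t w)"
        using ball[OF k(1)] by eventually_elim (simp add: F'_def)
    qed simp
    moreover have "(\<integral>w. (\<integral>x. F' (E k w) x \<partial>\<nu>) \<partial>\<Omega>) = (\<integral>w. (\<integral>x. F (E k w) x \<partial>\<nu>) \<partial>\<Omega>)"
    proof (rule integral_cong_AE)
      have "(\<lambda>e. \<integral>x. F' e x \<partial>\<nu>) \<in> borel_measurable borel"
        by (rule borel_measurable_lebesgue_integral) (rule F'm)
      then show "(\<lambda>w. \<integral>x. F' (E k w) x \<partial>\<nu>) \<in> borel_measurable \<Omega>"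
        using measurable_compose[OF E] by blast
      show "AE w in \<Omega>. (\<integral>x. F' (E k w) x \<partial>\<nu>) = (\<integral>x. F (E k w) x \<partial>\<nu>)"
        using ball[OF k(1)] by eventually_elim (simp add: F'_def)
    qed simp
    ultimately show "(\<integral>w. F (E t w) (X t w) \<partial>\<Omega>) - (\<integral>w. (\<integral>x. F (E t w) x \<partial>\<nu>) \<partial>\<Omega>) \<le> 2 * c * (real \<tau> * d) + c * m * \<rho> ^ \<tau>"
      using s1 s2 k(3) by (simp add: abs_le_iff)
  }
qed

text \<open>Times before \<tau> have no iterate \<tau> steps back and are charged the trivial bound
  \<open>2 * c\<close>; there are at most \<tau> of them, which produces the lone summand \<tau>.
  The constant is the crude sum of all coefficients, which is enough since every cross term is
  nonnegative.\<close>

lemma noise_sum_bound: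
  fixes n :: "nat \<Rightarrow> real"
  assumes "\<And>t. t \<le> T \<Longrightarrow> n t \<le> 2 * c" "\<And>t. t \<le> T \<Longrightarrow> \<tau> \<le> t \<Longrightarrow> n t \<le> 2 * c * (real \<tau> * (\<beta> * cE)) + c * m * e"
    and "0 \<le> c" "0 \<le> cE" "0 \<le> m" "0 \<le> e" "0 \<le> \<beta>"
  shows "(\<Sum>t\<le>T. n t) \<le> (2 * c + 2 * c * cE + c * m) * (real \<tau> + (real T + 1) * (\<beta> * real \<tau> + e))"
proof -
  have p: "0 \<le> 2 * c * (real \<tau> * (\<beta> * cE)) + c * m * e" using assms by auto
  have "(\<Sum>t\<le>T. n t) \<le> (\<Sum>t\<le>T. (if t < \<tau> then 2 * c else 0) + (2 * c * (real \<tau> * (\<beta> * cE)) + c * m * e))"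
  proof (rule sum_mono)
    fix t assume t: "t \<in> {..T}"
    show "n t \<le> (if t < \<tau> then 2 * c else 0) + (2 * c * (real \<tau> * (\<beta> * cE)) + c * m * e)"
      using assms(1,2)[of t] t p by (cases "t < \<tau>") auto
  qed
  also have "\<dots> = (\<Sum>t\<le>T. (if t < \<tau> then 2 * c else 0)) + (real T + 1) * (2 * c * (real \<tau> * (\<beta> * cE)) + c * m * e)"
    by (simp add: sum.distrib algebra_simps)
  also have "(\<Sum>t\<le>T. (if t < \<tau> then 2 * c else 0)) \<le> (\<Sum>t<\<tau>. 2 * c)"
    unfolding sum.inter_filter[symmetric, OF finite_atMost] using assms by (intro sum_mono2) auto
  also have "(\<Sum>t<\<tau>. 2 * c) = 2 * c * real \<tau>" by simp
  also have "2 * c * real \<tau> + (real T + 1) * (2 * c * (real \<tau> * (\<beta> * cE)) + c * m * e)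
     \<le> (2 * c + 2 * c * cE + c * m) * (real \<tau> + (real T + 1) * (\<beta> * real \<tau> + e))"
  proof -
    have "0 \<le> c * cE * real \<tau>" "0 \<le> c * m * real \<tau>" "0 \<le> (real T + 1) * c * \<beta> * real \<tau>" "0 \<le> (real T + 1) * c * e"
      "0 \<le> (real T + 1) * c * cE * e" "0 \<le> (real T + 1) * c * m * \<beta> * real \<tau>"
      using assms(3-) by auto
    moreover have "(2 * c + 2 * c * cE + c * m) * (real \<tau> + (real T + 1) * (\<beta> * real \<tau> + e))
      - (2 * c * real \<tau> + (real T + 1) * (2 * c * (real \<tau> * (\<beta> * cE)) + c * m * e))
      = 2 * (c * cE * real \<tau>) + c * m * real \<tau> + 2 * ((real T + 1) * c * \<beta> * real \<tau>) + 2 * ((real T + 1) * c * e)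
        + 2 * ((real T + 1) * c * cE * e) + (real T + 1) * c * m * \<beta> * real \<tau>"
      by (simp add: algebra_simps)
    ultimately show ?thesis by linarith
  qed
  finally show ?thesis by simp
qed

text \<open>The order of quantifiers is the point: \<open>K\<close> precedes stepsizes, horizon and
  lag, so it is independent of T and the lag can still be optimised. The condition
  \<open>\<alpha> \<le> \<beta>\<close> lets the movement of the pair, and of the target
  \<open>W\<close>, be measured in units of \<open>\<beta>\<close>.\<close>

lemma expected_gradient_sum_bound:
  fixes \<Omega> :: "'w measure" and X :: "nat \<Rightarrow> 'w \<Rightarrow> 'x"
  assumes \<Omega>: "prob_space \<Omega>" and X[measurable]: "\<And>t. X t \<in> \<Omega> \<rightarrow>\<^sub>M \<nu>" and m: "0 \<le> m" and \<rho>: "0 < \<rho>"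
  shows "\<exists>K\<ge>0. \<forall>\<alpha> \<beta> T \<tau> \<theta> \<omega>. 0 < \<alpha> \<longrightarrow> \<alpha> \<le> \<beta> \<longrightarrow> \<beta> \<le> 1 \<longrightarrow> gq_process \<Omega> X R T m \<rho> \<alpha> \<beta> \<theta> \<omega> \<longrightarrow>
     (\<Sum>t\<le>T. \<integral>w. (norm (D (\<theta> t w)))\<^sup>2 \<partial>\<Omega>) \<le> K * error_budget \<alpha> \<beta> T (real \<tau>) (\<rho> ^ \<tau>)"
proof -
  interpret O: prob_space \<Omega> by fact
  have XS: "X t w \<in> space \<nu>" if "w \<in> space \<Omega>" for t w using measurable_space[OF X that] .

  let ?B = "box2 R" and ?u = "{()}"
  obtain c1 where "bounded_lipschitz_const c1 ?B (space \<nu>) F1"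
    using bl_F1[of R] by (rule bounded_lipschitz_onE)
  note c1 = bounded_lipschitz_constD[OF this]
  obtain c2 where "bounded_lipschitz_const c2 ?B (space \<nu>) F2"
    using bl_F2[of R] by (rule bounded_lipschitz_onE)
  note c2 = bounded_lipschitz_constD[OF this]
  obtain cG where "bounded_lipschitz_const cG ?B (space \<nu>) (\<lambda>e. G (fst e) (snd e))"
    using bl_G[of R] by (rule bounded_lipschitz_onE)
  note cG = bounded_lipschitz_constD[OF this]
  obtain cH where "bounded_lipschitz_const cH ?B (space \<nu>) (\<lambda>e. H (fst e) (snd e))"
    using bl_H[of R] by (rule bounded_lipschitz_onE)
  note cH = bounded_lipschitz_constD[OF this]
  obtain cU where "bounded_lipschitz_const cU (cball 0 R) (space \<nu>) U"
    using U_bl[of R] by (rule bounded_lipschitz_onE)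
  note cU = bounded_lipschitz_constD[OF this]
  obtain cJ where "bounded_lipschitz_const cJ (cball 0 R) ?u (\<lambda>\<theta> x. J \<theta>)"
    using bl_J[of R ?u] by (rule bounded_lipschitz_onE)
  note cJ = bounded_lipschitz_constD[OF this]
  obtain cD where "bounded_lipschitz_const cD (cball 0 R) ?u (\<lambda>\<theta> x. D \<theta>)"
    using bl_D[of R ?u] by (rule bounded_lipschitz_onE)
  note cD = bounded_lipschitz_constD[OF this]
  obtain cW where "bounded_lipschitz_const cW (cball 0 R) ?u (\<lambda>\<theta> x. W \<theta>)"
    using bl_W[of R ?u] by (rule bounded_lipschitz_onE)
  note cW = bounded_lipschitz_constD[OF this]
  obtain L where L: "0 \<le> L" "\<And>\<theta> \<theta>'. \<theta> \<in> cball 0 R \<Longrightarrow> \<theta>' \<in> cball 0 R \<Longrightarrow>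
     \<bar>J \<theta>' - J \<theta> - D \<theta> \<bullet> (\<theta>' - \<theta>)\<bar> \<le> L * (norm (\<theta>' - \<theta>))\<^sup>2"
    using J_remainder[of R] by blast
  obtain l where l: "0 < l" "\<And>v. l * (norm v)\<^sup>2 \<le> v \<bullet> (C *v v)" using C_pos by blast
  \<comment> \<open>\<open>cE\<close> is the speed of the pair per unit of \<open>\<beta>\<close>
    and \<open>cz\<close> bounds the tracking error. \<open>q\<close> arises from Young's
    inequality, \<open>p\<close> from the cross term between tracking error and moving target,
    \<open>s\<close> and \<open>s'\<close> from the second-order terms of the two
    recursions.\<close>
  define cE where "cE = cG + cH"
  define cz where "cz = \<bar>R\<bar> + cW"
  define q where "q = (\<gamma> * cU)\<^sup>2"
  define p where "p = 2 * cz * (cW * cG)"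
  define s where "s = (cH + cW * cG)\<^sup>2"
  define s' where "s' = L * cG\<^sup>2"
  define k1 where "k1 = 2 * c1 + 2 * c1 * cE + c1 * m"
  define k2 where "k2 = 2 * c2 + 2 * c2 * cE + c2 * m"
  have cE: "0 < cE" and cz: "0 < cz" and q: "0 \<le> q" and p: "0 \<le> p" and s: "0 \<le> s" and s': "0 \<le> s'"
    and k1: "0 \<le> k1" and k2: "0 \<le> k2"
    using cG(1) cH(1) cW(1) L(1) c1(1) c2(1) m
    by (auto simp: cE_def cz_def q_def p_def s_def s'_def k1_def k2_def intro!: add_nonneg_nonneg mult_nonneg_nonneg)
  \<comment> \<open>\<open>cz\<close> appears squared because the sequence bounded in the
    deterministic lemma is the expected squared tracking error.\<close>
  define K where "K = 4 * (2 * cJ + k1 + q * ((cz\<^sup>2 + 2 * k2 + p + s) / (2 * l)) + s')"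
  have "0 \<le> K"
    unfolding K_def using q p s s' k1 k2 l(1) cJ(1)
    by (intro mult_nonneg_nonneg add_nonneg_nonneg divide_nonneg_nonneg) auto
  moreover have "(\<Sum>t\<le>T. \<integral>w. (norm (D (\<theta> t w)))\<^sup>2 \<partial>\<Omega>) \<le> K * error_budget \<alpha> \<beta> T (real \<tau>) (\<rho> ^ \<tau>)"
    if step: "0 < \<alpha>" "\<alpha> \<le> \<beta>" "\<beta> \<le> 1" and proc: "gq_process \<Omega> X R T m \<rho> \<alpha> \<beta> \<theta> \<omega>"
    for \<alpha> \<beta> T \<tau> \<theta> \<omega>
  proof -
    have \<theta>m: "\<theta> t \<in> borel_measurable \<Omega>" and \<omega>m: "\<omega> t \<in> borel_measurable \<Omega>"
      and ball: "t \<le> Suc T \<Longrightarrow> AE w in \<Omega>. norm (\<theta> t w) \<le> R \<and> norm (\<omega> t w) \<le> R"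
      and \<theta>rec: "w \<in> space \<Omega> \<Longrightarrow> \<theta> (Suc t) w = \<theta> t w + \<alpha> *\<^sub>R G (\<theta> t w) (\<omega> t w) (X t w)"
      and \<omega>rec: "w \<in> space \<Omega> \<Longrightarrow> \<omega> (Suc t) w = \<omega> t w + \<beta> *\<^sub>R H (\<theta> t w) (\<omega> t w) (X t w)"
      and mix: "mixing_bound \<Omega> X (\<lambda>t w. (\<theta> t w, \<omega> t w)) m \<rho>" for t w
      using proc unfolding gq_process_def by blast+
    note [measurable] = \<theta>m \<omega>m
    define E where "E t w = (\<theta> t w, \<omega> t w)" for t w
    have E_meas: "E t \<in> borel_measurable \<Omega>" for t unfolding E_def by simp
    have Eball: "AE w in \<Omega>. E t w \<in> ?B" if "t \<le> Suc T" for t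
      using ball[OF that] by eventually_elim (simp add: E_def)
    have \<beta>: "0 < \<beta>" using step by simp
    have Gle: "norm (G (\<theta> t w) (\<omega> t w) (X t w)) \<le> cG" if "w \<in> space \<Omega>" "E t w \<in> ?B" for t w
      using cG(2)[OF XS that(2)] that(1) by (simp add: E_def)
    have Hle: "norm (H (\<theta> t w) (\<omega> t w) (X t w)) \<le> cH" if "w \<in> space \<Omega>" "E t w \<in> ?B" for t w
      using cH(2)[OF XS that(2)] that(1) by (simp add: E_def)
    have drift: "AE w in \<Omega>. norm (E (Suc t) w - E t w) \<le> \<beta> * cE" if "t < Suc T" for t
      using Eball[of t, OF less_imp_le[OF that]] AE_space
    proof eventually_elim
      case (elim w)
      have "norm (E (Suc t) w - E t w) = norm (\<alpha> *\<^sub>R G (\<theta> t w) (\<omega> t w) (X t w), \<beta> *\<^sub>R H (\<theta> t w) (\<omega> t w) (X t w))"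
        using elim by (simp add: E_def \<theta>rec \<omega>rec)
      also have "\<dots> \<le> \<alpha> * norm (G (\<theta> t w) (\<omega> t w) (X t w)) + \<beta> * norm (H (\<theta> t w) (\<omega> t w) (X t w))"
        using norm_Pair_le[of "\<alpha> *\<^sub>R G (\<theta> t w) (\<omega> t w) (X t w)" "\<beta> *\<^sub>R H (\<theta> t w) (\<omega> t w) (X t w)"] step by simp
      also have "\<dots> \<le> \<beta> * cG + \<beta> * cH"
        using Gle[OF elim(2,1)] Hle[OF elim(2,1)] step by (intro add_mono mult_mono) auto
      finally show ?case by (simp add: cE_def distrib_left)
    qed
    have d0: "0 \<le> \<beta> * cE" using \<beta> cE by simp
    have Emix: "mixing_bound \<Omega> X E m \<rho>" using mix by (simp add: E_def[abs_def])
    note noise1 = markov_noise_bound[OF \<Omega> X E_meas F1_meas c1(1) c1(2)[unfolded real_norm_def] c1(3)[unfolded real_norm_def] Eball drift Emix d0]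
    note noise2 = markov_noise_bound[OF \<Omega> X E_meas F2_meas c2(1) c2(2)[unfolded real_norm_def] c2(3)[unfolded real_norm_def] Eball drift Emix d0]
    define z where "z t w = \<omega> t w - W (\<theta> t w)" for t w
    have z_meas[measurable]: "z t \<in> borel_measurable \<Omega>" for t unfolding z_def by measurable
    have zle: "norm (z t w) \<le> cz" if "E t w \<in> ?B" for t w
    proof -
      have "norm (W (\<theta> t w)) \<le> cW" "norm (\<omega> t w) \<le> R" using that cW(2)[of "()" "\<theta> t w"] by (auto simp: E_def)
      then show ?thesis
        using norm_triangle_ineq4[of "\<omega> t w" "W (\<theta> t w)"] abs_ge_self[of R] unfolding z_def cz_def by linarith
    qed
    define d where "d t = (\<integral>w. (norm (D (\<theta> t w)))\<^sup>2 \<partial>\<Omega>)" for t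
    define \<zeta> where "\<zeta> t = (\<integral>w. (norm (z t w))\<^sup>2 \<partial>\<Omega>)" for t
    define j where "j t = (\<integral>w. J (\<theta> t w) \<partial>\<Omega>)" for t
    define n1 where "n1 t = (\<integral>w. F1 (E t w) (X t w) \<partial>\<Omega>) - (\<integral>w. (\<integral>x. F1 (E t w) x \<partial>\<nu>) \<partial>\<Omega>)" for t
    define n2 where "n2 t = (\<integral>w. F2 (E t w) (X t w) \<partial>\<Omega>) - (\<integral>w. (\<integral>x. F2 (E t w) x \<partial>\<nu>) \<partial>\<Omega>)" for t
    have id: "integrable \<Omega> (\<lambda>w. (norm (D (\<theta> t w)))\<^sup>2)" if "t \<le> Suc T" for t
    proof (rule O.integrable_const_bound[where B="cD\<^sup>2"])
      show "AE w in \<Omega>. norm ((norm (D (\<theta> t w)))\<^sup>2) \<le> cD\<^sup>2"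
        using Eball[OF that] by eventually_elim (use cD(2)[of "()"] in \<open>simp add: E_def power_mono\<close>)
    qed measurable
    have iz: "integrable \<Omega> (\<lambda>w. (norm (z t w))\<^sup>2)" if "t \<le> Suc T" for t
    proof (rule O.integrable_const_bound[where B="cz\<^sup>2"])
      show "AE w in \<Omega>. norm ((norm (z t w))\<^sup>2) \<le> cz\<^sup>2"
        using Eball[OF that] by eventually_elim (use zle in \<open>simp add: power_mono\<close>)
    qed measurable
    have AJ: "AE w in \<Omega>. \<bar>J (\<theta> t w)\<bar> \<le> cJ" if "t \<le> Suc T" for t
      using Eball[OF that] by eventually_elim (use cJ(2)[of "()"] in \<open>simp add: E_def\<close>)
    have ij: "integrable \<Omega> (\<lambda>w. J (\<theta> t w))" if "t \<le> Suc T" for t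
      by (rule O.integrable_const_bound[where B=cJ]) (use AJ[OF that] in auto)
    have jb: "\<bar>j t\<bar> \<le> cJ" if "t \<le> Suc T" for t
      unfolding j_def using AJ[OF that] cJ(1) by (intro O.integral_abs_le) auto
    have \<zeta>b: "0 \<le> \<zeta> t \<and> \<zeta> t \<le> cz\<^sup>2" if "t \<le> Suc T" for t
    proof -
      have "\<bar>\<zeta> t\<bar> \<le> cz\<^sup>2" unfolding \<zeta>_def
      proof (rule O.integral_abs_le)
        show "AE w in \<Omega>. \<bar>(norm (z t w))\<^sup>2\<bar> \<le> cz\<^sup>2"
          using Eball[OF that] by eventually_elim (use zle in \<open>simp add: power_mono\<close>)
      qed simp
      then show ?thesis by (simp add: \<zeta>_def)
    qed
    have n1_eq: "(\<integral>w. F1 (E t w) (X t w) \<partial>\<Omega>) = n1 t - d t / 2" if "t \<le> T" for t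
      unfolding n1_def F1_mean d_def by (simp add: E_def)
    have n2_le: "(\<integral>w. F2 (E t w) (X t w) \<partial>\<Omega>) \<le> n2 t - l * \<zeta> t" if "t \<le> T" for t
    proof -
      have "l * \<zeta> t = (\<integral>w. l * (norm (z t w))\<^sup>2 \<partial>\<Omega>)" unfolding \<zeta>_def by simp
      also have "\<dots> \<le> (\<integral>w. - (\<integral>x. F2 (E t w) x \<partial>\<nu>) \<partial>\<Omega>)"
      proof (rule integral_mono)
        show "integrable \<Omega> (\<lambda>w. l * (norm (z t w))\<^sup>2)" using iz[of t] that by simp
        show "integrable \<Omega> (\<lambda>w. - (\<integral>x. F2 (E t w) x \<partial>\<nu>))" using noise2(2)[of t] that by simp
        fix w show "l * (norm (z t w))\<^sup>2 \<le> - (\<integral>x. F2 (E t w) x \<partial>\<nu>)"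
          unfolding F2_mean using l(2)[of "z t w"] by (simp add: E_def z_def)
      qed
      finally show ?thesis unfolding n2_def by simp
    qed
    have descent: "\<alpha> / 4 * d t \<le> j t - j (Suc t) + \<alpha> * n1 t + \<alpha> * q * \<zeta> t + s' * \<alpha>\<^sup>2" if t: "t \<le> T" for t
    proof -
      have "j (Suc t) \<le> (\<integral>w. J (\<theta> t w) + \<alpha> * F1 (E t w) (X t w) + \<alpha> / 4 * (norm (D (\<theta> t w)))\<^sup>2
          + \<alpha> * q * (norm (z t w))\<^sup>2 + s' * \<alpha>\<^sup>2 \<partial>\<Omega>)"
        unfolding j_def
      proof (rule integral_mono_AE)
        show "integrable \<Omega> (\<lambda>w. J (\<theta> (Suc t) w))" using ij t by simp
        show "integrable \<Omega> (\<lambda>w. J (\<theta> t w) + \<alpha> * F1 (E t w) (X t w) + \<alpha> / 4 * (norm (D (\<theta> t w)))\<^sup>2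
          + \<alpha> * q * (norm (z t w))\<^sup>2 + s' * \<alpha>\<^sup>2)"
          using ij[of t] id[of t] iz[of t] noise1(1)[of t] t by simp
        have "t \<le> Suc T" "Suc t \<le> Suc T" using t by auto
        from Eball[OF this(1)] Eball[OF this(2)] AE_space
        show "AE w in \<Omega>. J (\<theta> (Suc t) w) \<le> J (\<theta> t w) + \<alpha> * F1 (E t w) (X t w) + \<alpha> / 4 * (norm (D (\<theta> t w)))\<^sup>2
          + \<alpha> * q * (norm (z t w))\<^sup>2 + s' * \<alpha>\<^sup>2"
        proof eventually_elim
          case (elim w)
          let ?\<theta> = "\<theta> t w" and ?\<omega> = "\<omega> t w" and ?x = "X t w"
          have x: "?x \<in> space \<nu>" using XS elim by simp
          have th: "?\<theta> \<in> cball 0 R" "\<theta> (Suc t) w \<in> cball 0 R" using elim by (auto simp: E_def)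
          have diff: "\<theta> (Suc t) w - ?\<theta> = \<alpha> *\<^sub>R G ?\<theta> ?\<omega> ?x" using \<theta>rec elim by simp
          have "J (\<theta> (Suc t) w) \<le> J ?\<theta> + D ?\<theta> \<bullet> (\<theta> (Suc t) w - ?\<theta>) + L * (norm (\<theta> (Suc t) w - ?\<theta>))\<^sup>2"
            using L(2)[OF th] by linarith
          \<comment> \<open>The slow direction depends on \<omega> only through the correction term,
            so exchanging \<omega> for its target leaves one product linear in the tracking
            error.\<close>
          also have "D ?\<theta> \<bullet> (\<theta> (Suc t) w - ?\<theta>) = \<alpha> * (F1 (E t w) ?x - \<gamma> * (z t w \<bullet> f ?x) * (D ?\<theta> \<bullet> U ?\<theta> ?x))"
            unfolding diff by (simp add: F1_def G_def E_def z_def inner_diff_left inner_diff_right algebra_simps)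
          also have "\<dots> \<le> \<alpha> * (F1 (E t w) ?x + ((norm (D ?\<theta>))\<^sup>2 / 4 + q * (norm (z t w))\<^sup>2))"
          proof (intro mult_left_mono)
            have "\<bar>z t w \<bullet> f ?x\<bar> \<le> norm (z t w) * norm (f ?x)" by (rule Cauchy_Schwarz_ineq2)
            also have "\<dots> \<le> norm (z t w)" using f_bound[OF x] by (simp add: mult_left_le)
            finally have 1: "\<bar>z t w \<bullet> f ?x\<bar> \<le> norm (z t w)" .
            have "\<bar>D ?\<theta> \<bullet> U ?\<theta> ?x\<bar> \<le> norm (D ?\<theta>) * norm (U ?\<theta> ?x)" by (rule Cauchy_Schwarz_ineq2)
            also have "\<dots> \<le> norm (D ?\<theta>) * cU" using cU(2)[OF x th(1)] by (intro mult_left_mono) auto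
            finally have 2: "\<bar>D ?\<theta> \<bullet> U ?\<theta> ?x\<bar> \<le> norm (D ?\<theta>) * cU" .
            have "\<bar>\<gamma> * (z t w \<bullet> f ?x) * (D ?\<theta> \<bullet> U ?\<theta> ?x)\<bar> \<le> \<bar>\<gamma>\<bar> * norm (z t w) * (norm (D ?\<theta>) * cU)"
              unfolding abs_mult using 1 2 by (intro mult_mono) auto
            also have "\<dots> \<le> (norm (D ?\<theta>))\<^sup>2 / 4 + q * (norm (z t w))\<^sup>2"
            proof -
              \<comment> \<open>Young's inequality weighted to give a quarter of the squared
                gradient: the mean of \<open>F1\<close> provides one half, and a quarter
                survives.\<close>
              have "0 \<le> (norm (D ?\<theta>) / 2 - \<bar>\<gamma>\<bar> * cU * norm (z t w))\<^sup>2" by simp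
              also have "\<dots> = (norm (D ?\<theta>))\<^sup>2 / 4 + q * (norm (z t w))\<^sup>2 - \<bar>\<gamma>\<bar> * norm (z t w) * (norm (D ?\<theta>) * cU)"
                by (simp add: power2_diff power_mult_distrib power_divide q_def)
              finally show ?thesis by simp
            qed
            finally show "F1 (E t w) ?x - \<gamma> * (z t w \<bullet> f ?x) * (D ?\<theta> \<bullet> U ?\<theta> ?x)
                \<le> F1 (E t w) ?x + ((norm (D ?\<theta>))\<^sup>2 / 4 + q * (norm (z t w))\<^sup>2)" by linarith
          qed (use step in simp)
          also have "L * (norm (\<theta> (Suc t) w - ?\<theta>))\<^sup>2 \<le> L * (\<alpha>\<^sup>2 * cG\<^sup>2)"
            unfolding diff using Gle[OF elim(3,1)] L(1) step
            by (intro mult_left_mono) (auto simp: power_mult_distrib intro!: power_mono mult_left_mono)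
          finally show ?case by (simp add: s'_def algebra_simps)
        qed
      qed
      also have "\<dots> = j t + \<alpha> * (\<integral>w. F1 (E t w) (X t w) \<partial>\<Omega>) + \<alpha> / 4 * d t + \<alpha> * q * \<zeta> t + s' * \<alpha>\<^sup>2"
        using ij[of t] id[of t] iz[of t] noise1(1)[of t] t
        by (simp add: j_def d_def \<zeta>_def O.prob_space)
      finally show ?thesis unfolding n1_eq[OF t] by (simp add: algebra_simps)
    qed
    have tracking: "2 * \<beta> * l * \<zeta> t \<le> \<zeta> t - \<zeta> (Suc t) + 2 * \<beta> * n2 t + p * \<alpha> + s * \<beta>\<^sup>2" if t: "t \<le> T" for t
    proof -
      have "\<zeta> (Suc t) \<le> (\<integral>w. (norm (z t w))\<^sup>2 + 2 * \<beta> * F2 (E t w) (X t w) + (p * \<alpha> + s * \<beta>\<^sup>2) \<partial>\<Omega>)"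
        unfolding \<zeta>_def
      proof (rule integral_mono_AE)
        show "integrable \<Omega> (\<lambda>w. (norm (z (Suc t) w))\<^sup>2)" using iz t by simp
        show "integrable \<Omega> (\<lambda>w. (norm (z t w))\<^sup>2 + 2 * \<beta> * F2 (E t w) (X t w) + (p * \<alpha> + s * \<beta>\<^sup>2))"
          using iz[of t] noise2(1)[of t] t by simp
        have "t \<le> Suc T" "Suc t \<le> Suc T" using t by auto
        from Eball[OF this(1)] Eball[OF this(2)] AE_space
        show "AE w in \<Omega>. (norm (z (Suc t) w))\<^sup>2 \<le> (norm (z t w))\<^sup>2 + 2 * \<beta> * F2 (E t w) (X t w) + (p * \<alpha> + s * \<beta>\<^sup>2)"
        proof eventually_elim
          case (elim w)
          let ?\<theta> = "\<theta> t w" and ?\<omega> = "\<omega> t w" and ?x = "X t w"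
          define h where "h = H ?\<theta> ?\<omega> ?x"
          define \<Delta> where "\<Delta> = W (\<theta> (Suc t) w) - W ?\<theta>"
          have th: "?\<theta> \<in> cball 0 R" "\<theta> (Suc t) w \<in> cball 0 R" using elim by (auto simp: E_def)
          have "norm \<Delta> \<le> cW * norm (\<theta> (Suc t) w - ?\<theta>)" unfolding \<Delta>_def using cW(3)[of "()"] th by simp
          also have "\<dots> \<le> cW * (\<alpha> * cG)"
            using \<theta>rec Gle[OF elim(3,1)] elim step cW(1) by (intro mult_left_mono) auto
          finally have \<Delta>: "norm \<Delta> \<le> cW * cG * \<alpha>" by (simp add: mult_ac)
          \<comment> \<open>The tracking error moves by the fast update minus the displacement of
            its target.\<close>
          have zeq: "z (Suc t) w = z t w + (\<beta> *\<^sub>R h - \<Delta>)"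
            using \<omega>rec elim by (simp add: z_def h_def \<Delta>_def)
          have "(norm (z (Suc t) w))\<^sup>2 = (norm (z t w))\<^sup>2 + 2 * (z t w \<bullet> (\<beta> *\<^sub>R h - \<Delta>)) + (norm (\<beta> *\<^sub>R h - \<Delta>))\<^sup>2"
            unfolding zeq power2_norm_eq_inner by (simp add: inner_add_left inner_add_right inner_commute)
          also have "z t w \<bullet> (\<beta> *\<^sub>R h - \<Delta>) = \<beta> * F2 (E t w) ?x - z t w \<bullet> \<Delta>"
            by (simp add: F2_def E_def z_def h_def inner_diff_right)
          finally have eq: "(norm (z (Suc t) w))\<^sup>2 = (norm (z t w))\<^sup>2 + 2 * \<beta> * F2 (E t w) ?x - 2 * (z t w \<bullet> \<Delta>) + (norm (\<beta> *\<^sub>R h - \<Delta>))\<^sup>2"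
            by simp
          have "\<bar>z t w \<bullet> \<Delta>\<bar> \<le> norm (z t w) * norm \<Delta>" by (rule Cauchy_Schwarz_ineq2)
          also have "\<dots> \<le> cz * (cW * cG * \<alpha>)" using zle[OF elim(1)] \<Delta> cz by (intro mult_mono) auto
          finally have "\<bar>z t w \<bullet> \<Delta>\<bar> \<le> cz * (cW * cG * \<alpha>)" .
          moreover have "p * \<alpha> = 2 * (cz * (cW * cG * \<alpha>))" unfolding p_def by (simp only: mult_ac)
          ultimately have i1: "- 2 * (z t w \<bullet> \<Delta>) \<le> p * \<alpha>" by linarith
          have "norm (\<beta> *\<^sub>R h - \<Delta>) \<le> norm (\<beta> *\<^sub>R h) + norm \<Delta>" by (rule norm_triangle_ineq4)
          also have "\<dots> \<le> \<beta> * cH + cW * cG * \<beta>"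
          proof (rule add_mono)
            show "norm (\<beta> *\<^sub>R h) \<le> \<beta> * cH" using Hle[OF elim(3,1)] \<beta> by (simp add: h_def)
            \<comment> \<open>Because \<open>\<alpha> \<le> \<beta>\<close>, the whole second-order
              term is of order \<open>\<beta>\<^sup>2\<close>; only the cross term with the target's
              drift keeps the smaller stepsize.\<close>
            have "cW * cG * \<alpha> \<le> cW * cG * \<beta>" using step cW(1) cG(1) by (intro mult_left_mono) auto
            then show "norm \<Delta> \<le> cW * cG * \<beta>" using \<Delta> by linarith
          qed
          also have "\<dots> = \<beta> * (cH + cW * cG)" by (simp add: algebra_simps)
          finally have "(norm (\<beta> *\<^sub>R h - \<Delta>))\<^sup>2 \<le> (\<beta> * (cH + cW * cG))\<^sup>2" by (rule power_mono) simp
          also have "\<dots> = s * \<beta>\<^sup>2" by (simp add: s_def power_mult_distrib)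
          finally show ?case using eq i1 by linarith
        qed
      qed
      also have "\<dots> = \<zeta> t + 2 * \<beta> * (\<integral>w. F2 (E t w) (X t w) \<partial>\<Omega>) + (p * \<alpha> + s * \<beta>\<^sup>2)"
        using iz[of t] noise2(1)[of t] t by (simp add: \<zeta>_def O.prob_space)
      also have "2 * \<beta> * (\<integral>w. F2 (E t w) (X t w) \<partial>\<Omega>) \<le> 2 * \<beta> * (n2 t - l * \<zeta> t)"
        using n2_le[OF t] \<beta> by (intro mult_left_mono) auto
      finally show ?thesis by (simp add: algebra_simps)
    qed
    have e0: "0 \<le> \<rho> ^ \<tau>" using \<rho> by simp
    have N1: "(\<Sum>t\<le>T. n1 t) \<le> k1 * (real \<tau> + (real T + 1) * (\<beta> * real \<tau> + \<rho> ^ \<tau>))"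
      unfolding k1_def n1_def by (rule noise_sum_bound) (use noise1(3,4) c1(1) cE m \<beta> e0 in auto)
    have N2: "(\<Sum>t\<le>T. n2 t) \<le> k2 * (real \<tau> + (real T + 1) * (\<beta> * real \<tau> + \<rho> ^ \<tau>))"
      unfolding k2_def n2_def by (rule noise_sum_bound) (use noise2(3,4) c2(1) cE m \<beta> e0 in auto)
    show ?thesis
      using two_timescale_sum_bound[OF step(1) \<beta> l(1) q p s s' _ _ _ k1 k2 jb \<zeta>b descent tracking N1 N2 e0]
        cJ(1) unfolding K_def d_def by simp
  qed
  ultimately show ?thesis by blast
qed

end

section \<open>The behavior chain and its mixing\<close>

lemma space_state_space[simp]: "space (state_space S) = S"
  by (simp add: state_space_def space_restrict_space)

lemma space_sa_space[simp]: "space (sa_space S) = S \<times> UNIV"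
  by (simp add: sa_space_def space_pair_measure)

locale behavior_chain = prob_space \<Omega> for \<Omega> :: "'w measure" +
  fixes S :: "(real^'d::finite) set"
    and P :: "(real^'d) \<times> 'a::finite \<Rightarrow> (real^'d) measure"
    and pib :: "real^'d \<Rightarrow> 'a pmf" and \<mu> :: "((real^'d) \<times> 'a) measure"
    and s0 :: "real^'d" and st :: "nat \<Rightarrow> 'w \<Rightarrow> real^'d" and act :: "nat \<Rightarrow> 'w \<Rightarrow> 'a"
    and m \<rho> :: real
  assumes P_kernel: "P \<in> sa_space S \<rightarrow>\<^sub>M prob_algebra (state_space S)"
    and pib_meas: "measurable_policy S pib"
    and invariant: "invariant_measure (sa_space S) (sa_kernel S P pib) \<mu>"
    and m_nonneg: "0 \<le> m" and rho: "0 < \<rho>" "\<rho> < 1"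
    and mixing: "\<And>t. t > 0 \<Longrightarrow>
         (SUP s\<in>S. tv_dist (kernel_pow (state_space S) (state_kernel P pib) t s)
                           (distr \<mu> (state_space S) fst)) \<le> m * \<rho> ^ t"
    and trajectory: "behavior_trajectory \<Omega> S P pib s0 st act"
begin

abbreviation "X1 \<equiv> state_space S"
abbreviation "XA \<equiv> (sa_space S :: ((real^'d) \<times> 'a) measure)"
abbreviation "XT \<equiv> XA \<Otimes>\<^sub>M X1"
abbreviation "hist \<equiv> history \<Omega> S st act"
abbreviation "KP \<equiv> kernel_pow X1 (state_kernel P pib)"
abbreviation "\<mu>S \<equiv> distr \<mu> X1 fst"
abbreviation "\<nu> \<equiv> transition_law S P \<mu>"

text \<open>Factors both chains: the state-action kernel is \<open>P\<close> followed by
  \<open>Q\<close>, and integrating against the state kernel means \<open>Q\<close> followed by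
  \<open>P\<close>.\<close>

definition Q :: "real^'d \<Rightarrow> ((real^'d) \<times> 'a) measure" where
  "Q s = distr (measure_pmf (pib s)) XA (Pair s)"

lemma st_meas[measurable]: "st t \<in> \<Omega> \<rightarrow>\<^sub>M X1" and act_meas[measurable]: "act t \<in> \<Omega> \<rightarrow>\<^sub>M count_space UNIV"
  using trajectory by (auto simp: behavior_trajectory_def)

lemma fst_XA[measurable]: "fst \<in> XA \<rightarrow>\<^sub>M X1" and snd_XA[measurable]: "snd \<in> XA \<rightarrow>\<^sub>M count_space UNIV"
  unfolding sa_space_def by measurable

lemma Pair_XA[measurable (raw)]:
  "f \<in> M \<rightarrow>\<^sub>M X1 \<Longrightarrow> g \<in> M \<rightarrow>\<^sub>M count_space UNIV \<Longrightarrow> (\<lambda>x. (f x, g x)) \<in> M \<rightarrow>\<^sub>M XA"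
  unfolding sa_space_def by measurable

lemma pib_kernel[measurable]: "(\<lambda>s. measure_pmf (pib s)) \<in> X1 \<rightarrow>\<^sub>M prob_algebra (count_space UNIV)"
proof (rule measurable_prob_algebraI)
  show "prob_space (measure_pmf (pib s))" for s by (rule prob_space_measure_pmf)
  show "(\<lambda>s. measure_pmf (pib s)) \<in> X1 \<rightarrow>\<^sub>M subprob_algebra (count_space UNIV)"
  proof (rule measurable_subprob_algebra)
    fix A :: "'a set"
    have "(\<lambda>s. ennreal (\<Sum>a\<in>A. pmf (pib s) a)) \<in> borel_measurable X1"
      using pib_meas unfolding measurable_policy_def by (intro measurable_compose[OF _ measurable_ennreal] borel_measurable_sum) auto
    then show "(\<lambda>s. emeasure (measure_pmf (pib s)) A) \<in> borel_measurable X1"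
      by (simp add: measure_pmf.emeasure_eq_measure measure_measure_pmf_finite)
  qed (auto intro: prob_space_imp_subprob_space prob_space_measure_pmf)
qed

lemma Q_kernel[measurable]: "Q \<in> X1 \<rightarrow>\<^sub>M prob_algebra XA"
  unfolding Q_def[abs_def] by (rule measurable_distr_prob_space2[OF pib_kernel]) measurable

declare P_kernel[measurable]

lemma Q_integral:
  fixes h :: "(real^'d) \<times> 'a \<Rightarrow> real"
  assumes "h \<in> borel_measurable XA" "s \<in> S"
  shows "(\<integral>x. h x \<partial>Q s) = (\<integral>a. h (s, a) \<partial>measure_pmf (pib s))"
proof -
  have "Pair s \<in> measure_pmf (pib s) \<rightarrow>\<^sub>M XA" using assms(2) by (auto simp: measurable_def)
  then show ?thesis unfolding Q_def using assms(1) by (rule integral_distr)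
qed

lemma SK_kernel[measurable]: "state_kernel P pib \<in> X1 \<rightarrow>\<^sub>M prob_algebra X1"
  unfolding state_kernel_def[abs_def]
  by (rule measurable_bind_prob_space2[OF pib_kernel]) measurable

lemma SA_kernel[measurable]: "sa_kernel S P pib \<in> XA \<rightarrow>\<^sub>M prob_algebra XA"
proof -
  have "sa_kernel S P pib = (\<lambda>x. P x \<bind> Q)" by (simp add: sa_kernel_def[abs_def] Q_def[abs_def])
  then show ?thesis using measurable_bind_prob_space[OF P_kernel Q_kernel] by simp
qed

lemma mu: "prob_space \<mu>" "sets \<mu> = sets XA" "\<mu> \<bind> sa_kernel S P pib = \<mu>"
  using invariant by (auto simp: invariant_measure_def space_prob_algebra)

lemma kernel_on_mu: "f \<in> XA \<rightarrow>\<^sub>M M \<Longrightarrow> f \<in> \<mu> \<rightarrow>\<^sub>M M"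
  using mu(2) by (simp cong: measurable_cong_sets)

lemma muS: "prob_space \<mu>S" "sets \<mu>S = sets X1"
  using prob_space.prob_space_distr[OF mu(1) kernel_on_mu[OF fst_XA]] by simp_all

lemma muS_integral:
  fixes g :: "real^'d \<Rightarrow> real"
  assumes "g \<in> borel_measurable X1"
  shows "(\<integral>s. g s \<partial>\<mu>S) = (\<integral>x. g (fst x) \<partial>\<mu>)"
  by (rule integral_distr[OF kernel_on_mu[OF fst_XA] assms])

lemma kernel_const_meas:
  fixes h :: "'y \<Rightarrow> real"
  assumes K: "K \<in> M \<rightarrow>\<^sub>M prob_algebra N" and h: "h \<in> borel_measurable N"
  shows "(\<lambda>x. \<integral>y. h y \<partial>K x) \<in> borel_measurable M"
  by (rule measurable_kernel_integral[OF _ K]) (use h in measurable)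

lemma mu_integral_step:
  fixes g :: "(real^'d) \<times> 'a \<Rightarrow> real"
  assumes g: "g \<in> borel_measurable XA" and b: "\<And>x. x \<in> space XA \<Longrightarrow> \<bar>g x\<bar> \<le> c"
  shows "(\<integral>x. g x \<partial>\<mu>) = (\<integral>x. (\<integral>s. (\<integral>y. g y \<partial>Q s) \<partial>P x) \<partial>\<mu>)"
proof -
  have "(\<integral>x. g x \<partial>\<mu>) = (\<integral>x. g x \<partial>(\<mu> \<bind> sa_kernel S P pib))" by (simp add: mu(3))
  also have "\<dots> = (\<integral>x. (\<integral>y. g y \<partial>sa_kernel S P pib x) \<partial>\<mu>)"
    by (rule integral_bind_bounded[OF g b kernel_on_mu[OF SA_kernel] mu(1)])
  also have "\<dots> = (\<integral>x. (\<integral>s. (\<integral>y. g y \<partial>Q s) \<partial>P x) \<partial>\<mu>)"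
  proof (rule Bochner_Integration.integral_cong[OF refl])
    fix x assume "x \<in> space \<mu>"
    then have x: "x \<in> space XA" using sets_eq_imp_space_eq[OF mu(2)] by simp
    have "Q \<in> P x \<rightarrow>\<^sub>M prob_algebra XA" using Q_kernel prob_kernelD(2)[OF P_kernel x] by (simp cong: measurable_cong_sets)
    then have "integral\<^sup>L (P x \<bind> Q) g = (\<integral>s. integral\<^sup>L (Q s) g \<partial>P x)"
      by (intro integral_bind_bounded[OF g b] prob_kernelD(1)[OF P_kernel x])
    then show "(\<integral>y. g y \<partial>sa_kernel S P pib x) = (\<integral>s. (\<integral>y. g y \<partial>Q s) \<partial>P x)"
      by (simp add: sa_kernel_def Q_def[abs_def])
  qed
  finally show ?thesis .
qed

text \<open>Invariance under the state-action chain forces \<open>\<mu>\<close> to be its state marginal followed by the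
  behavior policy; this is what lets mixing of the states alone control transitions.\<close>

lemma mu_disintegration:
  fixes g :: "(real^'d) \<times> 'a \<Rightarrow> real"
  assumes g: "g \<in> borel_measurable XA" and b: "\<And>x. x \<in> space XA \<Longrightarrow> \<bar>g x\<bar> \<le> c" and c: "0 \<le> c"
  shows "(\<integral>x. g x \<partial>\<mu>) = (\<integral>s. (\<integral>y. g y \<partial>Q s) \<partial>\<mu>S)"
proof -
  define q where "q s = (\<integral>y. g y \<partial>Q s)" for s
  have q: "q \<in> borel_measurable X1" unfolding q_def by (rule kernel_const_meas[OF Q_kernel g])
  have qb: "\<bar>q s\<bar> \<le> c" if "s \<in> S" for s
    unfolding q_def using kernel_integral_bound[OF Q_kernel, of s "\<lambda>_. g" c] that b c by auto
  have "(\<integral>s. q s \<partial>\<mu>S) = (\<integral>x. q (fst x) \<partial>\<mu>)" by (rule muS_integral[OF q])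
  \<comment> \<open>Invariance is used twice, here for the policy average of \<open>g\<close> and
    below, backwards, for \<open>g\<close> itself. After one step of the chain the two integrands
    coincide, since the action is then drawn from the policy at the new state.\<close>
  also have "\<dots> = (\<integral>x. (\<integral>s. (\<integral>y. q (fst y) \<partial>Q s) \<partial>P x) \<partial>\<mu>)"
    by (rule mu_integral_step[where c=c]) (use q qb in auto)
  also have "\<dots> = (\<integral>x. (\<integral>s. q s \<partial>P x) \<partial>\<mu>)"
  proof (intro Bochner_Integration.integral_cong refl)
    fix x s assume "x \<in> space \<mu>" "s \<in> space (P x)"
    then have s: "s \<in> S" using sets_eq_imp_space_eq[OF mu(2)] prob_kernelD(3)[OF P_kernel, of x] by simp
    have "(\<integral>y. q (fst y) \<partial>Q s) = (\<integral>a. q s \<partial>measure_pmf (pib s))"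
      using q s by (subst Q_integral) auto
    then show "(\<integral>y. q (fst y) \<partial>Q s) = q s" by simp
  qed
  also have "\<dots> = (\<integral>x. g x \<partial>\<mu>)" unfolding q_def by (rule mu_integral_step[OF g b, symmetric])
  finally show ?thesis by (simp add: q_def)
qed

section \<open>The stationary law of a transition and its reduction to the state\<close>

lemma T_kernel: "(\<lambda>x. distr (P x) XT (Pair x)) \<in> XA \<rightarrow>\<^sub>M prob_algebra XT"
  by (rule measurable_distr_prob_space2[OF P_kernel]) measurable

lemma nu_eq: "\<nu> = \<mu> \<bind> (\<lambda>x. distr (P x) XT (Pair x))"
  by (simp add: transition_law_def)

lemma nu_prob: "prob_space \<nu>"
  unfolding nu_eq by (rule prob_space_bind'[OF _ T_kernel]) (use mu in \<open>simp add: space_prob_algebra\<close>)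

lemma nu_sets: "sets \<nu> = sets XT"
proof -
  have "space \<mu> \<noteq> {}" using prob_space.not_empty[OF mu(1)] .
  then show ?thesis unfolding nu_eq
    using sets_bind[of \<mu> "\<lambda>x. distr (P x) XT (Pair x)" "XT"] by simp
qed

lemma nu_space: "space \<nu> = (S \<times> UNIV) \<times> S"
  using sets_eq_imp_space_eq[OF nu_sets] by (simp add: space_pair_measure)

lemma Pair_P: "x \<in> space XA \<Longrightarrow> Pair x \<in> P x \<rightarrow>\<^sub>M XT"
proof -
  assume x: "x \<in> space XA"
  have "Pair x \<in> X1 \<rightarrow>\<^sub>M XT" using x by simp
  then show ?thesis using prob_kernelD(2)[OF P_kernel x] by (simp cong: measurable_cong_sets)
qed

lemma nu_integral:
  fixes h :: "((real^'d) \<times> 'a) \<times> (real^'d) \<Rightarrow> real"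
  assumes h: "h \<in> borel_measurable XT" and b: "\<And>x. x \<in> space XT \<Longrightarrow> \<bar>h x\<bar> \<le> c"
  shows "(\<integral>x. h x \<partial>\<nu>) = (\<integral>x. (\<integral>y. h (x, y) \<partial>P x) \<partial>\<mu>)"
proof -
  have "(\<integral>x. h x \<partial>\<nu>) = (\<integral>x. (\<integral>z. h z \<partial>distr (P x) XT (Pair x)) \<partial>\<mu>)"
    unfolding nu_eq by (rule integral_bind_bounded[OF h b kernel_on_mu[OF T_kernel] mu(1)])
  also have "\<dots> = (\<integral>x. (\<integral>y. h (x, y) \<partial>P x) \<partial>\<mu>)"
    by (intro Bochner_Integration.integral_cong refl integral_distr[OF Pair_P h])
      (simp add: sets_eq_imp_space_eq[OF mu(2)])
  finally show ?thesis .
qed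

text \<open>Conditional mean of a transition function given the current state, with the parameter
  \<open>w\<close> held fixed. Through it, mixing of the states controls functions of state, action
  and next state.\<close>

definition fiber :: "('z \<Rightarrow> ((real^'d) \<times> 'a) \<times> (real^'d) \<Rightarrow> real) \<Rightarrow> 'z \<Rightarrow> real^'d \<Rightarrow> real" where
  "fiber h w s = (\<integral>x. (\<integral>y. h w (x, y) \<partial>P x) \<partial>Q s)"

lemma P_integral_meas:
  assumes h: "case_prod h \<in> borel_measurable (N \<Otimes>\<^sub>M XT)"
  shows "(\<lambda>(w, x). \<integral>y. (h w (x, y) :: real) \<partial>P x) \<in> borel_measurable (N \<Otimes>\<^sub>M XA)"
proof -
  have "(\<lambda>z. \<integral>y. (\<lambda>z y. h (fst z) (snd z, y)) z y \<partial>P (snd z)) \<in> borel_measurable (N \<Otimes>\<^sub>M XA)"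
  proof (rule measurable_kernel_integral)
    show "(\<lambda>z. P (snd z)) \<in> N \<Otimes>\<^sub>M XA \<rightarrow>\<^sub>M prob_algebra X1" by measurable
    have "(\<lambda>z. (fst (fst z), (snd (fst z), snd z))) \<in> (N \<Otimes>\<^sub>M XA) \<Otimes>\<^sub>M X1 \<rightarrow>\<^sub>M N \<Otimes>\<^sub>M XT" by measurable
    from measurable_compose[OF this h]
    show "(\<lambda>(z, y). h (fst z) (snd z, y)) \<in> borel_measurable ((N \<Otimes>\<^sub>M XA) \<Otimes>\<^sub>M X1)" by (simp add: split_beta')
  qed
  then show ?thesis by (simp add: split_beta')
qed

lemma fiber_meas:
  assumes h: "case_prod h \<in> borel_measurable (N \<Otimes>\<^sub>M XT)"
  shows "case_prod (fiber h) \<in> borel_measurable (N \<Otimes>\<^sub>M X1)"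
  using measurable_kernel_integral_fst[OF Q_kernel P_integral_meas[OF h]] by (simp add: fiber_def[abs_def] split_beta')

lemma P_integral_bound:
  fixes h :: "'z \<Rightarrow> ((real^'d) \<times> 'a) \<times> (real^'d) \<Rightarrow> real"
  assumes b: "\<And>w x. w \<in> space N \<Longrightarrow> x \<in> space XT \<Longrightarrow> \<bar>h w x\<bar> \<le> c" and c: "0 \<le> c"
    and "w \<in> space N" "x \<in> space XA"
  shows "\<bar>\<integral>y. h w (x, y) \<partial>P x\<bar> \<le> c"
  by (rule kernel_integral_bound[OF P_kernel, of x "\<lambda>x y. h w (x, y)" c]) (use assms in \<open>auto simp: space_pair_measure\<close>)

lemma fiber_bound:
  assumes b: "\<And>w x. w \<in> space N \<Longrightarrow> x \<in> space XT \<Longrightarrow> \<bar>h w x\<bar> \<le> c" and c: "0 \<le> c"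
    and w: "w \<in> space N" and s: "s \<in> S"
  shows "\<bar>fiber h w s\<bar> \<le> c"
  unfolding fiber_def
proof (rule kernel_integral_bound[OF Q_kernel, of s "\<lambda>_ x. \<integral>y. h w (x, y) \<partial>P x" c])
  fix x :: "(real^'d) \<times> 'a" assume "x \<in> space XA"
  then show "\<bar>\<integral>y. h w (x, y) \<partial>P x\<bar> \<le> c" using b c w by (intro P_integral_bound[where N=N]) auto
qed (use s c in auto)

text \<open>Disintegration of \<open>\<mu>\<close> makes the stationary mean of a transition
  function a stationary mean over states alone, matching the form in which
  \<open>transition_step\<close> expresses the actual mean.\<close>

lemma nu_fiber:
  assumes h: "case_prod h \<in> borel_measurable (N \<Otimes>\<^sub>M XT)"
    and b: "\<And>w x. w \<in> space N \<Longrightarrow> x \<in> space XT \<Longrightarrow> \<bar>h w x\<bar> \<le> c" and c: "0 \<le> c" and w: "w \<in> space N"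
  shows "(\<integral>x. h w x \<partial>\<nu>) = (\<integral>s. fiber h w s \<partial>\<mu>S)"
proof -
  have hw: "h w \<in> borel_measurable XT"
    using measurable_compose[OF measurable_Pair1'[OF w] h] by simp
  have "(\<integral>x. h w x \<partial>\<nu>) = (\<integral>x. (\<integral>y. h w (x, y) \<partial>P x) \<partial>\<mu>)"
    by (rule nu_integral[OF hw b[OF w]])
  also have "\<dots> = (\<integral>s. fiber h w s \<partial>\<mu>S)"
    unfolding fiber_def
  proof (rule mu_disintegration[where c=c])
    show "(\<lambda>x. \<integral>y. h w (x, y) \<partial>P x) \<in> borel_measurable XA"
      using measurable_compose[OF measurable_Pair1'[OF w] P_integral_meas[OF h]] by simp
  qed (use P_integral_bound[OF b c w] c in auto)
  finally show ?thesis .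
qed

section \<open>Histories and one-step conditional laws\<close>

lemma history_subalgebra: "subalgebra \<Omega> (hist t n)"
proof -
  let ?G = "{st i -` B \<inter> space \<Omega> | i B. i \<le> t \<and> B \<in> sets X1} \<union> {act i -` B \<inter> space \<Omega> | i B. i < n}"
  have "?G \<subseteq> sets \<Omega>" by (auto intro!: measurable_sets[OF st_meas] measurable_sets[OF act_meas])
  then have "sigma_sets (space \<Omega>) ?G \<subseteq> sets \<Omega>" by (rule sets.sigma_sets_subset)
  moreover have "?G \<subseteq> Pow (space \<Omega>)" by auto
  ultimately show ?thesis
    unfolding history_def subalgebra_def by (simp add: sets_measure_of space_measure_of_conv)
qed

lemma space_history: "space (hist t n) = space \<Omega>"
  using history_subalgebra[of t n] by (simp add: subalgebra_def)

lemma sets_history: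
  "sets (hist t n) = sigma_sets (space \<Omega>)
     ({st i -` B \<inter> space \<Omega> | i B. i \<le> t \<and> B \<in> sets X1} \<union> {act i -` B \<inter> space \<Omega> | i B. i < n})"
  unfolding history_def by (rule sets_measure_of) auto

lemma st_history: "i \<le> t \<Longrightarrow> st i \<in> hist t n \<rightarrow>\<^sub>M X1"
  using measurable_space[OF st_meas]
  by (intro measurableI) (auto simp: space_history sets_history intro!: sigma_sets.Basic)

lemma act_history:
  assumes "i < n"
  shows "act i \<in> hist t n \<rightarrow>\<^sub>M count_space UNIV"
proof (rule measurableI)
  fix A :: "'a set"
  show "act i -` A \<inter> space (hist t n) \<in> sets (hist t n)"
    unfolding space_history sets_history by (rule sigma_sets.Basic, rule UnI2) (use assms in blast)
qed simp

lemma history_mono: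
  assumes "t \<le> t'" "n \<le> n'" "W \<in> hist t n \<rightarrow>\<^sub>M N"
  shows "W \<in> hist t' n' \<rightarrow>\<^sub>M N"
proof -
  have "sets (hist t n) \<subseteq> sets (hist t' n')"
    unfolding sets_history
  proof (intro sigma_sets_mono' Un_mono)
    show "{st i -` B \<inter> space \<Omega> | i B. i \<le> t \<and> B \<in> sets X1} \<subseteq> {st i -` B \<inter> space \<Omega> | i B. i \<le> t' \<and> B \<in> sets X1}"
      using order_trans[OF _ assms(1)] by blast
    show "{act i -` B \<inter> space \<Omega> | i B. i < n} \<subseteq> {act i -` B \<inter> space \<Omega> | i B. i < n'}"
      using less_le_trans[OF _ assms(2)] by blast
  qed
  then show ?thesis using assms(3) by (auto simp: measurable_def space_history)
qed

text \<open>The trajectory prescribes conditional probabilities of single actions; with finitely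
  many actions, additivity extends them to sets outside one null set.\<close>

lemma action_cond_exp:
  "AE x in \<Omega>. real_cond_exp \<Omega> (hist t t) (indicator (act t -` B \<inter> space \<Omega>)) x
     = measure (measure_pmf (pib (st t x))) B"
proof -
  let ?F = "hist t t"
  interpret F: finite_measure_subalgebra \<Omega> ?F by unfold_locales (rule history_subalgebra)
  \<comment> \<open>Choosing the zero function off \<open>B\<close> makes every member of the family
    integrable, as the summation rule for conditional expectations demands.\<close>
  define f :: "'a \<Rightarrow> 'w \<Rightarrow> real" where
    "f a = (if a \<in> B then indicator (act t -` {a} \<inter> space \<Omega>) else (\<lambda>_. 0))" for a
  have f_meas[measurable]: "f a \<in> borel_measurable \<Omega>" for a unfolding f_def by simp
  have fi: "integrable \<Omega> (f a)" for a
    by (rule integrable_const_bound[where B=1]) (auto simp: f_def)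
  have eq: "(\<Sum>a\<in>B. f a x) = indicator (act t -` B \<inter> space \<Omega>) x" for x
  proof -
    have "(\<Sum>a\<in>B. f a x) = (\<Sum>a\<in>B. if a = act t x then indicator (space \<Omega>) x else 0)"
      by (intro sum.cong) (auto simp: f_def indicator_def)
    then show ?thesis by (auto simp: indicator_def)
  qed
  have "AE x in \<Omega>. real_cond_exp \<Omega> ?F (\<lambda>x. \<Sum>a\<in>B. f a x) x = (\<Sum>a\<in>B. real_cond_exp \<Omega> ?F (f a) x)"
    using fi by (rule F.real_cond_exp_sum)
  moreover have "AE x in \<Omega>. \<forall>a\<in>B. real_cond_exp \<Omega> ?F (f a) x = pmf (pib (st t x)) a"
  proof (rule AE_finite_allI)
    fix a assume "a \<in> B"
    then show "AE x in \<Omega>. real_cond_exp \<Omega> ?F (f a) x = pmf (pib (st t x)) a"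
      using trajectory by (simp add: f_def behavior_trajectory_def)
  qed simp
  ultimately show ?thesis
    unfolding eq by eventually_elim (simp add: measure_measure_pmf_finite)
qed

lemma action_step:
  fixes h :: "'z \<Rightarrow> (real^'d) \<times> 'a \<Rightarrow> real"
  assumes W: "W \<in> hist t t \<rightarrow>\<^sub>M N"
    and h: "case_prod h \<in> borel_measurable (N \<Otimes>\<^sub>M XA)"
    and b: "\<And>w x. w \<in> space N \<Longrightarrow> x \<in> space XA \<Longrightarrow> \<bar>h w x\<bar> \<le> c"
  shows "(\<integral>x. h (W x) (st t x, act t x) \<partial>\<Omega>) = (\<integral>x. (\<integral>y. h (W x) y \<partial>Q (st t x)) \<partial>\<Omega>)"
proof -
  have WS: "W x \<in> space N" if "x \<in> space \<Omega>" for x using measurable_space[OF W] that by (simp add: space_history)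
  have "(\<integral>x. h (W x) (st t x, act t x) \<partial>\<Omega>) = (\<integral>x. (\<lambda>z a. h (fst z) (snd z, a)) (W x, st t x) (act t x) \<partial>\<Omega>)" by simp
  also have "\<dots> = (\<integral>x. (\<integral>a. (\<lambda>z a. h (fst z) (snd z, a)) (W x, st t x) a \<partial>(\<lambda>z. measure_pmf (pib (snd z))) (W x, st t x)) \<partial>\<Omega>)"
  proof (rule conditional_law_integral[OF history_subalgebra[of t t], where c=c and N="N \<Otimes>\<^sub>M X1" and L="count_space UNIV"])
    show "(\<lambda>x. (W x, st t x)) \<in> hist t t \<rightarrow>\<^sub>M N \<Otimes>\<^sub>M X1"
      using W st_history[of t t t] by simp
    show "act t \<in> \<Omega> \<rightarrow>\<^sub>M count_space UNIV" by simp
    show "(\<lambda>z. measure_pmf (pib (snd z))) \<in> N \<Otimes>\<^sub>M X1 \<rightarrow>\<^sub>M prob_algebra (count_space UNIV)"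
      by (rule measurable_compose[OF measurable_snd pib_kernel])
    fix B show "AE x in \<Omega>. real_cond_exp \<Omega> (hist t t) (indicat_real (act t -` B \<inter> space \<Omega>)) x =
          measure (measure_pmf (pib (snd (W x, st t x)))) B"
      using action_cond_exp by simp
  next
    have "(\<lambda>z. (fst (fst z), (snd (fst z), snd z))) \<in> (N \<Otimes>\<^sub>M X1) \<Otimes>\<^sub>M count_space UNIV \<rightarrow>\<^sub>M N \<Otimes>\<^sub>M XA"
      unfolding sa_space_def by measurable
    from measurable_compose[OF this h]
    show "(\<lambda>(z, a). h (fst z) (snd z, a)) \<in> borel_measurable ((N \<Otimes>\<^sub>M X1) \<Otimes>\<^sub>M count_space UNIV)"
      by (simp add: split_beta')
  qed (use b in \<open>auto simp: space_pair_measure\<close>)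
  also have "\<dots> = (\<integral>x. (\<integral>y. h (W x) y \<partial>Q (st t x)) \<partial>\<Omega>)"
  proof (rule Bochner_Integration.integral_cong[OF refl])
    fix x assume x: "x \<in> space \<Omega>"
    have "h (W x) \<in> borel_measurable XA"
      using measurable_compose[OF measurable_Pair1'[OF WS[OF x]] h] by simp
    then show "(\<integral>a. (\<lambda>z a. h (fst z) (snd z, a)) (W x, st t x) a \<partial>(\<lambda>z. measure_pmf (pib (snd z))) (W x, st t x))
      = (\<integral>y. h (W x) y \<partial>Q (st t x))"
      using measurable_space[OF st_meas x] by (simp add: Q_integral)
  qed
  finally show ?thesis .
qed

text \<open>The next state is integrated out given the history including the current action, and the
  action given the history without it. This is why histories count states and actions
  separately.\<close>

lemma transition_step:
  fixes h :: "'z \<Rightarrow> ((real^'d) \<times> 'a) \<times> (real^'d) \<Rightarrow> real"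
  assumes W: "W \<in> hist t t \<rightarrow>\<^sub>M N"
    and h: "case_prod h \<in> borel_measurable (N \<Otimes>\<^sub>M XT)"
    and b: "\<And>w x. w \<in> space N \<Longrightarrow> x \<in> space XT \<Longrightarrow> \<bar>h w x\<bar> \<le> c" and c: "0 \<le> c"
  shows "(\<integral>x. h (W x) ((st t x, act t x), st (Suc t) x) \<partial>\<Omega>) = (\<integral>x. fiber h (W x) (st t x) \<partial>\<Omega>)"
proof -
  let ?F = "hist t (Suc t)"
  have W': "W \<in> ?F \<rightarrow>\<^sub>M N" by (rule history_mono[OF _ _ W]) auto
  have "(\<integral>x. h (W x) ((st t x, act t x), st (Suc t) x) \<partial>\<Omega>)
      = (\<integral>x. (\<lambda>z y. h (fst z) (snd z, y)) (W x, (st t x, act t x)) (st (Suc t) x) \<partial>\<Omega>)" by simp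
  also have "\<dots> = (\<integral>x. (\<integral>y. (\<lambda>z y. h (fst z) (snd z, y)) (W x, (st t x, act t x)) y \<partial>(\<lambda>z. P (snd z)) (W x, (st t x, act t x))) \<partial>\<Omega>)"
  proof (rule conditional_law_integral[OF history_subalgebra[of t "Suc t"], where c=c and N="N \<Otimes>\<^sub>M XA" and L=X1])
    show "(\<lambda>x. (W x, (st t x, act t x))) \<in> ?F \<rightarrow>\<^sub>M N \<Otimes>\<^sub>M XA"
      using W' st_history[of t t "Suc t"] act_history[of t "Suc t" t] by (intro measurable_Pair Pair_XA) auto
    show "st (Suc t) \<in> \<Omega> \<rightarrow>\<^sub>M X1" by simp
    show "(\<lambda>z. P (snd z)) \<in> N \<Otimes>\<^sub>M XA \<rightarrow>\<^sub>M prob_algebra X1"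
      by (rule measurable_compose[OF measurable_snd P_kernel])
    fix B assume "B \<in> sets X1"
    then show "AE x in \<Omega>. real_cond_exp \<Omega> ?F (indicat_real (st (Suc t) -` B \<inter> space \<Omega>)) x =
          measure (P (snd (W x, (st t x, act t x)))) B"
      using trajectory by (simp add: behavior_trajectory_def)
  next
    have "(\<lambda>z. (fst (fst z), (snd (fst z), snd z))) \<in> (N \<Otimes>\<^sub>M XA) \<Otimes>\<^sub>M X1 \<rightarrow>\<^sub>M N \<Otimes>\<^sub>M XT" by measurable
    from measurable_compose[OF this h]
    show "(\<lambda>(z, y). h (fst z) (snd z, y)) \<in> borel_measurable ((N \<Otimes>\<^sub>M XA) \<Otimes>\<^sub>M X1)"
      by (simp add: split_beta')
  qed (use b in \<open>auto simp: space_pair_measure\<close>)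
  also have "\<dots> = (\<integral>x. (\<lambda>w z. \<integral>y. h w (z, y) \<partial>P z) (W x) (st t x, act t x) \<partial>\<Omega>)" by simp
  also have "\<dots> = (\<integral>x. (\<integral>z. (\<lambda>w z. \<integral>y. h w (z, y) \<partial>P z) (W x) z \<partial>Q (st t x)) \<partial>\<Omega>)"
  proof (rule action_step[OF W, where c=c])
    show "(\<lambda>(w, z). \<integral>y. h w (z, y) \<partial>P z) \<in> borel_measurable (N \<Otimes>\<^sub>M XA)" by (rule P_integral_meas[OF h])
  qed (rule P_integral_bound[OF b c])
  finally show ?thesis by (simp add: fiber_def)
qed

section \<open>The Markov property and geometric mixing along the trajectory\<close>

lemma state_kernel_integral:
  fixes g :: "real^'d \<Rightarrow> real"
  assumes g: "g \<in> borel_measurable X1" and b: "\<And>s. s \<in> S \<Longrightarrow> \<bar>g s\<bar> \<le> c" and s: "s \<in> S"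
  shows "(\<integral>y. g y \<partial>state_kernel P pib s) = (\<integral>x. (\<integral>y. g y \<partial>P x) \<partial>Q s)"
proof -
  have K: "(\<lambda>a. P (s, a)) \<in> measure_pmf (pib s) \<rightarrow>\<^sub>M prob_algebra X1"
    using measurable_space[OF P_kernel, of "(s, _)"] s by (auto simp: measurable_def)
  have "(\<integral>y. g y \<partial>state_kernel P pib s) = (\<integral>a. (\<integral>y. g y \<partial>P (s, a)) \<partial>measure_pmf (pib s))"
    unfolding state_kernel_def by (rule integral_bind_bounded[OF g _ K prob_space_measure_pmf]) (use b in auto)
  also have "\<dots> = (\<integral>x. (\<integral>y. g y \<partial>P x) \<partial>Q s)"
    by (rule Q_integral[symmetric, OF kernel_const_meas[OF P_kernel g] s])
  finally show ?thesis .
qed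

lemma KP_kernel: "KP t \<in> X1 \<rightarrow>\<^sub>M prob_algebra X1"
proof (induction t)
  case 0
  have "KP 0 = return X1" by (rule ext) simp
  then show ?case using measurable_return_prob_space by metis
next
  case (Suc t)
  have "KP (Suc t) = (\<lambda>x. KP t x \<bind> state_kernel P pib)"
    by (rule ext) simp
  then show ?case using measurable_bind_prob_space[OF Suc.IH SK_kernel] by simp
qed

text \<open>\<open>kernel_pow\<close> appends a step at the end, so the induction removes the last
  step: \<open>g\<close> is replaced by its average under the state kernel. Hence the induction
  hypothesis has to hold for every \<open>g\<close>.\<close>

lemma markov_property:
  fixes g :: "'z \<Rightarrow> real^'d \<Rightarrow> real"
  assumes W: "W \<in> hist k k \<rightarrow>\<^sub>M N"
    and c: "0 \<le> c"
  shows "case_prod g \<in> borel_measurable (N \<Otimes>\<^sub>M X1) \<Longrightarrow> (\<And>w s. w \<in> space N \<Longrightarrow> s \<in> S \<Longrightarrow> \<bar>g w s\<bar> \<le> c) \<Longrightarrow>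
    (\<integral>x. g (W x) (st (k + t) x) \<partial>\<Omega>) = (\<integral>x. (\<integral>y. g (W x) y \<partial>KP t (st k x)) \<partial>\<Omega>)"
proof (induction t arbitrary: g)
  case (0 g)
  show ?case
  proof (rule Bochner_Integration.integral_cong[OF refl])
    fix x assume x: "x \<in> space \<Omega>"
    have "W x \<in> space N" using measurable_space[OF W] x by (simp add: space_history)
    then have "g (W x) \<in> borel_measurable X1" using measurable_compose[OF measurable_Pair1' 0(1)] by simp
    then show "g (W x) (st (k + 0) x) = (\<integral>y. g (W x) y \<partial>KP 0 (st k x))"
      using measurable_space[OF st_meas x] by (simp add: integral_return)
  qed
next
  case (Suc t g)
  note gm = Suc.prems(1) and gb = Suc.prems(2)
  have WS: "W x \<in> space N" if "x \<in> space \<Omega>" for x using measurable_space[OF W] that by (simp add: space_history)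
  define g' where "g' w s = (\<integral>y. g w y \<partial>state_kernel P pib s)" for w s
  have gw: "g w \<in> borel_measurable X1" if "w \<in> space N" for w
    using measurable_compose[OF measurable_Pair1'[OF that] gm] by simp
  have "(\<integral>x. g (W x) (st (k + Suc t) x) \<partial>\<Omega>) = (\<integral>x. (\<lambda>w z. g w (snd z)) (W x) ((st (k + t) x, act (k + t) x), st (Suc (k + t)) x) \<partial>\<Omega>)"
    by simp
  also have "\<dots> = (\<integral>x. fiber (\<lambda>w z. g w (snd z)) (W x) (st (k + t) x) \<partial>\<Omega>)"
  proof (rule transition_step[where c=c])
    show "W \<in> hist (k + t) (k + t) \<rightarrow>\<^sub>M N" by (rule history_mono[OF _ _ W]) auto
    have "(\<lambda>z. (fst z, snd (snd z))) \<in> N \<Otimes>\<^sub>M XT \<rightarrow>\<^sub>M N \<Otimes>\<^sub>M X1" by measurable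
    from measurable_compose[OF this gm]
    show "(\<lambda>(w, z). g w (snd z)) \<in> borel_measurable (N \<Otimes>\<^sub>M XT)" by (simp add: split_beta')
  qed (use gb c in \<open>auto simp: space_pair_measure\<close>)
  also have "\<dots> = (\<integral>x. g' (W x) (st (k + t) x) \<partial>\<Omega>)"
  proof (rule Bochner_Integration.integral_cong[OF refl])
    fix x assume x: "x \<in> space \<Omega>"
    have "st (k + t) x \<in> S" using measurable_space[OF st_meas x] by simp
    from state_kernel_integral[OF gw[OF WS[OF x]] gb[OF WS[OF x]] this]
    show "fiber (\<lambda>w z. g w (snd z)) (W x) (st (k + t) x) = g' (W x) (st (k + t) x)"
      unfolding g'_def fiber_def by simp
  qed
  also have "\<dots> = (\<integral>x. (\<integral>y. g' (W x) y \<partial>KP t (st k x)) \<partial>\<Omega>)"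
  proof (rule Suc.IH)
    show "case_prod g' \<in> borel_measurable (N \<Otimes>\<^sub>M X1)"
      using measurable_kernel_integral_fst[OF SK_kernel gm] by (simp add: g'_def[abs_def])
    fix w s assume w: "w \<in> space N" and s: "s \<in> S"
    show "\<bar>g' w s\<bar> \<le> c" unfolding g'_def
      by (rule kernel_integral_bound[OF SK_kernel, of s "\<lambda>_. g w" c]) (use s gb[OF w] c in auto)
  qed
  also have "\<dots> = (\<integral>x. (\<integral>y. g (W x) y \<partial>KP (Suc t) (st k x)) \<partial>\<Omega>)"
  proof (rule Bochner_Integration.integral_cong[OF refl])
    fix x assume x: "x \<in> space \<Omega>"
    have s: "st k x \<in> space X1" using measurable_space[OF st_meas x] .
    note KD = prob_kernelD[OF KP_kernel s, of t]
    have "state_kernel P pib \<in> KP t (st k x) \<rightarrow>\<^sub>M prob_algebra X1"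
      using SK_kernel KD(2) by (simp cong: measurable_cong_sets)
    from integral_bind_bounded[OF gw[OF WS[OF x]] _ this KD(1), where c=c] gb[OF WS[OF x]]
    show "(\<integral>y. g' (W x) y \<partial>KP t (st k x))
      = (\<integral>y. g (W x) y \<partial>KP (Suc t) (st k x))"
      by (simp add: g'_def)
  qed
  finally show ?case .
qed

text \<open>Mixing is given for positive times only. At time 0 the distance is at most 1, which
  \<open>m + 1\<close> accommodates.\<close>

lemma tv_bound:
  assumes s: "s \<in> S"
  shows "tv_dist (KP t s) \<mu>S \<le> (m + 1) * \<rho> ^ t"
proof (cases "t = 0")
  case True
  have "tv_dist (KP t s) \<mu>S \<le> 1"
    using s by (intro tv_dist_le_1 prob_kernelD(1)[OF KP_kernel] muS) auto
  then show ?thesis using True m_nonneg by simp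
next
  case False
  have "tv_dist (KP t s) \<mu>S \<le> (SUP s\<in>S. tv_dist (KP t s) \<mu>S)"
  \<comment> \<open>A real supremum dominates its members only if it is bounded above; total
    variation distances never exceed 1.\<close>
  proof (rule cSUP_upper[OF s bdd_aboveI2[where M=1]])
    fix s assume "s \<in> S"
    then show "tv_dist (KP t s) \<mu>S \<le> 1"
      by (intro tv_dist_le_1 prob_kernelD(1)[OF KP_kernel] muS) auto
  qed
  also have "\<dots> \<le> m * \<rho> ^ t" using mixing False by simp
  also have "\<dots> \<le> (m + 1) * \<rho> ^ t" using rho by (intro mult_right_mono) auto
  finally show ?thesis .
qed

text \<open>Once \<open>h\<close> is replaced by its \<open>fiber\<close>, both expectations average
  the same state function, under the law of \<open>t - k\<close> steps from \<open>st k\<close> and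
  under the stationary marginal. The comparison is made pointwise in the sample, where
  \<open>W\<close> is a constant, so dependence between \<open>W\<close> and the state does no
  harm.\<close>

lemma chain_mixing:
  fixes h :: "'z \<Rightarrow> ((real^'d) \<times> 'a) \<times> (real^'d) \<Rightarrow> real"
  assumes W: "W \<in> hist k k \<rightarrow>\<^sub>M N" and kt: "k \<le> t"
    and h: "case_prod h \<in> borel_measurable (N \<Otimes>\<^sub>M XT)"
    and b: "\<And>w x. w \<in> space N \<Longrightarrow> x \<in> space XT \<Longrightarrow> \<bar>h w x\<bar> \<le> c" and c: "0 < c"
  shows "\<bar>(\<integral>x. h (W x) ((st t x, act t x), st (Suc t) x) \<partial>\<Omega>) - (\<integral>x. (\<integral>y. h (W x) y \<partial>\<nu>) \<partial>\<Omega>)\<bar>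
    \<le> c * (2 * (m + 1)) * \<rho> ^ (t - k)"
proof -
  let ?K = "KP (t - k)"
  have c0: "0 \<le> c" using c by simp
  have WS: "W x \<in> space N" if "x \<in> space \<Omega>" for x using measurable_space[OF W] that by (simp add: space_history)
  have W\<Omega>: "W \<in> \<Omega> \<rightarrow>\<^sub>M N" by (rule measurable_from_subalg[OF history_subalgebra W])
  have fb: "\<bar>fiber h w s\<bar> \<le> c" if "w \<in> space N" "s \<in> S" for w s by (rule fiber_bound[OF b c0 that])
  have fw: "fiber h w \<in> borel_measurable X1" if "w \<in> space N" for w
    using measurable_compose[OF measurable_Pair1'[OF that] fiber_meas[OF h]] by simp
  have "(\<integral>x. h (W x) ((st t x, act t x), st (Suc t) x) \<partial>\<Omega>) = (\<integral>x. fiber h (W x) (st (k + (t - k)) x) \<partial>\<Omega>)"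
    using transition_step[OF history_mono[OF kt kt W] h b c0] kt by simp
  also have "\<dots> = (\<integral>x. (\<integral>y. fiber h (W x) y \<partial>?K (st k x)) \<partial>\<Omega>)"
    by (rule markov_property[OF W c0 fiber_meas[OF h] fb])
  finally have e1: "(\<integral>x. h (W x) ((st t x, act t x), st (Suc t) x) \<partial>\<Omega>) = (\<integral>x. (\<integral>y. fiber h (W x) y \<partial>?K (st k x)) \<partial>\<Omega>)" .
  have e2: "(\<integral>x. (\<integral>y. h (W x) y \<partial>\<nu>) \<partial>\<Omega>) = (\<integral>x. (\<integral>y. fiber h (W x) y \<partial>\<mu>S) \<partial>\<Omega>)"
    by (intro Bochner_Integration.integral_cong refl nu_fiber[OF h b c0 WS])
  have i1: "integrable \<Omega> (\<lambda>x. \<integral>y. fiber h (W x) y \<partial>?K (st k x))"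
  proof (rule integrable_const_bound[where B=c])
    have "(\<lambda>x. (W x, st k x)) \<in> \<Omega> \<rightarrow>\<^sub>M N \<Otimes>\<^sub>M X1" using W\<Omega> by simp
    from measurable_compose[OF this measurable_kernel_integral_fst[OF KP_kernel fiber_meas[OF h]]]
    show "(\<lambda>x. \<integral>y. fiber h (W x) y \<partial>?K (st k x)) \<in> borel_measurable \<Omega>" by simp
    show "AE x in \<Omega>. norm (\<integral>y. fiber h (W x) y \<partial>?K (st k x)) \<le> c"
    proof (rule AE_I2)
      fix x assume x: "x \<in> space \<Omega>"
      show "norm (\<integral>y. fiber h (W x) y \<partial>?K (st k x)) \<le> c"
        using kernel_integral_bound[OF KP_kernel measurable_space[OF st_meas x], where h="\<lambda>_. fiber h (W x)" and c=c] fb[OF WS[OF x]] c0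
        by simp
    qed
  qed
  interpret muS: prob_space \<mu>S by (rule muS)
  have i2: "integrable \<Omega> (\<lambda>x. \<integral>y. fiber h (W x) y \<partial>\<mu>S)"
  proof (rule integrable_const_bound[where B=c])
    have "(\<lambda>w. \<integral>y. fiber h w y \<partial>\<mu>S) \<in> borel_measurable N"
      by (rule muS.borel_measurable_lebesgue_integral)
        (use fiber_meas[OF h] sets_pair_measure_cong[OF refl muS(2), of N] in \<open>simp cong: measurable_cong_sets\<close>)
    from measurable_compose[OF W\<Omega> this]
    show "(\<lambda>x. \<integral>y. fiber h (W x) y \<partial>\<mu>S) \<in> borel_measurable \<Omega>" .
    show "AE x in \<Omega>. norm (\<integral>y. fiber h (W x) y \<partial>\<mu>S) \<le> c"
      using fb WS c0 by (intro AE_I2) (auto intro!: muS.integral_abs_le)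
  qed
  have "\<bar>(\<integral>x. (\<integral>y. fiber h (W x) y \<partial>?K (st k x)) - (\<integral>y. fiber h (W x) y \<partial>\<mu>S) \<partial>\<Omega>)\<bar> \<le> c * (2 * (m + 1)) * \<rho> ^ (t - k)"
  proof (rule integral_abs_le, rule AE_I2)
    fix x assume x: "x \<in> space \<Omega>"
    have s: "st k x \<in> space X1" using measurable_space[OF st_meas x] .
    note KD = prob_kernelD[OF KP_kernel s, of "t - k"]
    have "\<bar>(\<integral>y. fiber h (W x) y \<partial>?K (st k x)) - (\<integral>y. fiber h (W x) y \<partial>\<mu>S)\<bar> \<le> 2 * c * tv_dist (?K (st k x)) \<mu>S"
    proof (rule integral_diff_le_tv_dist[OF KD(1) muS(1) _ _ _ c])
      show "sets (?K (st k x)) = sets \<mu>S" using KD(2) muS(2) by simp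
      show "fiber h (W x) \<in> borel_measurable (?K (st k x))"
        using fw[OF WS[OF x]] KD(2) by (simp cong: measurable_cong_sets)
    qed (use fb[OF WS[OF x]] KD(3) in auto)
    also have "\<dots> \<le> 2 * c * ((m + 1) * \<rho> ^ (t - k))"
      using tv_bound[of "st k x" "t - k"] s c by (intro mult_left_mono) auto
    finally show "\<bar>(\<integral>y. fiber h (W x) y \<partial>?K (st k x)) - (\<integral>y. fiber h (W x) y \<partial>\<mu>S)\<bar> \<le> c * (2 * (m + 1)) * \<rho> ^ (t - k)"
      by (simp add: algebra_simps)
  qed (use c m_nonneg rho in simp)
  then show ?thesis unfolding e1 e2 using i1 i2 by simp
qed

end

section \<open>Greedy-GQ with a smooth target policy\<close>

text \<open>Presents a component of the gradient as a limit of difference quotients along a fixed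
  sequence, through which the gradient inherits measurability in the state from the policy.\<close>

lemma GDERIV_partial_LIMSEQ:
  assumes "\<And>z. GDERIV f z :> g z"
  shows "(\<lambda>n. (f (x + (1 / real (Suc n)) *\<^sub>R b) - f x) * real (Suc n)) \<longlonglongrightarrow> g x \<bullet> b"
proof -
  have "((\<lambda>t. f (x + t *\<^sub>R b)) has_real_derivative b \<bullet> g x) (at 0)"
    using GDERIV_segment[OF assms, of x "x + b" 0] by simp
  then have "(\<lambda>h. (f (x + h *\<^sub>R b) - f x) / h) \<midarrow>0\<rightarrow> b \<bullet> g x"
    by (simp add: DERIV_def)
  then have "(\<lambda>n. (f (x + (1 / real (Suc n)) *\<^sub>R b) - f x) / (1 / real (Suc n))) \<longlonglongrightarrow> b \<bullet> g x"
    unfolding LIMSEQ_SEQ_conv[symmetric]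
    using LIMSEQ_inverse_real_of_nat by (elim allE[of _ "\<lambda>n. 1 / real (Suc n)"]) (simp add: inverse_eq_divide)
  then show ?thesis by (simp add: inner_commute)
qed

locale gq_model = behavior_chain \<Omega> S P pib \<mu> s0 st act m \<rho>
  for \<Omega> :: "'w measure"
    and S :: "(real^'d::finite) set"
    and P :: "(real^'d) \<times> 'a::finite \<Rightarrow> (real^'d) measure"
    and pib :: "real^'d \<Rightarrow> 'a pmf" and \<mu> :: "((real^'d) \<times> 'a) measure"
    and s0 :: "real^'d" and st :: "nat \<Rightarrow> 'w \<Rightarrow> real^'d" and act :: "nat \<Rightarrow> 'w \<Rightarrow> 'a"
    and m \<rho> :: real +
  fixes r :: "('d, 'a) reward" and \<gamma> rmax k1 k2 :: real
    and \<phi> :: "('d, 'a, 'n::finite) features" and \<pi> :: "('d, 'a, 'n) policy_family"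
  assumes reward_measurable:
      "(\<lambda>((s, a), s'). r s a s') \<in> borel_measurable (sa_space S \<Otimes>\<^sub>M state_space S)"
    and reward_bounds: "\<And>s a s'. s \<in> S \<Longrightarrow> s' \<in> S \<Longrightarrow> 0 \<le> r s a s' \<and> r s a s' \<le> rmax"
    and features_measurable: "\<And>a. (\<lambda>s. \<phi> s a) \<in> borel_measurable (state_space S)"
    and target_measurable: "\<And>\<theta>. measurable_policy S (\<pi> \<theta>)"
    and target_differentiable:
      "\<And>\<theta> s a. s \<in> S \<Longrightarrow> (\<lambda>\<eta>. pmf (\<pi> \<eta> s) a) differentiable (at \<theta>)"
    and cov_nonsingular: "invertible (feature_cov \<mu> \<phi>)"
    and features_bounded: "\<And>s a. s \<in> S \<Longrightarrow> norm (\<phi> s a) \<le> 1"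
    and policy_gradient_bounded:
      "\<And>\<theta> s a. s \<in> S \<Longrightarrow> norm (grad (\<lambda>\<eta>. pmf (\<pi> \<eta> s) a) \<theta>) \<le> k1"
    and policy_gradient_lipschitz:
      "\<And>\<theta>1 \<theta>2 s a. s \<in> S \<Longrightarrow>
         norm (grad (\<lambda>\<eta>. pmf (\<pi> \<eta> s) a) \<theta>1 - grad (\<lambda>\<eta>. pmf (\<pi> \<eta> s) a) \<theta>2) \<le> k2 * norm (\<theta>1 - \<theta>2)"
begin

abbreviation "gp a \<theta> s \<equiv> grad (\<lambda>\<eta>. pmf (\<pi> \<eta> s) a) \<theta>"

lemma gp_GDERIV: "s \<in> S \<Longrightarrow> GDERIV (\<lambda>\<eta>. pmf (\<pi> \<eta> s) a) \<theta> :> gp a \<theta> s"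
  by (rule differentiable_imp_GDERIV[OF target_differentiable])

lemma pmf_lipschitz:
  assumes s: "s \<in> S"
  shows "\<bar>pmf (\<pi> \<theta> s) a - pmf (\<pi> \<theta>' s) a\<bar> \<le> k1 * norm (\<theta> - \<theta>')"
proof -
  obtain t where t: "pmf (\<pi> \<theta> s) a - pmf (\<pi> \<theta>' s) a = (\<theta> - \<theta>') \<bullet> gp a (\<theta>' + t *\<^sub>R (\<theta> - \<theta>')) s"
    using GDERIV_segment_mvt[OF gp_GDERIV[OF s], where x=\<theta>' and y=\<theta>] by metis
  have "\<bar>pmf (\<pi> \<theta> s) a - pmf (\<pi> \<theta>' s) a\<bar> \<le> norm (\<theta> - \<theta>') * norm (gp a (\<theta>' + t *\<^sub>R (\<theta> - \<theta>')) s)"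
    unfolding t by (rule Cauchy_Schwarz_ineq2)
  also have "\<dots> \<le> norm (\<theta> - \<theta>') * k1" by (intro mult_left_mono policy_gradient_bounded s) simp
  finally show ?thesis by (simp add: mult.commute)
qed

lemma pmf_meas: "(\<lambda>s. pmf (\<pi> \<theta> s) a) \<in> borel_measurable X1"
  using target_measurable by (simp add: measurable_policy_def)

lemma pmf_meas2[measurable (raw)]:
  assumes "p \<in> borel_measurable M" "q \<in> M \<rightarrow>\<^sub>M X1"
  shows "(\<lambda>w. pmf (\<pi> (p w) (q w)) a) \<in> borel_measurable M"
proof (rule measurable_Caratheodory[where f="\<lambda>\<theta> s. pmf (\<pi> \<theta> s) a", OF pmf_meas _ assms])
  fix s assume "s \<in> space X1"
  then show "continuous_on UNIV (\<lambda>\<theta>. pmf (\<pi> \<theta> s) a)"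
    using differentiable_imp_continuous_within[OF target_differentiable]
    by (simp add: continuous_on_eq_continuous_within)
qed

lemma gp_meas: "gp a \<theta> \<in> borel_measurable X1"
proof (rule borel_measurable_euclidean_space[THEN iffD2], rule ballI)
  fix b :: "real^'n"
  show "(\<lambda>s. gp a \<theta> s \<bullet> b) \<in> borel_measurable X1"
  proof (rule borel_measurable_LIMSEQ_real)
    fix s assume "s \<in> space X1"
    then show "(\<lambda>n. (pmf (\<pi> (\<theta> + (1 / real (Suc n)) *\<^sub>R b) s) a - pmf (\<pi> \<theta> s) a) * real (Suc n)) \<longlonglongrightarrow> gp a \<theta> s \<bullet> b"
      by (intro GDERIV_partial_LIMSEQ gp_GDERIV) simp
  next
    fix n show "(\<lambda>s. (pmf (\<pi> (\<theta> + (1 / real (Suc n)) *\<^sub>R b) s) a - pmf (\<pi> \<theta> s) a) * real (Suc n)) \<in> borel_measurable X1"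
      using pmf_meas by measurable
  qed
qed

lemma gp_meas2[measurable (raw)]:
  assumes "p \<in> borel_measurable M" "q \<in> M \<rightarrow>\<^sub>M X1"
  shows "(\<lambda>w. gp a (p w) (q w)) \<in> borel_measurable M"
proof (rule measurable_Caratheodory[where f="gp a", OF gp_meas _ assms])
  fix s assume "s \<in> space X1"
  then have s: "s \<in> S" by simp
  \<comment> \<open>\<open>lipschitz_on\<close> asks for a nonnegative constant; the Lipschitz
    hypothesis at two distinct parameters supplies it.\<close>
  have "0 \<le> k2"
    using policy_gradient_lipschitz[OF s, of a 0 1] norm_ge_zero[of "gp a 0 s - gp a 1 s"]
    by (metis (no_types, lifting) diff_0 norm_minus_cancel order_trans zero_le_mult_iff norm_le_zero_iff zero_neq_one)
  then have "k2-lipschitz_on UNIV (\<lambda>\<theta>. gp a \<theta> s)"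
    using policy_gradient_lipschitz[OF s] by (intro lipschitz_onI) (auto simp: dist_norm)
  then show "continuous_on UNIV (\<lambda>\<theta>. gp a \<theta> s)" by (rule lipschitz_on_continuous_on)
qed

lemma phi_meas[measurable (raw)]:
  assumes "p \<in> M \<rightarrow>\<^sub>M X1" "q \<in> M \<rightarrow>\<^sub>M count_space UNIV"
  shows "(\<lambda>w. \<phi> (p w) (q w)) \<in> borel_measurable M"
proof (rule measurable_compose_countable'[OF _ assms(2)])
  show "(\<lambda>w. \<phi> (p w) a) \<in> borel_measurable M" for a
    by (rule measurable_compose[OF assms(1) features_measurable])
qed (auto intro: countable_finite)

section \<open>Greedy-GQ as an instance of the abstract model\<close>

abbreviation "mf \<equiv> \<lambda>x. \<phi> (fst (fst x)) (snd (fst x))"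
abbreviation "mr \<equiv> \<lambda>x. r (fst (fst x)) (snd (fst x)) (snd x)"
abbreviation "mV \<equiv> \<lambda>\<theta> x. Vbar \<phi> \<pi> \<theta> (snd x)"
abbreviation "mU \<equiv> \<lambda>\<theta> x. phi_hat \<phi> \<pi> \<theta> (snd x)"

lemma nu_proj[measurable]: "snd \<in> \<nu> \<rightarrow>\<^sub>M X1" "fst \<in> \<nu> \<rightarrow>\<^sub>M XA"
  using nu_sets by (simp_all cong: measurable_cong_sets)

lemma nuD: "x \<in> space \<nu> \<Longrightarrow> fst (fst x) \<in> S \<and> snd x \<in> S"
  by (auto simp: nu_space)

lemma pmf_bl:
  "bounded_lipschitz_on B (space \<nu>) (\<lambda>\<theta> x. pmf (\<pi> \<theta> (snd x)) a)"
  by (rule bounded_lipschitz_onI[where c=1 and d=k1]) (use nuD pmf_lipschitz in \<open>auto simp: pmf_le_1\<close>)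

lemma gp_bl:
  "bounded_lipschitz_on B (space \<nu>) (\<lambda>\<theta> x. gp a \<theta> (snd x))"
proof (rule bounded_lipschitz_onI[where c=k1 and d=k2])
  fix x \<theta> \<theta>' assume "x \<in> space \<nu>"
  then have s: "snd x \<in> S" using nuD by blast
  show "norm (gp a \<theta> (snd x)) \<le> k1" by (rule policy_gradient_bounded[OF s])
  show "norm (gp a \<theta> (snd x) - gp a \<theta>' (snd x)) \<le> k2 * norm (\<theta> - \<theta>')"
    by (rule policy_gradient_lipschitz[OF s])
qed

lemma phi_bl: "bounded_lipschitz_on B (space \<nu>) (\<lambda>\<theta> x. \<phi> (snd x) a)"
  by (rule bl_const[where c=1]) (use nuD features_bounded in auto)

text \<open>For each action the error is the policy's second-order remainder times \<theta>
  \<bullet> \<phi>, plus a product of two first-order increments. The former is scaled by the size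
  of \<theta>, so the constant contains \<open>k2 * B\<close> and is only local; the latter gives
  \<open>k1\<close>.\<close>

lemma Vbar_expansion:
  assumes s: "s \<in> S" and B: "norm \<theta> \<le> B"
  shows "\<bar>Vbar \<phi> \<pi> \<theta>' s - Vbar \<phi> \<pi> \<theta> s - phi_hat \<phi> \<pi> \<theta> s \<bullet> (\<theta>' - \<theta>)\<bar>
    \<le> real CARD('a) * (k2 * B + k1) * (norm (\<theta>' - \<theta>))\<^sup>2"
proof -
  let ?h = "\<theta>' - \<theta>"
  define e where "e a = (pmf (\<pi> \<theta>' s) a - pmf (\<pi> \<theta> s) a - gp a \<theta> s \<bullet> ?h) * (\<theta> \<bullet> \<phi> s a)
     + (pmf (\<pi> \<theta>' s) a - pmf (\<pi> \<theta> s) a) * (?h \<bullet> \<phi> s a)" for a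
  have "Vbar \<phi> \<pi> \<theta>' s - Vbar \<phi> \<pi> \<theta> s - phi_hat \<phi> \<pi> \<theta> s \<bullet> ?h = (\<Sum>a\<in>UNIV. e a)"
    unfolding Vbar_def phi_hat_def inner_sum_left sum_subtractf[symmetric] e_def
    by (intro sum.cong refl) (simp add: inner_add_left inner_diff_left inner_diff_right inner_commute algebra_simps)
  also have "\<bar>\<dots>\<bar> \<le> (\<Sum>a\<in>(UNIV::'a set). (k2 * B + k1) * (norm ?h)\<^sup>2)"
  proof (intro order_trans[OF sum_abs] sum_mono)
    fix a
    have 1: "\<bar>pmf (\<pi> \<theta>' s) a - pmf (\<pi> \<theta> s) a - gp a \<theta> s \<bullet> ?h\<bar> \<le> k2 * (norm ?h)\<^sup>2"
      by (rule quadratic_remainder_of_lipschitz_gradient[OF gp_GDERIV[OF s] policy_gradient_lipschitz[OF s]])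
    have 2: "\<bar>v \<bullet> \<phi> s a\<bar> \<le> norm v" for v
      using Cauchy_Schwarz_ineq2[of v "\<phi> s a"] mult_left_mono[OF features_bounded[OF s, of a] norm_ge_zero[of v]] by linarith
    have "\<bar>e a\<bar> \<le> \<bar>pmf (\<pi> \<theta>' s) a - pmf (\<pi> \<theta> s) a - gp a \<theta> s \<bullet> ?h\<bar> * \<bar>\<theta> \<bullet> \<phi> s a\<bar>
        + \<bar>pmf (\<pi> \<theta>' s) a - pmf (\<pi> \<theta> s) a\<bar> * \<bar>?h \<bullet> \<phi> s a\<bar>"
      unfolding e_def abs_mult[symmetric] by (rule abs_triangle_ineq)
    also have "\<dots> \<le> (k2 * (norm ?h)\<^sup>2) * B + (k1 * norm ?h) * norm ?h"
      using 1 2[of \<theta>] 2[of ?h] B pmf_lipschitz[OF s, of \<theta>' a \<theta>]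
      by (intro add_mono mult_mono) (auto intro: order_trans[OF abs_ge_zero])
    also have "\<dots> = (k2 * B + k1) * (norm ?h)\<^sup>2" by (simp add: power2_eq_square algebra_simps)
    finally show "\<bar>e a\<bar> \<le> (k2 * B + k1) * (norm ?h)\<^sup>2" .
  qed
  also have "\<dots> = real CARD('a) * (k2 * B + k1) * (norm ?h)\<^sup>2" by simp
  finally show ?thesis .
qed

text \<open>The matrix is defined entrywise under \<open>\<mu>\<close>, the model works under
  \<open>\<nu>\<close>. The features ignore the next state, so the inner integral over
  \<open>P x\<close> is that of a constant; the rest is a comparison of components.\<close>

lemma feature_cov_mult:
  "feature_cov \<mu> \<phi> *v v = (\<integral>x. (mf x \<bullet> v) *\<^sub>R mf x \<partial>\<nu>)"
proof -
  interpret mu: prob_space \<mu> by (rule mu)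
  interpret nu: prob_space \<nu> by (rule nu_prob)
  have XAS: "fst x \<in> S" if "x \<in> space XA" for x :: "(real^'d) \<times> 'a" using that by auto
  have mf_meas: "mf \<in> borel_measurable \<nu>"
    using phi_meas[OF measurable_compose[OF nu_proj(2) fst_XA] measurable_compose[OF nu_proj(2) snd_XA]] .
  have phm: "(\<lambda>x. \<phi> (fst x) (snd x)) \<in> borel_measurable XA" by (rule phi_meas) measurable
  have phi_le: "\<bar>\<phi> s a $ i\<bar> \<le> 1" if "s \<in> S" for s a i
    using component_le_norm_cart[of "\<phi> s a" i] features_bounded[OF that, of a] by linarith
  have inner_le: "\<bar>\<phi> s a \<bullet> v\<bar> \<le> norm v" if "s \<in> S" for s a
    using Cauchy_Schwarz_ineq2[of "\<phi> s a" v] mult_right_mono[OF features_bounded[OF that, of a] norm_ge_zero[of v]] by linarith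
  have norm_prod_le: "norm ((mf x \<bullet> v) *\<^sub>R mf x) \<le> norm v" if "x \<in> space \<nu>" for x
  proof -
    have "norm ((mf x \<bullet> v) *\<^sub>R mf x) \<le> norm v * 1"
      using nuD[OF that] inner_le features_bounded by (simp only: norm_scaleR) (intro mult_mono, auto)
    then show ?thesis by simp
  qed
  have int: "integrable \<nu> (\<lambda>x. (mf x \<bullet> v) *\<^sub>R mf x)"
  proof (rule nu.integrable_const_bound[where B="norm v"])
    show "AE x in \<nu>. norm ((mf x \<bullet> v) *\<^sub>R mf x) \<le> norm v" using norm_prod_le by (intro AE_I2)
  qed (intro borel_measurable_scaleR borel_measurable_inner mf_meas borel_measurable_const)
  have muS': "x \<in> space \<mu> \<Longrightarrow> x \<in> space XA" for x using sets_eq_imp_space_eq[OF mu(2)] by simp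
  have phmu: "(\<lambda>x. \<phi> (fst x) (snd x)) \<in> borel_measurable \<mu>" by (rule kernel_on_mu[OF phm])
  have comp_meas: "(\<lambda>x. \<phi> (fst x) (snd x) $ i) \<in> borel_measurable M" if [measurable]: "(\<lambda>x. \<phi> (fst x) (snd x)) \<in> borel_measurable M" for i M
    unfolding cart_eq_inner_axis by measurable
  show ?thesis
  proof (rule vec_eq_iff[THEN iffD2], rule allI)
    fix i
    have int_j: "integrable \<mu> (\<lambda>x. \<phi> (fst x) (snd x) $ i * \<phi> (fst x) (snd x) $ j * v $ j)" for j
    proof (rule mu.integrable_const_bound[where B="1 * 1 * \<bar>v $ j\<bar>"])
      show "AE x in \<mu>. norm (\<phi> (fst x) (snd x) $ i * \<phi> (fst x) (snd x) $ j * v $ j) \<le> 1 * 1 * \<bar>v $ j\<bar>"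
        using phi_le XAS muS' unfolding real_norm_def abs_mult by (intro AE_I2 mult_mono) auto
    qed (intro borel_measurable_times comp_meas phmu borel_measurable_const)
    have "(feature_cov \<mu> \<phi> *v v) $ i = (\<Sum>j\<in>UNIV. (\<integral>x. \<phi> (fst x) (snd x) $ i * \<phi> (fst x) (snd x) $ j \<partial>\<mu>) * v $ j)"
      by (simp add: matrix_vector_mult_def feature_cov_def split_beta')
    also have "\<dots> = (\<Sum>j\<in>UNIV. \<integral>x. \<phi> (fst x) (snd x) $ i * \<phi> (fst x) (snd x) $ j * v $ j \<partial>\<mu>)"
      by (intro sum.cong refl) simp
    also have "\<dots> = (\<integral>x. (\<Sum>j\<in>UNIV. \<phi> (fst x) (snd x) $ i * \<phi> (fst x) (snd x) $ j * v $ j) \<partial>\<mu>)"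
      using int_j by (intro Bochner_Integration.integral_sum[symmetric])
    also have "\<dots> = (\<integral>x. (\<phi> (fst x) (snd x) \<bullet> v) * \<phi> (fst x) (snd x) $ i \<partial>\<mu>)"
      by (intro Bochner_Integration.integral_cong refl)
        (simp add: inner_vec_def sum_distrib_left sum_distrib_right mult_ac)
    also have "\<dots> = (\<integral>x. (\<integral>y. (mf (x, y) \<bullet> v) * mf (x, y) $ i \<partial>P x) \<partial>\<mu>)"
    proof (intro Bochner_Integration.integral_cong refl)
      fix x assume "x \<in> space \<mu>"
      then interpret Px: prob_space "P x" using prob_kernelD(1)[OF P_kernel] muS' by blast
      show "(\<phi> (fst x) (snd x) \<bullet> v) * \<phi> (fst x) (snd x) $ i = (\<integral>y. (mf (x, y) \<bullet> v) * mf (x, y) $ i \<partial>P x)"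
        by (simp add: Px.prob_space)
    qed
    also have "\<dots> = (\<integral>x. (mf x \<bullet> v) * mf x $ i \<partial>\<nu>)"
    proof (rule nu_integral[symmetric, where c="norm v"])
      have [measurable]: "mf \<in> borel_measurable XT" by (rule phi_meas) measurable
      show "(\<lambda>x. (mf x \<bullet> v) * mf x $ i) \<in> borel_measurable XT"
        unfolding cart_eq_inner_axis by measurable
      fix x :: "((real^'d) \<times> 'a) \<times> (real^'d)" assume "x \<in> space XT"
      then have "fst (fst x) \<in> S" by (auto simp: space_pair_measure)
      then have "\<bar>mf x \<bullet> v\<bar> * \<bar>mf x $ i\<bar> \<le> norm v * 1" by (intro mult_mono inner_le phi_le) auto
      then show "\<bar>(mf x \<bullet> v) * mf x $ i\<bar> \<le> norm v" by (simp add: abs_mult)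
    qed
    also have "\<dots> = (\<integral>x. ((mf x \<bullet> v) *\<^sub>R mf x) \<bullet> axis i 1 \<partial>\<nu>)"
      by (simp add: cart_eq_inner_axis)
    also have "\<dots> = (\<integral>x. (mf x \<bullet> v) *\<^sub>R mf x \<partial>\<nu>) \<bullet> axis i 1"
      by (rule inner_integral[OF int, symmetric])
    finally show "(feature_cov \<mu> \<phi> *v v) $ i = (\<integral>x. (mf x \<bullet> v) *\<^sub>R mf x \<partial>\<nu>) $ i"
      by (simp add: cart_eq_inner_axis)
  qed
qed

sublocale td: td_model \<nu> mf mr mV mU \<gamma> "feature_cov \<mu> \<phi>"
proof -
  interpret nu: prob_space \<nu> by (rule nu_prob)
  have m1[measurable]: "(\<lambda>z. snd (snd z)) \<in> borel \<Otimes>\<^sub>M \<nu> \<rightarrow>\<^sub>M X1"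
    by (rule measurable_compose[OF measurable_snd nu_proj(1)])
  show "td_model \<nu> mf mr mV mU (feature_cov \<mu> \<phi>)"
  proof unfold_locales
    show "mf \<in> borel_measurable \<nu>"
      by (rule phi_meas[OF measurable_compose[OF nu_proj(2) fst_XA] measurable_compose[OF nu_proj(2) snd_XA]])
    have "(\<lambda>((s, a), s'). r s a s') \<in> borel_measurable \<nu>"
      using reward_measurable nu_sets by (simp cong: measurable_cong_sets)
    then show "mr \<in> borel_measurable \<nu>" by (simp add: split_beta')
    show "case_prod mV \<in> borel_measurable (borel \<Otimes>\<^sub>M \<nu>)"
      unfolding Vbar_def split_beta' by measurable
    show "case_prod mU \<in> borel_measurable (borel \<Otimes>\<^sub>M \<nu>)"
      unfolding phi_hat_def split_beta'
      by (intro borel_measurable_sum borel_measurable_add borel_measurable_scaleR borel_measurable_inner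
          gp_meas2 pmf_meas2 phi_meas m1 measurable_fst measurable_const) simp_all
    show "norm (mf x) \<le> 1" if "x \<in> space \<nu>" for x using nuD[OF that] features_bounded by simp
    have "\<bar>mr x\<bar> \<le> rmax" if "x \<in> space \<nu>" for x
      using reward_bounds[of "fst (fst x)" "snd x" "snd (fst x)"] nuD[OF that] by simp
    then show "\<exists>c. \<forall>x\<in>space \<nu>. \<bar>mr x\<bar> \<le> c" by blast
    show "bounded_lipschitz_on (cball 0 B) (space \<nu>) mV" for B
      unfolding Vbar_def by (intro bl_intros pmf_bl phi_bl bl_id)
    show "bounded_lipschitz_on (cball 0 B) (space \<nu>) mU" for B
      unfolding phi_hat_def by (intro bl_sum bl_add bl_scaleR bl_inner pmf_bl phi_bl bl_id gp_bl)
    show "\<exists>L. \<forall>x\<in>space \<nu>. \<forall>\<theta>\<in>cball 0 B. \<forall>\<theta>'\<in>cball 0 B.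
          \<bar>mV \<theta>' x - mV \<theta> x - mU \<theta> x \<bullet> (\<theta>' - \<theta>)\<bar> \<le> L * (norm (\<theta>' - \<theta>))\<^sup>2" for B
    proof (intro exI[of _ "real CARD('a) * (k2 * B + k1)"] ballI Vbar_expansion)
      fix x and \<theta> :: "real^'n"
      show "snd x \<in> S" if "x \<in> space \<nu>" using nuD[OF that] by blast
      show "norm \<theta> \<le> B" if "\<theta> \<in> cball 0 B" using that by simp
    qed
    show "feature_cov \<mu> \<phi> *v v = (\<integral>x. (mf x \<bullet> v) *\<^sub>R mf x \<partial>\<nu>)" for v by (rule feature_cov_mult)
    show "invertible (feature_cov \<mu> \<phi>)" by (rule cov_nonsingular)
  qed
qed

lemma mean_td_update_eq: "mean_td_update S P \<mu> r \<gamma> \<phi> \<pi> = td.g"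
  by (rule ext) (simp add: mean_td_update_def td.g_def td.td_def td_error_def split_beta')

lemma MSPBE_eq: "MSPBE S P \<mu> r \<gamma> \<phi> \<pi> = td.J"
  by (rule ext) (simp only: MSPBE_def td.J_def td.W_def mean_td_update_eq)

lemma grad_MSPBE: "grad (MSPBE S P \<mu> r \<gamma> \<phi> \<pi>) = td.D"
  unfolding MSPBE_eq by (rule td.grad_J)

section \<open>The recursion and measurability of the iterates\<close>

lemma greedy_gq_Suc:
  fixes \<theta>0 \<omega>0 :: "real^'n" and \<alpha> \<beta> :: "nat \<Rightarrow> real" and s :: "nat \<Rightarrow> real^'d" and a :: "nat \<Rightarrow> 'a"
  defines "it \<equiv> greedy_gq r \<gamma> \<phi> \<pi> \<alpha> \<beta> \<theta>0 \<omega>0 s a"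
  shows "fst (it (Suc t)) = fst (it t) + \<alpha> t *\<^sub>R td.G (fst (it t)) (snd (it t)) ((s t, a t), s (Suc t))"
    and "snd (it (Suc t)) = snd (it t) + \<beta> t *\<^sub>R td.H (fst (it t)) (snd (it t)) ((s t, a t), s (Suc t))"
  unfolding it_def
  by (simp_all only: greedy_gq.simps Let_def case_prod_beta fst_conv snd_conv td.G_def td.H_def td.td_def td_error_def)

text \<open>The bounds \<open>i \<le> t\<close> for states and \<open>i < t\<close> for actions are
  those of the history just before the action at time \<open>t\<close>: iterate \<open>t\<close> has
  used the state at \<open>t\<close> as a next state, but not yet its action. The space
  \<open>M\<close> is left general to cover the sample space, the histories and the path
  space.\<close>

lemma greedy_gq_measurable:
  fixes \<theta>0 \<omega>0 :: "real^'n"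
  assumes "\<And>i. i \<le> t \<Longrightarrow> s i \<in> M \<rightarrow>\<^sub>M X1" "\<And>i. i < t \<Longrightarrow> a i \<in> M \<rightarrow>\<^sub>M count_space UNIV"
  shows "(\<lambda>w. greedy_gq r \<gamma> \<phi> \<pi> \<alpha> \<beta> \<theta>0 \<omega>0 (\<lambda>i. s i w) (\<lambda>i. a i w) t) \<in> borel_measurable M"
  using assms
proof (induction t)
  case (Suc t)
  define it where "it = (\<lambda>w t. greedy_gq r \<gamma> \<phi> \<pi> \<alpha> \<beta> \<theta>0 \<omega>0 (\<lambda>i. s i w) (\<lambda>i. a i w) t)"
  have [measurable]: "(\<lambda>w. it w t) \<in> borel_measurable M" unfolding it_def using Suc by simp
  have [measurable]: "s t \<in> M \<rightarrow>\<^sub>M X1" "s (Suc t) \<in> M \<rightarrow>\<^sub>M X1" "a t \<in> M \<rightarrow>\<^sub>M count_space UNIV"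
    using Suc.prems by auto
  have x: "(\<lambda>w. ((s t w, a t w), s (Suc t) w)) \<in> M \<rightarrow>\<^sub>M \<nu>"
    unfolding measurable_cong_sets[OF refl nu_sets] by measurable
  have f: "(\<lambda>w. fst (it w t)) \<in> borel_measurable M" "(\<lambda>w. snd (it w t)) \<in> borel_measurable M"
    using measurable_compose[OF \<open>(\<lambda>w. it w t) \<in> borel_measurable M\<close>, of fst borel]
      measurable_compose[OF \<open>(\<lambda>w. it w t) \<in> borel_measurable M\<close>, of snd borel]
    by (simp_all add: borel_prod[symmetric])
  have "(\<lambda>w. (fst (it w (Suc t)), snd (it w (Suc t)))) \<in> borel_measurable M"
    unfolding it_def greedy_gq_Suc
    by (intro borel_measurable_Pair borel_measurable_add borel_measurable_scaleR borel_measurable_const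
        td.G_meas td.H_meas x f[unfolded it_def])
  then show ?case by (simp add: it_def)
qed simp

end

section \<open>The convergence rate\<close>

lemma stepsize_fraction:
  assumes "0 < T"
  shows "stepsize T a k / (\<Sum>t\<le>T. stepsize T a t) = 1 / (real T + 1)"
  using assms by (simp add: stepsize_def field_simps)

text \<open>Dividing by \<open>T + 1\<close> leaves 1/(T \<alpha>), of order
  \<open>1 / T powr (1 - a)\<close>, which dominates 1/(T \<beta>) because \<open>b \<le> a\<close>.
  The ratio and the two stepsizes are powers of 1/T with exponents at least
  \<open>min b (a - b)\<close>, as is 1/T, and the lag contributes the logarithm.\<close>

lemma rate_bound:
  fixes a b \<rho> :: real
  assumes a: "0 < a" "a \<le> 1" and b: "0 < b" "b \<le> a" and \<rho>: "0 < \<rho>" "\<rho> < 1"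
  shows "\<exists>K\<ge>0. \<forall>T>0. \<exists>\<tau>::nat. error_budget (stepsize T a 0) (stepsize T b 0) T (real \<tau>) (\<rho> ^ \<tau>) / (real T + 1)
    \<le> K * (1 / real T powr (1 - a) + ln (real T) / real T powr (min b (a - b)))"
proof -
  \<comment> \<open>Coefficient of ln T in the lag: the second summand pays for rounding up, since 1
    is at most ln T / ln 2 when T is at least 2.\<close>
  define \<kappa> where "\<kappa> = 1 / ln (1 / \<rho>) + 1 / ln 2"
  define mn where "mn = min b (a - b)"
  have mn: "0 \<le> mn" "mn \<le> b" "mn \<le> a - b" "mn \<le> 1" using a b by (auto simp: mn_def)
  have lr: "0 < ln (1 / \<rho>)" using \<rho> by (simp add: ln_div)
  have \<kappa>: "0 < \<kappa>" using lr unfolding \<kappa>_def by (intro add_pos_pos) auto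
  \<comment> \<open>The 5 is the case T = 1. Four terms (stepsize ratio, both stepsizes, mixing
    error) cost \<open>1 / ln 2\<close> each, and the two terms containing the lag cost
    \<open>\<kappa>\<close> each.\<close>
  define K where "K = 5 + 4 / ln 2 + 2 * \<kappa>"
  have K: "5 \<le> K" "2 + 4 / ln 2 + 2 * \<kappa> \<le> K" "0 \<le> K" using \<kappa> by (auto simp: K_def)
  have "\<exists>\<tau>::nat. error_budget (stepsize T a 0) (stepsize T b 0) T (real \<tau>) (\<rho> ^ \<tau>) / (real T + 1)
    \<le> K * (1 / real T powr (1 - a) + ln (real T) / real T powr mn)" if T: "0 < T" for T :: nat
  proof (cases "T = 1")
    \<comment> \<open>The logarithm vanishes, leaving only the first rate. With lag 0 every power
      equals 1, the budget is 10 and its quotient by \<open>T + 1\<close> is 5.\<close>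
    case True
    then show ?thesis using K by (intro exI[of _ 0]) (simp add: stepsize_def error_budget_def)
  next
    case False
    define x where "x = real T"
    have x: "2 \<le> x" using T False by (simp add: x_def)
    have lx: "ln 2 \<le> ln x" "0 < ln x" using x by auto
    define u where "u = ln x / x powr mn"
    have u: "0 \<le> u" using lx by (simp add: u_def)
    have pw: "1 / x powr e \<le> u / ln 2" if "mn \<le> e" for e
    proof -
      have "1 / x powr e \<le> 1 / x powr mn" using x that by (intro divide_left_mono powr_mono) auto
      also have "\<dots> \<le> (ln x / ln 2) / x powr mn" using x lx by (intro divide_right_mono) auto
      finally show ?thesis by (simp add: u_def mult.commute)
    qed
    have lw: "ln x / x powr e \<le> u" if "mn \<le> e" for e
      unfolding u_def using x lx that by (intro divide_left_mono powr_mono) auto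
    \<comment> \<open>the least number of steps after which the mixing error is at most \<open>1 / T\<close>\<close>
    define \<tau> where "\<tau> = nat \<lceil>ln x / ln (1 / \<rho>)\<rceil>"
    have \<tau>1: "ln x / ln (1 / \<rho>) \<le> real \<tau>" unfolding \<tau>_def by (rule real_nat_ceiling_ge)
    have "real \<tau> \<le> ln x / ln (1 / \<rho>) + 1"
      unfolding \<tau>_def using lx lr by (simp add: of_nat_ceiling)
    also have "\<dots> \<le> ln x / ln (1 / \<rho>) + ln x / ln 2" using lx by simp
    also have "\<dots> = \<kappa> * ln x" by (simp add: \<kappa>_def algebra_simps)
    finally have \<tau>2: "real \<tau> \<le> \<kappa> * ln x" .
    have \<rho>\<tau>: "\<rho> ^ \<tau> \<le> 1 / x"
    proof -
      have "ln x \<le> real \<tau> * ln (1 / \<rho>)" using \<tau>1 lr by (simp add: field_simps)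
      then have "real \<tau> * ln \<rho> \<le> ln (1 / x)" using \<rho> x by (simp add: ln_div)
      then have "ln (\<rho> ^ \<tau>) \<le> ln (1 / x)" using \<rho> by (simp add: ln_realpow)
      then show ?thesis using \<rho> x by (subst (asm) ln_le_cancel_iff) auto
    qed
    define \<alpha> \<beta> where "\<alpha> = 1 / x powr a" and "\<beta> = 1 / x powr b"
    have t1: "(1 / \<alpha>) / (x + 1) \<le> 1 / x powr (1 - a)"
    proof -
      have "(1 / \<alpha>) / (x + 1) \<le> x powr a / x" using x by (simp add: \<alpha>_def divide_left_mono)
      also have "\<dots> = 1 / x powr (1 - a)" using x by (simp add: powr_diff)
      finally show ?thesis .
    qed
    have t2: "(1 / \<beta>) / (x + 1) \<le> 1 / x powr (1 - a)"
    proof -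
      have "(1 / \<beta>) / (x + 1) \<le> (1 / \<alpha>) / (x + 1)"
        using x b by (auto simp: \<alpha>_def \<beta>_def intro!: divide_right_mono powr_mono)
      then show ?thesis using t1 by linarith
    qed
    have t3: "\<alpha> / \<beta> \<le> u / ln 2"
    proof -
      have "\<alpha> / \<beta> = 1 / x powr (a - b)" using x by (simp add: \<alpha>_def \<beta>_def powr_diff)
      then show ?thesis using pw mn by simp
    qed
    have t4: "\<alpha> \<le> u / ln 2" "\<beta> \<le> u / ln 2" unfolding \<alpha>_def \<beta>_def using pw mn b by auto
    have t5: "real \<tau> / (x + 1) \<le> \<kappa> * u"
    proof -
      have "real \<tau> / (x + 1) \<le> real \<tau> / x" using x by (intro divide_left_mono) auto
      also have "\<dots> \<le> (\<kappa> * ln x) / x" using x \<tau>2 by (intro divide_right_mono) auto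
      also have "\<dots> = \<kappa> * (ln x / x powr 1)" using x by simp
      also have "\<dots> \<le> \<kappa> * u" by (rule mult_left_mono[OF lw[OF mn(4)] less_imp_le[OF \<kappa>]])
      finally show ?thesis .
    qed
    have t6: "\<beta> * real \<tau> \<le> \<kappa> * u"
    proof -
      have "\<beta> * real \<tau> \<le> \<beta> * (\<kappa> * ln x)" using \<tau>2 by (intro mult_left_mono) (auto simp: \<beta>_def)
      also have "\<dots> = \<kappa> * (ln x / x powr b)" by (simp add: \<beta>_def)
      also have "\<dots> \<le> \<kappa> * u" by (rule mult_left_mono[OF lw[OF mn(2)] less_imp_le[OF \<kappa>]])
      finally show ?thesis .
    qed
    have t7: "\<rho> ^ \<tau> \<le> u / ln 2" using \<rho>\<tau> pw[of 1] mn(4) x by simp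
    have x1: "(x + 1) * e / (x + 1) = e" for e using x by simp
    have "(1 / \<alpha> + 1 / \<beta> + (x + 1) * (\<alpha> / \<beta>) + (x + 1) * (\<alpha> + \<beta>) + (real \<tau> + (x + 1) * (\<beta> * real \<tau> + \<rho> ^ \<tau>))) / (x + 1)
      = (1 / \<alpha>) / (x + 1) + (1 / \<beta>) / (x + 1) + \<alpha> / \<beta> + (\<alpha> + \<beta>) + (real \<tau> / (x + 1) + (\<beta> * real \<tau> + \<rho> ^ \<tau>))"
      by (simp only: add_divide_distrib x1)
    also have "\<dots> \<le> 2 * (1 / x powr (1 - a)) + (4 / ln 2 + 2 * \<kappa>) * u"
    proof -
      have "(4 / ln 2 + 2 * \<kappa>) * u = 4 * (u / ln 2) + 2 * (\<kappa> * u)" by (simp add: algebra_simps)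
      then show ?thesis using t1 t2 t3 t4 t5 t6 t7 by linarith
    qed
    also have "\<dots> \<le> K * (1 / x powr (1 - a)) + K * u"
      using K u \<kappa> by (intro add_mono mult_right_mono) auto
    also have "\<dots> = K * (1 / x powr (1 - a) + ln x / x powr mn)" by (simp add: u_def algebra_simps)
    finally show ?thesis
      unfolding \<alpha>_def \<beta>_def x_def stepsize_def error_budget_def by blast
  qed
  then show ?thesis using K unfolding mn_def by blast
qed

section \<open>Averaging over the random index and the final rate\<close>

context gq_model
begin

abbreviation "XP \<equiv> \<Pi>\<^sub>M t\<in>(UNIV :: nat set). XA"

lemma traj_meas: "(\<lambda>w t. (st t w, act t w)) \<in> \<Omega> \<rightarrow>\<^sub>M XP"
  using measurable_space[OF st_meas] by (intro measurable_PiM_single') auto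

text \<open>Constant stepsizes make the index uniform on 0 to T. The quantities \<open>H k\<close>
  are functionals of the whole path because independence is stated against the sigma-algebra
  generated by the trajectory; splitting over the values of \<open>M\<close> then factors each
  expectation.\<close>

lemma random_index_average:
  fixes H :: "nat \<Rightarrow> (nat \<Rightarrow> (real^'d) \<times> 'a) \<Rightarrow> real"
  assumes ri: "random_index \<Omega> S st act (stepsize T a) T M" and T: "0 < T"
    and H: "\<And>k. H k \<in> borel_measurable XP"
    and b: "\<And>k. k \<le> T \<Longrightarrow> AE w in \<Omega>. \<bar>H k (\<lambda>t. (st t w, act t w))\<bar> \<le> c"
  shows "integrable \<Omega> (\<lambda>w. H (M w) (\<lambda>t. (st t w, act t w)))"
    and "(\<integral>w. H (M w) (\<lambda>t. (st t w, act t w)) \<partial>\<Omega>) = (\<Sum>k\<le>T. \<integral>w. H k (\<lambda>t. (st t w, act t w)) \<partial>\<Omega>) / (real T + 1)"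
proof -
  let ?tr = "\<lambda>w t. (st t w, act t w)"
  have M[measurable]: "M \<in> \<Omega> \<rightarrow>\<^sub>M count_space UNIV" using ri by (simp add: random_index_def)
  have HT[measurable]: "(\<lambda>w. H k (?tr w)) \<in> borel_measurable \<Omega>" for k
    using measurable_compose[OF traj_meas H] .
  have HM: "(\<lambda>w. H (M w) (?tr w)) \<in> borel_measurable \<Omega>"
    by (rule measurable_compose_countable[OF HT M])
  have pk: "prob {w \<in> space \<Omega>. M w = k} = 1 / (real T + 1)" if "k \<le> T" for k
    using ri that stepsize_fraction[OF T] by (simp add: random_index_def)
  \<comment> \<open>The prescribed probabilities already sum to one, so values above T form a null
    set.\<close>
  have Mle: "AE w in \<Omega>. M w \<le> T"
  proof -
    have "prob {w \<in> space \<Omega>. M w \<le> T} = prob (\<Union>k\<in>{..T}. {w \<in> space \<Omega>. M w = k})"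
      by (intro arg_cong[where f=prob]) auto
    also have "\<dots> = (\<Sum>k\<in>{..T}. prob {w \<in> space \<Omega>. M w = k})"
      by (rule finite_measure_finite_Union) (auto simp: disjoint_family_on_def)
    also have "\<dots> = 1" by (simp add: pk)
    finally show ?thesis by (subst (asm) prob_Collect_eq_1) auto
  qed
  have Hb: "AE w in \<Omega>. \<forall>k\<le>T. \<bar>H k (?tr w)\<bar> \<le> c"
  proof -
    have "AE w in \<Omega>. \<forall>k\<in>{..T}. \<bar>H k (?tr w)\<bar> \<le> c" by (rule AE_finite_allI) (use b in auto)
    then show ?thesis by eventually_elim auto
  qed
  show "integrable \<Omega> (\<lambda>w. H (M w) (?tr w))"
  proof (rule integrable_const_bound[OF _ HM, where B=c])
    show "AE w in \<Omega>. norm (H (M w) (?tr w)) \<le> c" using Mle Hb by eventually_elim auto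
  qed
  have iH: "integrable \<Omega> (\<lambda>w. H k (?tr w))" if "k \<le> T" for k
    by (rule integrable_const_bound[where B=c]) (use b[OF that] in auto)
  have ik: "integrable \<Omega> (\<lambda>w. of_bool (M w = k) :: real)" for k
    by (rule integrable_const_bound[where B=1]) auto
  \<comment> \<open>Independence passes to the indicator of \<open>M w = k\<close> and to
    \<open>H k\<close> of the path, as their preimages belong to the two independent
    classes.\<close>
  have indk: "indep_var borel (\<lambda>w. of_bool (M w = k) :: real) borel (\<lambda>w. H k (?tr w))" for k
  proof -
    have i0: "indep_set {M -` N \<inter> space \<Omega> | N. True} {?tr -` B \<inter> space \<Omega> | B. B \<in> sets XP}"
      using ri by (simp add: random_index_def)
    have s1: "{(\<lambda>w. of_bool (M w = k) :: real) -` A \<inter> space \<Omega> | A. A \<in> sets borel} \<subseteq> {M -` N \<inter> space \<Omega> | N. True}"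
    proof clarify
      fix A :: "real set"
      have "(\<lambda>w. of_bool (M w = k) :: real) -` A \<inter> space \<Omega> = M -` ((\<lambda>j. of_bool (j = k)) -` A) \<inter> space \<Omega>" by auto
      then show "\<exists>N. (\<lambda>w. of_bool (M w = k) :: real) -` A \<inter> space \<Omega> = M -` N \<inter> space \<Omega> \<and> True" by blast
    qed
    have s2: "{(\<lambda>w. H k (?tr w)) -` A \<inter> space \<Omega> | A. A \<in> sets borel} \<subseteq> {?tr -` B \<inter> space \<Omega> | B. B \<in> sets XP}"
    proof clarify
      fix A :: "real set" assume A: "A \<in> sets borel"
      let ?B = "H k -` A \<inter> space XP"
      have "?B \<in> sets XP" using H A by (rule measurable_sets)
      moreover have "(\<lambda>w. H k (?tr w)) -` A \<inter> space \<Omega> = ?tr -` ?B \<inter> space \<Omega>"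
        using measurable_space[OF traj_meas] by auto
      ultimately show "\<exists>B. (\<lambda>w. H k (?tr w)) -` A \<inter> space \<Omega> = ?tr -` B \<inter> space \<Omega> \<and> B \<in> sets XP"
        by blast
    qed
    show ?thesis
      unfolding indep_var_def indep_vars_def2
    proof (intro conjI ballI indep_sets_mono_sets[OF i0[unfolded indep_set_def]])
      fix i
      show "random_variable (case_bool borel borel i) (case_bool (\<lambda>w. of_bool (M w = k) :: real) (\<lambda>w. H k (?tr w)) i)"
        by (cases i) simp_all
    qed (use s1 s2 in \<open>simp split: bool.split\<close>)
  qed
  have "(\<integral>w. H (M w) (?tr w) \<partial>\<Omega>) = (\<integral>w. (\<Sum>k\<le>T. of_bool (M w = k) * H k (?tr w)) \<partial>\<Omega>)"
  proof (rule integral_cong_AE[OF HM])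
    show "AE w in \<Omega>. H (M w) (?tr w) = (\<Sum>k\<le>T. of_bool (M w = k) * H k (?tr w))"
      using Mle
    proof eventually_elim
      case (elim w)
      have "(\<Sum>k\<le>T. of_bool (M w = k) * H k (?tr w)) = (\<Sum>k\<le>T. if M w = k then H k (?tr w) else 0)"
        by (intro sum.cong) auto
      then show ?case using elim by simp
    qed
  qed measurable
  also have "\<dots> = (\<Sum>k\<le>T. \<integral>w. of_bool (M w = k) * H k (?tr w) \<partial>\<Omega>)"
    using indep_var_integrable[OF indk ik iH] by (intro Bochner_Integration.integral_sum) auto
  also have "\<dots> = (\<Sum>k\<le>T. (\<integral>w. H k (?tr w) \<partial>\<Omega>) / (real T + 1))"
  proof (intro sum.cong refl)
    fix k assume "k \<in> {..T}"
    then have k: "k \<le> T" by simp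
    have "(\<integral>w. of_bool (M w = k) * H k (?tr w) \<partial>\<Omega>) = (\<integral>w. of_bool (M w = k) \<partial>\<Omega>) * (\<integral>w. H k (?tr w) \<partial>\<Omega>)"
      by (rule indep_var_lebesgue_integral[OF indk ik iH[OF k]])
    also have "(\<integral>w. of_bool (M w = k) \<partial>\<Omega>) = (\<integral>w. indicator {w \<in> space \<Omega>. M w = k} w \<partial>\<Omega>)"
      by (intro Bochner_Integration.integral_cong refl) (simp add: indicator_def)
    also have "\<dots> = 1 / (real T + 1)" using pk[OF k] by simp
    finally show "(\<integral>w. of_bool (M w = k) * H k (?tr w) \<partial>\<Omega>) = (\<integral>w. H k (?tr w) \<partial>\<Omega>) / (real T + 1)" by simp
  qed
  also have "\<dots> = (\<Sum>k\<le>T. \<integral>w. H k (?tr w) \<partial>\<Omega>) / (real T + 1)" by (simp add: sum_divide_distrib)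
  finally show "(\<integral>w. H (M w) (?tr w) \<partial>\<Omega>) = (\<Sum>k\<le>T. \<integral>w. H k (?tr w) \<partial>\<Omega>) / (real T + 1)" .
qed

text \<open>\<open>K1\<close> and \<open>K2\<close> are fixed before T, and only the lag is chosen
  per horizon, so their product is uniform in T and \<open>M\<close>. Integrability is asserted as
  well, since otherwise the bound could hold merely through the default value of the
  integral.\<close>

theorem greedy_gq_rate:
  fixes \<theta>0 \<omega>0 :: "real^'n" and a b R :: real
  assumes exponents: "0 < a" "a \<le> 1" "0 < b" "b \<le> a"
    and iterates_bounded:
      "\<And>T t. T > 0 \<Longrightarrow> t \<le> Suc T \<Longrightarrow>
         (AE x in \<Omega>. norm (fst (gq_run r \<gamma> \<phi> \<pi> a b \<theta>0 \<omega>0 st act T t x)) \<le> R \<and>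
                     norm (snd (gq_run r \<gamma> \<phi> \<pi> a b \<theta>0 \<omega>0 st act T t x)) \<le> R)"
  shows "\<exists>K. \<forall>T>0. \<forall>M. random_index \<Omega> S st act (stepsize T a) T M \<longrightarrow>
     integrable \<Omega> (\<lambda>x. (norm (grad (MSPBE S P \<mu> r \<gamma> \<phi> \<pi>)
                 (fst (gq_run r \<gamma> \<phi> \<pi> a b \<theta>0 \<omega>0 st act T (M x) x))))\<^sup>2) \<and>
     (\<integral>x. (norm (grad (MSPBE S P \<mu> r \<gamma> \<phi> \<pi>)
                 (fst (gq_run r \<gamma> \<phi> \<pi> a b \<theta>0 \<omega>0 st act T (M x) x))))\<^sup>2 \<partial>\<Omega>)
       \<le> K * (1 / real T powr (1 - a) + ln (real T) / real T powr (min b (a - b)))"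
proof -
  let ?run = "gq_run r \<gamma> \<phi> \<pi> a b \<theta>0 \<omega>0 st act"
  define X where "X t w = ((st t w, act t w), st (Suc t) w)" for t w
  have X: "X t \<in> \<Omega> \<rightarrow>\<^sub>M \<nu>" for t
    unfolding X_def[abs_def] measurable_cong_sets[OF refl nu_sets] by measurable
  have run_meas: "?run T t \<in> borel_measurable \<Omega>" for T t
    unfolding gq_run_def[abs_def] by (rule greedy_gq_measurable) measurable
  have run_hist: "?run T t \<in> borel_measurable (hist t t)" for T t
    unfolding gq_run_def[abs_def] by (rule greedy_gq_measurable) (auto intro: st_history act_history)
  have mix: "td.mixing_bound \<Omega> X (?run T) (2 * (m + 1)) \<rho>" for T
    unfolding td.mixing_bound_def
  proof (intro allI impI)
    fix k t :: nat and h :: "(real^'n) \<times> (real^'n) \<Rightarrow> ((real^'d) \<times> 'a) \<times> (real^'d) \<Rightarrow> real" and c :: real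
    assume kt: "k \<le> t" and c: "0 < c" and h: "case_prod h \<in> borel_measurable (borel \<Otimes>\<^sub>M \<nu>)"
      and b: "\<forall>e. \<forall>x\<in>space \<nu>. \<bar>h e x\<bar> \<le> c"
    have h': "case_prod h \<in> borel_measurable (borel \<Otimes>\<^sub>M XT)"
      using h unfolding measurable_cong_sets[OF sets_pair_measure_cong[OF refl nu_sets] refl] .
    have "\<bar>h e x\<bar> \<le> c" if "x \<in> space XT" for e x
      using b that unfolding sets_eq_imp_space_eq[OF nu_sets] by blast
    from chain_mixing[OF run_hist kt h' this c]
    show "\<bar>(\<integral>w. h (?run T k w) (X t w) \<partial>\<Omega>) - (\<integral>w. (\<integral>x. h (?run T k w) x \<partial>\<nu>) \<partial>\<Omega>)\<bar> \<le> c * (2 * (m + 1)) * \<rho> ^ (t - k)"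
      unfolding X_def .
  qed
  have m': "0 \<le> 2 * (m + 1)" using m_nonneg by simp
  obtain K1 where K1: "0 \<le> K1" and bound: "\<And>\<alpha> \<beta> T \<tau> \<theta> \<omega>. 0 < \<alpha> \<Longrightarrow> \<alpha> \<le> \<beta> \<Longrightarrow> \<beta> \<le> 1 \<Longrightarrow>
     td.gq_process \<Omega> X R T (2 * (m + 1)) \<rho> \<alpha> \<beta> \<theta> \<omega> \<Longrightarrow>
     (\<Sum>t\<le>T. \<integral>w. (norm (td.D (\<theta> t w)))\<^sup>2 \<partial>\<Omega>) \<le> K1 * error_budget \<alpha> \<beta> T (real \<tau>) (\<rho> ^ \<tau>)"
    using td.expected_gradient_sum_bound[where X=X and R=R, OF prob_space_axioms X m' rho(1)] by blast
  obtain K2 where K2: "\<And>T. 0 < T \<Longrightarrow>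
    \<exists>\<tau>::nat. error_budget (stepsize T a 0) (stepsize T b 0) T (real \<tau>) (\<rho> ^ \<tau>) / (real T + 1)
    \<le> K2 * (1 / real T powr (1 - a) + ln (real T) / real T powr (min b (a - b)))"
    using rate_bound[OF exponents rho] by blast
  obtain cD where "bounded_lipschitz_const cD (cball 0 R) {()} (\<lambda>\<theta> x. td.D \<theta>)"
    using td.bl_D[of R "{()}"] by (rule bounded_lipschitz_onE)
  note cD = bounded_lipschitz_constD[OF this]
  show ?thesis
    unfolding grad_MSPBE
  proof (intro exI[of _ "K1 * K2"] allI impI)
    fix T :: nat and M
    assume T: "0 < T" and ri: "random_index \<Omega> S st act (stepsize T a) T M"
    \<comment> \<open>The squared gradient is rewritten as a function on path space, the form in
      which independence of the index can be used.\<close>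
    define H where "H k z = (norm (td.D (fst (greedy_gq r \<gamma> \<phi> \<pi> (stepsize T a) (stepsize T b) \<theta>0 \<omega>0
        (\<lambda>i. fst (z i)) (\<lambda>i. snd (z i)) k))))\<^sup>2" for k and z :: "nat \<Rightarrow> (real^'d) \<times> 'a"
    have Hrun: "H k (\<lambda>t. (st t w, act t w)) = (norm (td.D (fst (?run T k w))))\<^sup>2" for k w
      by (simp add: H_def gq_run_def)
    have H: "H k \<in> borel_measurable XP" for k
    proof -
      have c: "(\<lambda>z. z i) \<in> XP \<rightarrow>\<^sub>M XA" for i :: nat by (rule measurable_component_singleton) simp
      have "(\<lambda>z. greedy_gq r \<gamma> \<phi> \<pi> (stepsize T a) (stepsize T b) \<theta>0 \<omega>0 (\<lambda>i. fst (z i)) (\<lambda>i. snd (z i)) k)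
          \<in> borel_measurable XP"
        by (rule greedy_gq_measurable) (auto intro: measurable_compose[OF c fst_XA] measurable_compose[OF c snd_XA])
      then have "(\<lambda>z. fst (greedy_gq r \<gamma> \<phi> \<pi> (stepsize T a) (stepsize T b) \<theta>0 \<omega>0 (\<lambda>i. fst (z i)) (\<lambda>i. snd (z i)) k))
          \<in> borel_measurable XP"
        by (rule measurable_compose) (simp add: borel_prod[symmetric])
      from measurable_compose[OF this td.D_meas] show ?thesis unfolding H_def by measurable
    qed
    have Hb: "AE w in \<Omega>. \<bar>H k (\<lambda>t. (st t w, act t w))\<bar> \<le> cD\<^sup>2" if "k \<le> T" for k
    proof -
      have "AE w in \<Omega>. norm (fst (?run T k w)) \<le> R \<and> norm (snd (?run T k w)) \<le> R"
        using iterates_bounded[OF T, of k] that by simp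
      then show ?thesis
        unfolding Hrun by eventually_elim (use cD(2)[of "()"] in \<open>simp add: power_mono\<close>)
    qed
    have avg1: "integrable \<Omega> (\<lambda>w. (norm (td.D (fst (?run T (M w) w))))\<^sup>2)"
      using random_index_average(1)[OF ri T H Hb] by (simp only: Hrun)
    have avg2: "(\<integral>w. (norm (td.D (fst (?run T (M w) w))))\<^sup>2 \<partial>\<Omega>)
        = (\<Sum>t\<le>T. \<integral>w. (norm (td.D (fst (?run T t w))))\<^sup>2 \<partial>\<Omega>) / (real T + 1)"
      using random_index_average(2)[OF ri T H Hb] by (simp only: Hrun)
    obtain \<tau> where \<tau>: "error_budget (stepsize T a 0) (stepsize T b 0) T (real \<tau>) (\<rho> ^ \<tau>) / (real T + 1)
      \<le> K2 * (1 / real T powr (1 - a) + ln (real T) / real T powr (min b (a - b)))" (is "?Q / _ \<le> K2 * ?rate")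
      using K2[OF T] by blast
    have T1: "1 \<le> real T" using T by simp
    have pos: "0 < stepsize T a 0" and ab: "stepsize T a 0 \<le> stepsize T b 0" and b1: "stepsize T b 0 \<le> 1"
      using T1 exponents by (auto simp: stepsize_def intro!: divide_left_mono powr_mono ge_one_powr_ge_zero)
    have "(\<Sum>t\<le>T. \<integral>w. (norm (td.D (fst (?run T t w))))\<^sup>2 \<partial>\<Omega>) \<le> K1 * ?Q"
    proof (rule bound[of _ _ _ "\<lambda>t w. fst (?run T t w)" "\<lambda>t w. snd (?run T t w)", OF pos ab b1], unfold td.gq_process_def, intro conjI)
      show "\<forall>t. (\<lambda>w. fst (?run T t w)) \<in> borel_measurable \<Omega>" "\<forall>t. (\<lambda>w. snd (?run T t w)) \<in> borel_measurable \<Omega>"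
        by (auto intro!: measurable_compose[OF run_meas] simp: borel_prod[symmetric])
      show "\<forall>t\<le>Suc T. AE w in \<Omega>. norm (fst (?run T t w)) \<le> R \<and> norm (snd (?run T t w)) \<le> R"
        using iterates_bounded[OF T] by blast
      show "\<forall>t. \<forall>w\<in>space \<Omega>. fst (?run T (Suc t) w) = fst (?run T t w)
          + stepsize T a 0 *\<^sub>R td.G (fst (?run T t w)) (snd (?run T t w)) (X t w)"
        unfolding gq_run_def greedy_gq_Suc X_def stepsize_def by (intro allI ballI refl)
      show "\<forall>t. \<forall>w\<in>space \<Omega>. snd (?run T (Suc t) w) = snd (?run T t w)
          + stepsize T b 0 *\<^sub>R td.H (fst (?run T t w)) (snd (?run T t w)) (X t w)"
        unfolding gq_run_def greedy_gq_Suc X_def stepsize_def by (intro allI ballI refl)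
      show "td.mixing_bound \<Omega> X (\<lambda>t w. (fst (?run T t w), snd (?run T t w))) (2 * (m + 1)) \<rho>"
        using mix by simp
    qed
    then have "(\<Sum>t\<le>T. \<integral>w. (norm (td.D (fst (?run T t w))))\<^sup>2 \<partial>\<Omega>) / (real T + 1) \<le> K1 * ?Q / (real T + 1)"
      by (rule divide_right_mono) simp
    also have "\<dots> = K1 * (?Q / (real T + 1))" by simp
    also have "\<dots> \<le> K1 * (K2 * ?rate)" using \<tau> K1 by (rule mult_left_mono)
    finally have "(\<integral>w. (norm (td.D (fst (?run T (M w) w))))\<^sup>2 \<partial>\<Omega>) \<le> K1 * K2 * ?rate"
      by (simp only: avg2 mult.assoc)
    with avg1 show "integrable \<Omega> (\<lambda>w. (norm (td.D (fst (?run T (M w) w))))\<^sup>2) \<and>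
      (\<integral>w. (norm (td.D (fst (?run T (M w) w))))\<^sup>2 \<partial>\<Omega>) \<le> K1 * K2 * ?rate" by blast
  qed
qed

end

theorem theorem1:
  fixes S :: "(real^'d::finite) set"
    and P :: "(real^'d) \<times> 'a::finite \<Rightarrow> (real^'d) measure"
    and \<gamma> rmax m \<rho> k1 k2 R a b :: real
    and r :: "('d, 'a) reward"
    and \<phi> :: "('d, 'a, 'n::finite) features"
    and pib :: "real^'d \<Rightarrow> 'a pmf"
    and \<pi> :: "('d, 'a, 'n) policy_family"
    and \<mu> :: "((real^'d) \<times> 'a) measure"
    and s0 :: "real^'d" and \<theta>0 \<omega>0 :: "real^'n"
    and \<Omega> :: "'w measure"
    and st :: "nat \<Rightarrow> 'w \<Rightarrow> real^'d" and act :: "nat \<Rightarrow> 'w \<Rightarrow> 'a"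
  assumes kernel: "P \<in> sa_space S \<rightarrow>\<^sub>M prob_algebra (state_space S)"
    and discount: "0 < \<gamma>" "\<gamma> < 1"
    and reward_measurable:
      "(\<lambda>((s, a), s'). r s a s') \<in> borel_measurable (sa_space S \<Otimes>\<^sub>M state_space S)"
    and reward_bounds:
      "\<And>s a s'. s \<in> S \<Longrightarrow> s' \<in> S \<Longrightarrow> 0 \<le> r s a s' \<and> r s a s' \<le> rmax"
    and features_measurable: "\<And>a. (\<lambda>s. \<phi> s a) \<in> borel_measurable (state_space S)"
    and behavior_measurable: "measurable_policy S pib"
    and target_measurable: "\<And>\<theta>. measurable_policy S (\<pi> \<theta>)"
    and target_differentiable:
      "\<And>\<theta> s a. s \<in> S \<Longrightarrow> (\<lambda>\<eta>. pmf (\<pi> \<eta> s) a) differentiable (at \<theta>)"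
    and ergodic: "uniformly_ergodic (sa_space S) (sa_kernel S P pib) \<mu>"
    and cov_nonsingular: "invertible (feature_cov \<mu> \<phi>)"
    and features_bounded: "\<And>s a. s \<in> S \<Longrightarrow> norm (\<phi> s a) \<le> 1"
    and mixing_constants: "m > 0" "0 < \<rho>" "\<rho> < 1"
    and mixing:
      "\<And>t. t > 0 \<Longrightarrow>
         (SUP s\<in>S. tv_dist (kernel_pow (state_space S) (state_kernel P pib) t s)
                           (distr \<mu> (state_space S) fst)) \<le> m * \<rho> ^ t"
    and policy_gradient_bounded:
      "\<And>\<theta> s a. s \<in> S \<Longrightarrow> norm (grad (\<lambda>\<eta>. pmf (\<pi> \<eta> s) a) \<theta>) \<le> k1"
    and policy_gradient_lipschitz:
      "\<And>\<theta>1 \<theta>2 s a. s \<in> S \<Longrightarrow>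
         norm (grad (\<lambda>\<eta>. pmf (\<pi> \<eta> s) a) \<theta>1 - grad (\<lambda>\<eta>. pmf (\<pi> \<eta> s) a) \<theta>2)
           \<le> k2 * norm (\<theta>1 - \<theta>2)"
    and initial_state: "s0 \<in> S"
    and probability: "prob_space \<Omega>"
    and trajectory: "behavior_trajectory \<Omega> S P pib s0 st act"
    and exponents: "1/2 < a" "a \<le> 1" "0 < b" "b \<le> a"
    and iterates_bounded:
      "\<And>T t. T > 0 \<Longrightarrow> t \<le> Suc T \<Longrightarrow>
         (AE x in \<Omega>. norm (fst (gq_run r \<gamma> \<phi> \<pi> a b \<theta>0 \<omega>0 st act T t x)) \<le> R \<and>
                     norm (snd (gq_run r \<gamma> \<phi> \<pi> a b \<theta>0 \<omega>0 st act T t x)) \<le> R)"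
  shows "\<exists>K. \<forall>T>0. \<forall>M. random_index \<Omega> S st act (stepsize T a) T M \<longrightarrow>
     integrable \<Omega> (\<lambda>x. (norm (grad (MSPBE S P \<mu> r \<gamma> \<phi> \<pi>)
                 (fst (gq_run r \<gamma> \<phi> \<pi> a b \<theta>0 \<omega>0 st act T (M x) x))))\<^sup>2) \<and>
     (\<integral>x. (norm (grad (MSPBE S P \<mu> r \<gamma> \<phi> \<pi>)
                 (fst (gq_run r \<gamma> \<phi> \<pi> a b \<theta>0 \<omega>0 st act T (M x) x))))\<^sup>2 \<partial>\<Omega>)
       \<le> K * (1 / real T powr (1 - a) + ln (real T) / real T powr (min b (a - b)))"
proof -
  interpret gq_model \<Omega> S P pib \<mu> s0 st act m \<rho> r \<gamma> rmax k1 k2 \<phi> \<pi>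
  proof (intro gq_model.intro behavior_chain.intro behavior_chain_axioms.intro gq_model_axioms.intro probability)
    show "invariant_measure (sa_space S) (sa_kernel S P pib) \<mu>"
      using ergodic by (simp add: uniformly_ergodic_def)
  qed (use assms in \<open>auto intro: less_imp_le\<close>)
  show ?thesis
    by (rule greedy_gq_rate) (use exponents iterates_bounded in auto)
qed

end
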